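(* Let $E$ be a fully symmetric Banach space either on the interval $(0,1)$ or on the semi-axis $(0,\infty)$ and let $x\in E$. Suppose that the norm on $E$ is a Fatou norm. If $\varphi(y)\le\varphi(x)$ for every positive symmetric functional $\varphi$ on $E$ and every $0\le y\prec\prec x$, then $$\lim_{m\to\infty}\frac1m\|\sigma_m(\mu(x))\|_E=0,$$ provided that one of the following conditions is satisfied: (1) $E=E(0,1)$ is a space on the interval $(0,1)$; (2) $E=E(0,\infty)$ is a space on the semi-axis and $E(0,\infty)\not\subset L_1(0,\infty)$.
   Context: Let $I=(0,1)$ or $I=(0,\infty)$ with Lebesgue measure. For a measurable function $x$ on $I$, $\mu(t,x)=\inf\{s\ge0:\ |\{|x|>s\}|\le t\}$ is its decreasing rearrangement; $y\prec\prec x$ means $\int_0^t\mu(s,y)ds\le\int_0^t\mu(s,x)ds$ for all $t\ge0$. A fully symmetric Banach space $E$ on $I$ is a Banach space of (real-valued) functions $E\subset(L_1+L_\infty)(I)$ such that $x\in E$, $y\in(L_1+L_\infty)(I)$ and $y\prec\prec x$ imply $y\in E$ and $\|y\|_E\le\|x\|_E$. The norm on $E$ is a Fatou norm if the unit ball of $E$ is closed with respect to almost everywhere convergence (i.e. if $\|x_n\|_E\le1$ and $x_n\to x$ a.e., then $x\in E$ and $\|x\|_E\le1$). For $m\in\mathbb{N}$, $(\sigma_mx)(t)=x(t/m)$ for $t\in I$. A linear functional $\varphi$ on $E$ is symmetric if $\varphi(y)=\varphi(x)$ for all $0\le x,y\in E$ with $\mu(y)=\mu(x)$. *)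

theory Defs
  imports "HOL-Analysis.Analysis"
begin

text \<open>
  A measurable function on an interval \<open>I\<close> with Lebesgue measure is represented by a function
  \<open>real \<Rightarrow> real\<close> that is measurable with respect to \<^term>\<open>lebesgue_on I\<close>. Values outside \<open>I\<close> are
  irrelevant, and functions that agree almost everywhere on \<open>I\<close> represent the same element, so
  equality, order and convergence below are all understood almost everywhere on \<open>I\<close>.
\<close>

definition L1_plus_Linf :: "real set \<Rightarrow> (real \<Rightarrow> real) set" where
  "L1_plus_Linf I = {x \<in> borel_measurable (lebesgue_on I).
     \<exists>g h C. integrable (lebesgue_on I) g
       \<and> h \<in> borel_measurable (lebesgue_on I) \<and> (AE t in lebesgue_on I. \<bar>h t\<bar> \<le> C)
       \<and> (AE t in lebesgue_on I. x t = g t + h t)}"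

text \<open>
  For \<open>x\<close> in \<open>L\<^sub>1 + L\<^sub>\<infinity>\<close> the set below is nonempty for every \<open>t > 0\<close>. At \<open>t = 0\<close> it is empty if
  \<open>x\<close> is unbounded (the rearrangement is then infinite, which a real infimum does not express),
  so the rearrangement is used for \<open>t > 0\<close> only. On \<open>(0,1)\<close> it vanishes for \<open>t \<ge> 1\<close>.
\<close>

definition rearr :: "real set \<Rightarrow> (real \<Rightarrow> real) \<Rightarrow> real \<Rightarrow> real" where
  "rearr I x t = Inf {s. 0 \<le> s \<and> emeasure lebesgue {u \<in> I. s < \<bar>x u\<bar>} \<le> ennreal t}"

definition submajorized :: "real set \<Rightarrow> (real \<Rightarrow> real) \<Rightarrow> (real \<Rightarrow> real) \<Rightarrow> bool" where
  "submajorized I y x \<longleftrightarrow> (\<forall>t\<ge>0.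
     (\<integral>\<^sup>+s\<in>{0<..<t}. ennreal (rearr I y s) \<partial>lborel) \<le> (\<integral>\<^sup>+s\<in>{0<..<t}. ennreal (rearr I x s) \<partial>lborel))"

definition dilation :: "nat \<Rightarrow> (real \<Rightarrow> real) \<Rightarrow> real \<Rightarrow> real" where
  "dilation m x = (\<lambda>t. x (t / real m))"

definition banach_function_space ::
    "real set \<Rightarrow> (real \<Rightarrow> real) set \<Rightarrow> ((real \<Rightarrow> real) \<Rightarrow> real) \<Rightarrow> bool" where
  "banach_function_space I E N \<longleftrightarrow>
     E \<subseteq> L1_plus_Linf I
   \<and> (\<forall>x\<in>E. \<forall>y\<in>borel_measurable (lebesgue_on I). (AE t in lebesgue_on I. y t = x t) \<longrightarrow> y \<in> E)
   \<and> (\<lambda>t. 0) \<in> E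
   \<and> (\<forall>x\<in>E. \<forall>y\<in>E. (\<lambda>t. x t + y t) \<in> E)
   \<and> (\<forall>c. \<forall>x\<in>E. (\<lambda>t. c * x t) \<in> E)
   \<and> (\<forall>x\<in>E. 0 \<le> N x)
   \<and> (\<forall>x\<in>E. N x = 0 \<longleftrightarrow> (AE t in lebesgue_on I. x t = 0))
   \<and> (\<forall>x\<in>E. \<forall>y\<in>E. N (\<lambda>t. x t + y t) \<le> N x + N y)
   \<and> (\<forall>c. \<forall>x\<in>E. N (\<lambda>t. c * x t) = \<bar>c\<bar> * N x)
   \<and> (\<forall>X::nat \<Rightarrow> real \<Rightarrow> real. (\<forall>n. X n \<in> E) \<longrightarrow>
        (\<forall>e>0. \<exists>M. \<forall>m\<ge>M. \<forall>n\<ge>M. N (\<lambda>t. X m t - X n t) < e) \<longrightarrow>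
        (\<exists>x\<in>E. (\<lambda>n. N (\<lambda>t. X n t - x t)) \<longlonglongrightarrow> 0))"

definition fully_symmetric_space ::
    "real set \<Rightarrow> (real \<Rightarrow> real) set \<Rightarrow> ((real \<Rightarrow> real) \<Rightarrow> real) \<Rightarrow> bool" where
  "fully_symmetric_space I E N \<longleftrightarrow> banach_function_space I E N
   \<and> (\<forall>x\<in>E. \<forall>y\<in>L1_plus_Linf I. submajorized I y x \<longrightarrow> y \<in> E \<and> N y \<le> N x)"

definition fatou_norm ::
    "real set \<Rightarrow> (real \<Rightarrow> real) set \<Rightarrow> ((real \<Rightarrow> real) \<Rightarrow> real) \<Rightarrow> bool" where
  "fatou_norm I E N \<longleftrightarrow>
     (\<forall>(X::nat \<Rightarrow> real \<Rightarrow> real). \<forall>x\<in>borel_measurable (lebesgue_on I).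
        (\<forall>n. X n \<in> E \<and> N (X n) \<le> 1) \<longrightarrow>
        (AE t in lebesgue_on I. (\<lambda>n. X n t) \<longlonglongrightarrow> x t) \<longrightarrow>
        x \<in> E \<and> N x \<le> 1)"

definition linear_functional_on ::
    "real set \<Rightarrow> (real \<Rightarrow> real) set \<Rightarrow> ((real \<Rightarrow> real) \<Rightarrow> real) \<Rightarrow> bool" where
  "linear_functional_on I E \<phi> \<longleftrightarrow>
     (\<forall>x\<in>E. \<forall>y\<in>E. (AE t in lebesgue_on I. x t = y t) \<longrightarrow> \<phi> x = \<phi> y)
   \<and> (\<forall>x\<in>E. \<forall>y\<in>E. \<phi> (\<lambda>t. x t + y t) = \<phi> x + \<phi> y)
   \<and> (\<forall>c. \<forall>x\<in>E. \<phi> (\<lambda>t. c * x t) = c * \<phi> x)"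

definition positive_functional_on ::
    "real set \<Rightarrow> (real \<Rightarrow> real) set \<Rightarrow> ((real \<Rightarrow> real) \<Rightarrow> real) \<Rightarrow> bool" where
  "positive_functional_on I E \<phi> \<longleftrightarrow>
     (\<forall>x\<in>E. (AE t in lebesgue_on I. 0 \<le> x t) \<longrightarrow> 0 \<le> \<phi> x)"

definition symmetric_functional_on ::
    "real set \<Rightarrow> (real \<Rightarrow> real) set \<Rightarrow> ((real \<Rightarrow> real) \<Rightarrow> real) \<Rightarrow> bool" where
  "symmetric_functional_on I E \<phi> \<longleftrightarrow> linear_functional_on I E \<phi>
   \<and> (\<forall>x\<in>E. \<forall>y\<in>E. (AE t in lebesgue_on I. 0 \<le> x t) \<longrightarrow> (AE t in lebesgue_on I. 0 \<le> y t) \<longrightarrow>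
        (\<forall>t>0. rearr I y t = rearr I x t) \<longrightarrow> \<phi> y = \<phi> x)"

end

theory Submission
  imports Defs
begin

text \<open>
  Write \<open>X(t)\<close> for the integral over \<open>(0,t)\<close> of the rearrangement \<open>\<mu>(x)\<close>, and likewise \<open>Y, U, V, D\<close> for
  functions \<open>y, u, v, e\<close> (the function \<open>mass\<close> below). The numbers \<open>\<parallel>\<sigma>\<^sub>m \<mu>(x)\<parallel> / m\<close> decrease in \<open>m\<close>, because
  \<open>\<sigma>\<^sub>m \<mu>(x) / m\<close> has mass \<open>X(t/m)\<close>. If they do not tend to zero, they are at least some \<open>c > 0\<close>, and
  the hypothesis fails for a suitable \<open>y \<prec>\<prec> x\<close>, as follows.

  \<^emph>\<open>What the hypothesis gives.\<close> Call positive \<open>u, v\<close> in \<open>E\<close> equivalent if \<open>U(t) \<le> V(Lt)\<close> and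
  \<open>V(t) \<le> U(Lt)\<close> for some \<open>L\<close> and all \<open>t\<close>. Equimeasurable functions are equivalent, and equivalent pairs
  form a cone. The infimum of \<open>N e\<close> over all positive \<open>e\<close> with \<open>z \<le> u - v + e\<close> is a sublinear functional
  of \<open>z\<close>, and every linear functional below it is positive and symmetric. By the Hahn-Banach theorem the
  infimum vanishes at \<open>z = y - x\<close>; so \<open>y + v \<le> x + u + e\<close> with \<open>N e\<close> as small as desired
  (\<open>symmetric_functionals_detect\<close>). Comparing masses (\<open>core_inequality\<close>), for large \<open>k\<close> and \<open>a \<le> b\<close>,

  \<open>Y(b) - Y(ka) \<le> X(kb) - X(a) + D(kb) - D(a) + (V(kb) - V(b)) + (U(ka) - U(a))\<close>.

  The auxiliary \<open>u\<close> and \<open>v\<close> are not controlled, but they enter only through increments over one factor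
  \<open>k\<close>. Summing over \<open>k\<close> values of \<open>a\<close> and \<open>b\<close> in geometric progression telescopes these increments and
  divides their contribution by \<open>k\<close>.

  \<^emph>\<open>The choice of y.\<close> Let \<open>y\<close> be \<open>\<mu>(x)\<close> averaged over cells between consecutive sparse nodes. Inside a
  cell \<open>y\<close> is constant, so at least half of its mass there lies between \<open>t/2\<close> and \<open>t\<close>, where \<open>t\<close> is the
  right end point, and hence near a node. For \<open>\<mu>(x)\<close>, by contrast, one can arrange that it has little mass near
  the nodes: each node is picked by the pigeonhole principle among \<open>k\<close> candidates (\<open>sparse_block\<close>). The inequality at a node then
  bounds the mass of the preceding cell by twice the increment of \<open>H = D + (X + U + V) / k\<close> over the
  block of that node. Adding up over a window of cells, \<open>X\<close>, up to a dilation by a fixed power of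
  the block ratio and up to the mass below the window, is at most \<open>2H\<close> (\<open>window_increments\<close>). Hence the
  spread of \<open>\<mu>(x)\<close> restricted to the window has norm at most \<open>2 (N e + (N x + N u + N v) / k)\<close>
  (\<open>spread_window_mass_le\<close>).

  \<^emph>\<open>The windows.\<close> Since \<open>y\<close> comes first and \<open>u, v, e, L\<close> afterwards, \<open>y\<close> needs infinitely many disjoint
  windows, the one with index \<open>k\<close> built with parameter \<open>k + 2\<close>, and on each of them the spread of
  \<open>\<mu>(x)\<close> must have norm at least \<open>c / 4\<close> (\<open>separated_windows\<close>). They are found one after another. The part of
  \<open>\<mu>(x)\<close> on a compact interval is bounded with bounded support, and its spreads tend to zero in norm: this is
  obvious on \<open>(0,1)\<close>, while on the half-line a failure would put \<open>E\<close> inside \<open>L\<^sub>1\<close> (\<open>bump_spread_null\<close>).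
  So the spreads stay large on one of the two sides of whatever has been used already, and the Fatou property
  shrinks that side to a window with end points in \<open>I\<close> (\<open>truncated_window\<close>). For a large index the two bounds on the norm
  contradict each other.
\<close>

section \<open>Level integrals and the decreasing rearrangement\<close>

lemma sigma_finite_lebesgue: "sigma_finite_measure (lebesgue :: real measure)"
proof -
  obtain C :: "real set set" where C: "countable C" "C \<subseteq> sets lborel" "\<Union>C = space lborel" "\<forall>a\<in>C. emeasure lborel a \<noteq> \<infinity>"
    using lborel.sigma_finite_countable by blast
  have "C \<subseteq> sets lebesgue" using C(2) by auto
  moreover have "\<forall>a\<in>C. emeasure lebesgue a \<noteq> \<infinity>"
    using C(2,4) by (auto simp: emeasure_completion)
  ultimately show ?thesis
    using C(1,3) by (intro sigma_finite_measure.intro exI[of _ C]) auto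
qed

text \<open>
  Fubini's theorem for the region between the level \<open>s\<close> and the graph of \<open>\<bar>f\<bar>\<close>. It turns statements about
  distribution functions into statements about level integrals.
\<close>
lemma layer_cake:
  assumes "sigma_finite_measure M" and [measurable]: "f \<in> borel_measurable M"
  shows "(\<integral>\<^sup>+u. ennreal (\<bar>f u\<bar> - s) \<partial>M) = (\<integral>\<^sup>+r\<in>{s<..}. emeasure M {u \<in> space M. r < \<bar>f u\<bar>} \<partial>lborel)"
proof -
  interpret M: sigma_finite_measure M by fact
  interpret pair_sigma_finite M lborel ..
  \<comment> \<open>Indicator of the region between the level and the graph.\<close>
  define h :: "_ \<Rightarrow> real \<Rightarrow> ennreal" where "h u r = indicator {r. s < r \<and> r < \<bar>f u\<bar>} r" for u r
  have hm: "case_prod h \<in> borel_measurable (M \<Otimes>\<^sub>M lborel)" unfolding h_def by measurable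
  have "(\<integral>\<^sup>+u. ennreal (\<bar>f u\<bar> - s) \<partial>M) = (\<integral>\<^sup>+u. (\<integral>\<^sup>+r. h u r \<partial>lborel) \<partial>M)"
  proof (rule nn_integral_cong)
    fix u
    have "(\<integral>\<^sup>+r. h u r \<partial>lborel) = (\<integral>\<^sup>+r. indicator {s<..<\<bar>f u\<bar>} r \<partial>lborel)"
      unfolding h_def by (intro nn_integral_cong) (auto simp: indicator_def)
    also have "\<dots> = emeasure lborel {s<..<\<bar>f u\<bar>}" by simp
    also have "\<dots> = ennreal (\<bar>f u\<bar> - s)"
      by (cases "s \<le> \<bar>f u\<bar>") (auto simp: ennreal_neg)
    finally show "ennreal (\<bar>f u\<bar> - s) = (\<integral>\<^sup>+r. h u r \<partial>lborel)" by simp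
  qed
  also have "\<dots> = (\<integral>\<^sup>+r. (\<integral>\<^sup>+u. h u r \<partial>M) \<partial>lborel)"
    using Fubini'[OF hm] by simp
  also have "\<dots> = (\<integral>\<^sup>+r\<in>{s<..}. emeasure M {u \<in> space M. r < \<bar>f u\<bar>} \<partial>lborel)"
  proof (rule nn_integral_cong)
    fix r :: real
    have "(\<integral>\<^sup>+u. h u r \<partial>M) = (\<integral>\<^sup>+u. indicator {s<..} r * indicator {u \<in> space M. r < \<bar>f u\<bar>} u \<partial>M)"
      unfolding h_def by (intro nn_integral_cong) (auto simp: indicator_def)
    also have "\<dots> = indicator {s<..} r * emeasure M {u \<in> space M. r < \<bar>f u\<bar>}"
      by (subst nn_integral_cmult) auto
    finally show "(\<integral>\<^sup>+u. h u r \<partial>M) = emeasure M {u \<in> space M. r < \<bar>f u\<bar>} * indicator {s<..} r"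
      by (simp add: mult.commute)
  qed
  finally show ?thesis .
qed

text \<open>
  Since \<open>ennreal\<close> sends negative numbers to zero, this is the integral of \<open>(\<bar>f\<bar> - s)\<^sub>+\<close>. It is a level
  integral that can be estimated without any reference to the rearrangement.
\<close>
definition excess :: "real set \<Rightarrow> (real \<Rightarrow> real) \<Rightarrow> real \<Rightarrow> ennreal" where
  "excess I f s = (\<integral>\<^sup>+u. ennreal (\<bar>f u\<bar> - s) \<partial>lebesgue_on I)"

definition rearr_mass :: "real set \<Rightarrow> (real \<Rightarrow> real) \<Rightarrow> real \<Rightarrow> ennreal" where
  "rearr_mass I f t = (\<integral>\<^sup>+s\<in>{0<..<t}. ennreal (rearr I f s) \<partial>lborel)"

text \<open>
  The value at non-positive arguments is fixed so that the function is Borel on the whole line.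
\<close>
definition pos_rearr :: "real set \<Rightarrow> (real \<Rightarrow> real) \<Rightarrow> real \<Rightarrow> real" where
  "pos_rearr I f t = (if 0 < t then rearr I f t else 0)"

locale unit_or_half_line =
  fixes I :: "real set"
  assumes I_cases: "I = {0<..<1} \<or> I = {0<..}"
begin

lemma I_borel [measurable, simp]: "I \<in> sets borel" using I_cases by auto
lemma I_leb [simp]: "I \<in> sets lebesgue" "I \<inter> space lebesgue \<in> sets lebesgue" by auto
lemma I_pos: "t \<in> I \<Longrightarrow> 0 < t" using I_cases by auto
lemma I_down: "t \<in> I \<Longrightarrow> 0 < s \<Longrightarrow> s \<le> t \<Longrightarrow> s \<in> I" using I_cases by auto
lemma space_I [simp]: "space (lebesgue_on I) = I" by (simp add: space_restrict_space)

lemma sigma_finite_I: "sigma_finite_measure (lebesgue_on I)"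
  by (rule sigma_finite_measure_restrict_space[OF sigma_finite_lebesgue]) auto

definition distrib :: "(real \<Rightarrow> real) \<Rightarrow> real \<Rightarrow> ennreal" where
  "distrib f s = emeasure lebesgue {u \<in> I. s < \<bar>f u\<bar>}"

abbreviation meas :: "(real \<Rightarrow> real) \<Rightarrow> bool" where
  "meas f \<equiv> f \<in> borel_measurable (lebesgue_on I)"

lemma borel_meas: "f \<in> borel_measurable borel \<Longrightarrow> meas f"
  by (intro measurable_restrict_space1 measurable_completion) simp

lemma distrib_set:
  assumes "meas f" shows "{u \<in> I. s < \<bar>f u\<bar>} \<in> sets lebesgue"
proof -
  have "{u \<in> space (lebesgue_on I). s < \<bar>f u\<bar>} \<in> sets (lebesgue_on I)" using assms by measurable
  then show ?thesis by (auto simp: sets_restrict_space_iff)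
qed

lemma distrib_on:
  assumes "meas f" shows "emeasure (lebesgue_on I) {u \<in> I. s < \<bar>f u\<bar>} = distrib f s"
  unfolding distrib_def by (rule emeasure_restrict_space) auto

lemma excess_distrib:
  assumes "meas f"
  shows "excess I f s = (\<integral>\<^sup>+r\<in>{s<..}. distrib f r \<partial>lborel)"
  unfolding excess_def using layer_cake[OF sigma_finite_I assms, of s] distrib_on[OF assms] by simp

lemma distrib_antimono: "meas f \<Longrightarrow> r \<le> s \<Longrightarrow> distrib f s \<le> distrib f r"
  unfolding distrib_def by (rule emeasure_mono) (auto intro: distrib_set)

lemma distrib_markov:
  assumes "meas f" "r < s" shows "ennreal (s - r) * distrib f s \<le> excess I f r"
proof -
  have "ennreal (s - r) * distrib f s = (\<integral>\<^sup>+u. ennreal (s - r) * indicator {u \<in> I. s < \<bar>f u\<bar>} u \<partial>lebesgue_on I)"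
    using assms(1) by (subst nn_integral_cmult_indicator) (auto simp: distrib_on distrib_set sets_restrict_space_iff)
  also have "\<dots> \<le> excess I f r" unfolding excess_def
    by (intro nn_integral_mono) (auto simp: indicator_def intro!: ennreal_leI)
  finally show ?thesis .
qed

text \<open>
  Cutting \<open>f\<close> off at height \<open>s\<close> splits it into a bounded and an integrable part, so membership in
  \<open>L\<^sub>1 + L\<^sub>\<infinity>\<close> is a condition on level integrals.
\<close>
lemma L1_plus_Linf_iff:
  "f \<in> L1_plus_Linf I \<longleftrightarrow> meas f \<and> (\<exists>s\<ge>0. excess I f s < \<infinity>)"
proof
  assume f: "f \<in> L1_plus_Linf I"
  then have mf: "meas f" unfolding L1_plus_Linf_def by auto
  from f obtain g h C where gh: "integrable (lebesgue_on I) g"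
     "AE t in lebesgue_on I. \<bar>h t\<bar> \<le> C" "AE t in lebesgue_on I. f t = g t + h t"
    unfolding L1_plus_Linf_def by auto
  have "excess I f (max C 0) \<le> (\<integral>\<^sup>+u. ennreal (norm (g u)) \<partial>lebesgue_on I)"
    unfolding excess_def by (rule nn_integral_mono_AE, use gh(2,3) in eventually_elim) (auto intro!: ennreal_leI)
  also have "\<dots> < \<infinity>" using gh(1) by (simp add: integrable_iff_bounded)
  finally show "meas f \<and> (\<exists>s\<ge>0. excess I f s < \<infinity>)" using mf by (intro conjI exI[of _ "max C 0"]) auto
next
  assume "meas f \<and> (\<exists>s\<ge>0. excess I f s < \<infinity>)"
  then obtain s where s[measurable]: "meas f" "s \<ge> 0" "excess I f s < \<infinity>" by auto
  define h where "h u = max (-s) (min s (f u))" for u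
  define g where "g u = f u - h u" for u
  have [measurable]: "meas h" "meas g" unfolding h_def g_def by measurable
  have "(\<integral>\<^sup>+u. ennreal (norm (g u)) \<partial>lebesgue_on I) \<le> excess I f s"
    unfolding excess_def g_def h_def using s(2) by (intro nn_integral_mono) (auto intro!: ennreal_leI simp: max_def min_def ennreal_neg)
  then have "integrable (lebesgue_on I) g" using s(3) by (simp add: integrable_iff_bounded)
  then show "f \<in> L1_plus_Linf I" unfolding L1_plus_Linf_def
    using s by (intro CollectI conjI exI[of _ g] exI[of _ h] exI[of _ s]) (auto simp: g_def h_def)
qed

lemma L1_plus_Linf_measD: "f \<in> L1_plus_Linf I \<Longrightarrow> meas f" by (simp add: L1_plus_Linf_iff)

lemma excess_mono_fun:
  assumes "AE u in lebesgue_on I. \<bar>f u\<bar> \<le> \<bar>g u\<bar>" shows "excess I f s \<le> excess I g s"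
  unfolding excess_def by (rule nn_integral_mono_AE, use assms in eventually_elim) (auto intro!: ennreal_leI)

lemma excess_le_in_L1_plus_Linf:
  assumes "meas f" "g \<in> L1_plus_Linf I" "\<And>s. s \<ge> 0 \<Longrightarrow> excess I f s \<le> excess I g s"
  shows "f \<in> L1_plus_Linf I"
  using assms unfolding L1_plus_Linf_iff by (meson order_le_less_trans)

text \<open>
  The infimum that defines the rearrangement is taken over a nonempty set at every positive time.
\<close>
lemma distrib_small:
  assumes "f \<in> L1_plus_Linf I" "t > 0"
  shows "\<exists>s\<ge>0. distrib f s \<le> ennreal t"
proof -
  obtain r where r: "meas f" "r \<ge> 0" "excess I f r < \<infinity>" using assms(1) by (auto simp: L1_plus_Linf_iff)
  define e where "e = enn2real (excess I f r)"
  have e: "excess I f r = ennreal e" "e \<ge> 0" using r(3) by (auto simp: e_def)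
  \<comment> \<open>By Markov's inequality the distribution function at this level is at most \<open>t\<close>;
     the summand one keeps the level strictly above \<open>r\<close>.\<close>
  define s where "s = r + (e + 1) / t"
  have rs: "r < s" using assms(2) e by (simp add: s_def add_nonneg_pos)
  have "distrib f s = ennreal (1 / (s - r)) * (ennreal (s - r) * distrib f s)"
    using rs by (simp add: mult.assoc[symmetric] ennreal_mult[symmetric])
  also have "\<dots> \<le> ennreal (1 / (s - r)) * ennreal e"
    using distrib_markov[OF r(1) rs] e by (intro mult_left_mono) auto
  also have "\<dots> = ennreal (e / (s - r))" using rs e by (simp add: ennreal_mult[symmetric])
  also have "\<dots> \<le> ennreal t" using assms(2) e(2) by (intro ennreal_leI) (simp add: s_def field_simps)
  finally show ?thesis using r(2) rs by (intro exI[of _ s]) auto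
qed

lemma rearr_set_eq: "rearr I f t = Inf {s. 0 \<le> s \<and> distrib f s \<le> ennreal t}"
  by (simp add: rearr_def distrib_def)

lemma rearr_nonneg:
  assumes "f \<in> L1_plus_Linf I" "t > 0" shows "0 \<le> rearr I f t"
  unfolding rearr_set_eq using distrib_small[OF assms] by (intro cInf_greatest) auto

text \<open>
  The strict inequality on the right persists at a slightly higher level, since the distribution function is
  right continuous; hence the infimum lies strictly above \<open>s\<close>.
\<close>
lemma rearr_greater_iff:
  assumes f: "f \<in> L1_plus_Linf I" and t: "t > 0" and s: "s \<ge> 0"
  shows "s < rearr I f t \<longleftrightarrow> ennreal t < distrib f s"
proof
  assume "s < rearr I f t"
  then have "s \<notin> {s. 0 \<le> s \<and> distrib f s \<le> ennreal t}"
    unfolding rearr_set_eq by (metis (no_types, lifting) bdd_below.I cInf_lower leD mem_Collect_eq)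
  then show "ennreal t < distrib f s" using s by auto
next
  assume less: "ennreal t < distrib f s"
  have mf: "meas f" by (rule L1_plus_Linf_measD[OF f])
  have "(\<lambda>n. emeasure lebesgue {u \<in> I. s + 1 / real (Suc n) < \<bar>f u\<bar>}) \<longlonglongrightarrow> emeasure lebesgue (\<Union>n. {u \<in> I. s + 1 / real (Suc n) < \<bar>f u\<bar>})"
  proof (rule Lim_emeasure_incseq)
    show "range (\<lambda>n. {u \<in> I. s + 1 / real (Suc n) < \<bar>f u\<bar>}) \<subseteq> sets lebesgue"
      using distrib_set[OF mf] by auto
    have "s + 1 / real (Suc n) < r \<Longrightarrow> m \<ge> n \<Longrightarrow> s + 1 / real (Suc m) < r" for m n r
      by (smt (verit) Suc_le_mono frac_le of_nat_0_less_iff of_nat_le_iff zero_less_Suc)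
    then show "incseq (\<lambda>n. {u \<in> I. s + 1 / real (Suc n) < \<bar>f u\<bar>})"
      unfolding incseq_def by blast
  qed
  also have "(\<Union>n. {u \<in> I. s + 1 / real (Suc n) < \<bar>f u\<bar>}) = {u \<in> I. s < \<bar>f u\<bar>}"
  proof -
    have "\<exists>n. s + 1 / real (Suc n) < r" if "s < r" for r
      using reals_Archimedean[of "r - s"] that by (auto simp: field_simps)
    moreover have "s < r" if "s + 1 / real (Suc n) < r" for r n
      using that by (smt (verit) divide_pos_pos of_nat_0_less_iff zero_less_Suc)
    ultimately show ?thesis by blast
  qed
  finally have "(\<lambda>n. distrib f (s + 1 / real (Suc n))) \<longlonglongrightarrow> distrib f s" by (simp add: distrib_def)
  from order_tendstoD(1)[OF this less] obtain n where n: "ennreal t < distrib f (s + 1 / real (Suc n))"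
    by (auto simp: eventually_sequentially)
  have "s < s + 1 / real (Suc n)" by simp
  also have "\<dots> \<le> rearr I f t" unfolding rearr_set_eq
  proof (rule cInf_greatest)
    show "{s. 0 \<le> s \<and> distrib f s \<le> ennreal t} \<noteq> {}" using distrib_small[OF f t] by auto
    fix r assume "r \<in> {s. 0 \<le> s \<and> distrib f s \<le> ennreal t}"
    then show "s + 1 / real (Suc n) \<le> r" using n distrib_antimono[OF mf, of r "s + 1 / real (Suc n)"] by force
  qed
  finally show "s < rearr I f t" .
qed

lemma rearr_antimono:
  assumes "f \<in> L1_plus_Linf I" "0 < t" "t \<le> t'" shows "rearr I f t' \<le> rearr I f t"
proof (rule ccontr)
  assume "\<not> ?thesis"
  then have "rearr I f t < rearr I f t'" by simp
  then have "ennreal t' < distrib f (rearr I f t)"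
    using rearr_greater_iff assms rearr_nonneg by auto
  moreover have "\<not> ennreal t < distrib f (rearr I f t)"
    using rearr_greater_iff[of f t "rearr I f t"] assms rearr_nonneg by auto
  moreover have "ennreal t \<le> ennreal t'" using assms by (simp add: ennreal_leI)
  ultimately show False by order
qed

lemma pos_rearr_borel:
  assumes "f \<in> L1_plus_Linf I" shows "pos_rearr I f \<in> borel_measurable borel"
proof -
  have "mono_on {0<..} (\<lambda>t. - pos_rearr I f t)"
    using rearr_antimono[OF assms] by (auto simp: mono_on_def pos_rearr_def)
  moreover have "mono_on {..0} (\<lambda>t. - pos_rearr I f t)" by (auto simp: mono_on_def pos_rearr_def)
  ultimately have "(\<lambda>t. - pos_rearr I f t) \<in> borel_measurable borel"
    by (intro borel_measurable_piecewise_mono[of "{{0<..},{..0}}"]) auto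
  then have "(\<lambda>t. - (- pos_rearr I f t)) \<in> borel_measurable borel" by measurable
  then show ?thesis by simp
qed

lemma pos_rearr_nonneg: "f \<in> L1_plus_Linf I \<Longrightarrow> 0 \<le> pos_rearr I f t"
  by (simp add: pos_rearr_def rearr_nonneg)

lemma emeasure_ennreal_below: "emeasure lborel {t::real. 0 < t \<and> ennreal t < d} = d"
proof (cases d)
  case (real r)
  have "{t::real. 0 < t \<and> ennreal t < d} = {0<..<r}" using real by (auto simp: ennreal_less_iff)
  then show ?thesis using real by simp
next
  case top
  then have eq: "{t::real. 0 < t \<and> ennreal t < d} = {0<..}" by auto
  have "emeasure lborel {0::real<..} \<ge> emeasure lborel {0<..<real n}" for n
    by (rule emeasure_mono) auto
  then have "emeasure lborel {0::real<..} \<ge> of_nat n" for n by (simp add: ennreal_of_nat_eq_real_of_nat)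
  then have "emeasure lborel {0::real<..} = top"
    by (metis ennreal_Ex_less_of_nat leD linorder_not_less top.not_eq_extremum)
  then show ?thesis using eq top by simp
qed

text \<open>
  A function and its rearrangement have the same distribution function, so the layer cake formula gives them
  the same level integrals.
\<close>
lemma excess_rearr:
  assumes f: "f \<in> L1_plus_Linf I" and s: "s \<ge> 0"
  shows "excess I f s = (\<integral>\<^sup>+t. ennreal (pos_rearr I f t - s) \<partial>lborel)"
proof -
  note pos_rearr_borel[OF f, measurable]
  have "(\<integral>\<^sup>+t. ennreal (pos_rearr I f t - s) \<partial>lborel) = (\<integral>\<^sup>+t. ennreal (\<bar>pos_rearr I f t\<bar> - s) \<partial>lborel)"
    using pos_rearr_nonneg[OF f] by simp
  also have "\<dots> = (\<integral>\<^sup>+r\<in>{s<..}. emeasure lborel {u \<in> space lborel. r < \<bar>pos_rearr I f u\<bar>} \<partial>lborel)"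
    by (rule layer_cake) (auto intro: lborel.sigma_finite_measure_axioms)
  also have "\<dots> = (\<integral>\<^sup>+r\<in>{s<..}. distrib f r \<partial>lborel)"
  proof (rule nn_integral_cong)
    fix r :: real
    have "emeasure lborel {u \<in> space lborel. r < \<bar>pos_rearr I f u\<bar>} = distrib f r" if "r > s"
    proof -
      have "{u \<in> space lborel. r < \<bar>pos_rearr I f u\<bar>} = {t. 0 < t \<and> ennreal t < distrib f r}"
        using that s rearr_greater_iff[OF f, of _ r] rearr_nonneg[OF f] by (auto simp: pos_rearr_def)
      then show ?thesis by (simp add: emeasure_ennreal_below)
    qed
    then show "emeasure lborel {u \<in> space lborel. r < \<bar>pos_rearr I f u\<bar>} * indicator {s<..} r = distrib f r * indicator {s<..} r"
      by (auto simp: indicator_def)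
  qed
  also have "\<dots> = excess I f s" using excess_distrib L1_plus_Linf_measD[OF f] by simp
  finally show ?thesis by simp
qed

lemma rearr_mass_pos: "rearr_mass I f t = (\<integral>\<^sup>+s\<in>{0<..<t}. ennreal (pos_rearr I f s) \<partial>lborel)"
  unfolding rearr_mass_def pos_rearr_def by (intro nn_integral_cong) (auto simp: indicator_def)

text \<open>
  Together with the next lemma: the integral of the rearrangement over \<open>(0,t)\<close> is the minimum over
  \<open>s\<close> of \<open>ts + excess I f s\<close>, a Legendre transform. All later facts about rearrangements of sums, dilations
  and truncations are read off from this formula.
\<close>
lemma rearr_mass_le:
  assumes f: "f \<in> L1_plus_Linf I" and s: "s \<ge> 0" and t: "t > 0"
  shows "rearr_mass I f t \<le> ennreal (t * s) + excess I f s"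
proof -
  note pos_rearr_borel[OF f, measurable]
  have "rearr_mass I f t \<le> (\<integral>\<^sup>+u. ennreal s * indicator {0<..<t} u + ennreal (pos_rearr I f u - s) \<partial>lborel)"
    unfolding rearr_mass_pos using s
    by (intro nn_integral_mono) (auto simp: indicator_def ennreal_plus_if simp del: ennreal_plus intro!: ennreal_leI)
  also have "\<dots> = ennreal (t * s) + excess I f s"
    using s t by (subst nn_integral_add) (auto simp: nn_integral_cmult_indicator excess_rearr[OF f s] ennreal_mult'' mult.commute)
  finally show ?thesis .
qed

text \<open>
  The minimum is attained at \<open>s = rearr I f t\<close>, because the rearrangement is at least \<open>s\<close> before time \<open>t\<close>
  and at most \<open>s\<close> from then on.
\<close>
lemma rearr_mass_attained:
  assumes f: "f \<in> L1_plus_Linf I" and t: "t > 0"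
  shows "\<exists>s\<ge>0. rearr_mass I f t = ennreal (t * s) + excess I f s"
proof (intro exI[of _ "rearr I f t"] conjI)
  note pos_rearr_borel[OF f, measurable]
  let ?s = "rearr I f t"
  show s: "0 \<le> ?s" by (rule rearr_nonneg[OF f t])
  have "rearr_mass I f t \<ge> (\<integral>\<^sup>+u. ennreal ?s * indicator {0<..<t} u + ennreal (pos_rearr I f u - ?s) * indicator {0<..<t} u \<partial>lborel)"
    unfolding rearr_mass_pos using s rearr_antimono[OF f, of _ t]
    by (intro nn_integral_mono) (auto simp: indicator_def ennreal_plus_if pos_rearr_def simp del: ennreal_plus intro!: ennreal_leI)
  also have "(\<integral>\<^sup>+u. ennreal ?s * indicator {0<..<t} u + ennreal (pos_rearr I f u - ?s) * indicator {0<..<t} u \<partial>lborel)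
     = ennreal (t * ?s) + (\<integral>\<^sup>+u. ennreal (pos_rearr I f u - ?s) * indicator {0<..<t} u \<partial>lborel)"
    using s t by (subst nn_integral_add) (auto simp: nn_integral_cmult_indicator ennreal_mult'' mult.commute)
  also have "(\<integral>\<^sup>+u. ennreal (pos_rearr I f u - ?s) * indicator {0<..<t} u \<partial>lborel) = (\<integral>\<^sup>+u. ennreal (pos_rearr I f u - ?s) \<partial>lborel)"
    using rearr_antimono[OF f, of t] s t
    by (intro nn_integral_cong) (auto simp: indicator_def pos_rearr_def ennreal_neg)
  also have "\<dots> = excess I f ?s" using excess_rearr[OF f s] by simp
  finally show "rearr_mass I f t = ennreal (t * ?s) + excess I f ?s"
    using rearr_mass_le[OF f s t] by (intro antisym)
qed

end

section \<open>The mass of a rearrangement on an initial interval\<close>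

context unit_or_half_line
begin

abbreviation L1Linf :: "(real \<Rightarrow> real) set" where "L1Linf \<equiv> L1_plus_Linf I"

text \<open>
  This is the K-functional of the couple \<open>(L\<^sub>1, L\<^sub>\<infinity>)\<close>, as a real number.
\<close>
definition mass :: "(real \<Rightarrow> real) \<Rightarrow> real \<Rightarrow> real" where
  "mass f t = enn2real (rearr_mass I f t)"

lemma ennreal_mass:
  assumes f: "f \<in> L1Linf" and t: "t > 0" shows "ennreal (mass f t) = rearr_mass I f t"
proof -
  obtain s where s: "s \<ge> 0" "excess I f s < \<infinity>" using f by (auto simp: L1_plus_Linf_iff)
  have "rearr_mass I f t \<le> ennreal (t * s) + excess I f s" by (rule rearr_mass_le[OF f s(1) t])
  also have "\<dots> < top" using s(2) by auto
  finally show ?thesis by (simp add: mass_def)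
qed

lemma mass_nonneg [simp]: "0 \<le> mass f t" by (simp add: mass_def)

lemma mass_le:
  assumes f: "f \<in> L1Linf" and "t > 0" "s \<ge> 0" "e \<ge> 0" "excess I f s \<le> ennreal e"
  shows "mass f t \<le> t * s + e"
proof -
  have "ennreal (mass f t) \<le> ennreal (t * s) + ennreal e"
    unfolding ennreal_mass[OF f assms(2)] using rearr_mass_le[OF f assms(3,2)] assms(5)
    by (meson add_left_mono order_trans)
  also have "\<dots> = ennreal (t * s + e)" using assms by simp
  finally show ?thesis using assms by (subst (asm) ennreal_le_iff) auto
qed

lemma mass_attained:
  assumes f: "f \<in> L1Linf" and t: "t > 0"
  obtains s e where "s \<ge> 0" "e \<ge> 0" "excess I f s = ennreal e" "mass f t = t * s + e"
proof -
  obtain s where s: "s \<ge> 0" "rearr_mass I f t = ennreal (t * s) + excess I f s"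
    using rearr_mass_attained[OF f t] by auto
  then have *: "ennreal (mass f t) = ennreal (t * s) + excess I f s" using ennreal_mass[OF f t] by simp
  then have "excess I f s < top" by (metis ennreal_add_eq_top ennreal_neq_top top.not_eq_extremum)
  then obtain e where e: "e \<ge> 0" "excess I f s = ennreal e" by (cases "excess I f s") auto
  have "ennreal (mass f t) = ennreal (t * s + e)" using * e s t by (simp add: ennreal_plus)
  then have "mass f t = t * s + e" using e s t by (subst (asm) ennreal_inj) auto
  then show thesis using that s e by auto
qed

lemma mass_mono: assumes "f \<in> L1Linf" "0 < t" "t \<le> t'" shows "mass f t \<le> mass f t'"
proof -
  have "rearr_mass I f t \<le> rearr_mass I f t'" unfolding rearr_mass_def
    using assms(3) by (intro nn_integral_mono) (auto simp: indicator_def)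
  then have "ennreal (mass f t) \<le> ennreal (mass f t')" using assms by (simp add: ennreal_mass)
  then show ?thesis by (subst (asm) ennreal_le_iff) auto
qed

lemma submajorizedI:
  assumes "f \<in> L1Linf" "g \<in> L1Linf" "\<And>t. t > 0 \<Longrightarrow> mass f t \<le> mass g t"
  shows "submajorized I f g"
  unfolding submajorized_def
proof (intro allI impI)
  fix t :: real assume "t \<ge> 0"
  show "(\<integral>\<^sup>+ s\<in>{0<..<t}. ennreal (rearr I f s)\<partial>lborel) \<le> (\<integral>\<^sup>+ s\<in>{0<..<t}. ennreal (rearr I g s)\<partial>lborel)"
  proof (cases "t = 0")
    case False
    then have "t > 0" using \<open>t \<ge> 0\<close> by simp
    have "ennreal (mass f t) \<le> ennreal (mass g t)" using assms(3)[OF \<open>t > 0\<close>] by (rule ennreal_leI)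
    then show ?thesis using assms(1,2) \<open>t > 0\<close> by (simp add: ennreal_mass rearr_mass_def)
  qed simp
qed

text \<open>
  The minimum formula is monotone in the level integrals. In this form submajorization is checked below for
  averages and dilations.
\<close>
lemma mass_mono_excess:
  assumes f: "f \<in> L1Linf" and g: "g \<in> L1Linf" and t: "t > 0"
    and le: "\<And>s. s \<ge> 0 \<Longrightarrow> excess I f s \<le> excess I g s"
  shows "mass f t \<le> mass g t"
proof -
  obtain s e where s: "s \<ge> 0" "e \<ge> 0" "excess I g s = ennreal e" "mass g t = t * s + e"
    using mass_attained[OF g t] .
  then show ?thesis using mass_le[OF f t s(1,2)] le[OF s(1)] by simp
qed

lemma meas_add: "meas f \<Longrightarrow> meas g \<Longrightarrow> meas (\<lambda>t. f t + g t)" by measurable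

lemma excess_measurable:
  assumes [measurable]: "meas f" shows "(\<lambda>u. ennreal (\<bar>f u\<bar> - s)) \<in> borel_measurable (lebesgue_on I)"
  by measurable

text \<open>
  From \<open>(p + q - s - r)\<^sub>+ \<le> (p - s)\<^sub>+ + (q - r)\<^sub>+\<close>; it yields the subadditivity of the mass.
\<close>
lemma excess_add:
  assumes "meas f" "meas g"
  shows "excess I (\<lambda>u. f u + g u) (s + r) \<le> excess I f s + excess I g r"
proof -
  have "excess I (\<lambda>u. f u + g u) (s + r) \<le> (\<integral>\<^sup>+u. ennreal (\<bar>f u\<bar> - s) + ennreal (\<bar>g u\<bar> - r) \<partial>lebesgue_on I)"
    unfolding excess_def
    by (intro nn_integral_mono) (auto simp: ennreal_plus_if simp del: ennreal_plus intro!: ennreal_leI)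
  also have "\<dots> = excess I f s + excess I g r"
    unfolding excess_def by (intro nn_integral_add excess_measurable assms)
  finally show ?thesis .
qed

text \<open>
  For \<open>p, q \<ge> 0\<close> the convex function \<open>p \<mapsto> (p - s)\<^sub>+\<close>, which vanishes at zero, is superadditive.
\<close>
lemma excess_superadd:
  assumes "meas f" "meas g" "AE u in lebesgue_on I. 0 \<le> f u" "AE u in lebesgue_on I. 0 \<le> g u" "s \<ge> 0"
  shows "excess I f s + excess I g s \<le> excess I (\<lambda>u. f u + g u) s"
proof -
  have "excess I f s + excess I g s = (\<integral>\<^sup>+u. ennreal (\<bar>f u\<bar> - s) + ennreal (\<bar>g u\<bar> - s) \<partial>lebesgue_on I)"
    unfolding excess_def by (intro nn_integral_add[symmetric] excess_measurable assms)
  also have "\<dots> \<le> excess I (\<lambda>u. f u + g u) s" unfolding excess_def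
    by (intro nn_integral_mono_AE, use assms(3,4) in eventually_elim)
       (use assms(5) in \<open>auto simp: ennreal_plus_if simp del: ennreal_plus intro!: ennreal_leI\<close>)
  finally show ?thesis .
qed

lemma excess_cmult:
  assumes "meas f" "c > 0" shows "excess I (\<lambda>u. c * f u) (c * s) = ennreal c * excess I f s"
proof -
  have "\<bar>c * f u\<bar> - c * s = c * (\<bar>f u\<bar> - s)" for u using assms(2) by (simp add: abs_mult algebra_simps)
  then have "excess I (\<lambda>u. c * f u) (c * s) = (\<integral>\<^sup>+u. ennreal c * ennreal (\<bar>f u\<bar> - s) \<partial>lebesgue_on I)"
    unfolding excess_def using assms(2) by (simp add: ennreal_mult')
  also have "\<dots> = ennreal c * excess I f s" unfolding excess_def
    by (intro nn_integral_cmult excess_measurable assms)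
  finally show ?thesis .
qed

lemma L1Linf_add:
  assumes "f \<in> L1Linf" "g \<in> L1Linf" shows "(\<lambda>t. f t + g t) \<in> L1Linf"
proof -
  obtain s r where "s \<ge> 0" "excess I f s < \<infinity>" "r \<ge> 0" "excess I g r < \<infinity>"
    using assms by (auto simp: L1_plus_Linf_iff)
  moreover from this have "excess I f s + excess I g r < \<infinity>" by simp
  ultimately show ?thesis using excess_add[of f g s r] assms(1,2) meas_add[of f g] unfolding L1_plus_Linf_iff
    by (meson add_nonneg_nonneg order_le_less_trans)
qed

lemma mass_add_le:
  assumes f: "f \<in> L1Linf" and g: "g \<in> L1Linf" and t: "t > 0"
  shows "mass (\<lambda>u. f u + g u) t \<le> mass f t + mass g t"
proof -
  obtain s e where s: "s \<ge> 0" "e \<ge> 0" "excess I f s = ennreal e" "mass f t = t * s + e"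
    using mass_attained[OF f t] .
  obtain r d where r: "r \<ge> 0" "d \<ge> 0" "excess I g r = ennreal d" "mass g t = t * r + d"
    using mass_attained[OF g t] .
  have "mass (\<lambda>u. f u + g u) t \<le> t * (s + r) + (e + d)"
    using s r excess_add[of f g s r] L1_plus_Linf_measD[OF f] L1_plus_Linf_measD[OF g]
    by (intro mass_le L1Linf_add f g t) auto
  then show ?thesis using s r by (simp add: algebra_simps)
qed

text \<open>
  A converse to subadditivity up to a factor two in time: optimal sets for \<open>f\<close> and for \<open>g\<close> at time \<open>t\<close>
  have a union of measure at most \<open>2t\<close>. In the proof
  the minimizing level for the sum at time \<open>2t\<close> is inserted for \<open>f\<close> and for \<open>g\<close> at time \<open>t\<close>.
\<close>
lemma mass_add_ge:
  assumes f: "f \<in> L1Linf" and g: "g \<in> L1Linf" and t: "t > 0"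
    and nonneg: "AE u in lebesgue_on I. 0 \<le> f u" "AE u in lebesgue_on I. 0 \<le> g u"
  shows "mass f t + mass g t \<le> mass (\<lambda>u. f u + g u) (2 * t)"
proof -
  have t2: "2 * t > 0" using t by simp
  obtain s e where s: "s \<ge> 0" "e \<ge> 0" "excess I (\<lambda>u. f u + g u) s = ennreal e"
      "mass (\<lambda>u. f u + g u) (2 * t) = 2 * t * s + e"
    using mass_attained[OF L1Linf_add[OF f g] t2] .
  have *: "excess I f s + excess I g s \<le> ennreal e"
    using excess_superadd[OF L1_plus_Linf_measD[OF f] L1_plus_Linf_measD[OF g] nonneg s(1)] s(3) by simp
  have fin: "excess I f s < top" "excess I g s < top"
    using * by (auto simp: less_top[symmetric] top_unique)
  then obtain a b where ab: "excess I f s = ennreal a" "excess I g s = ennreal b" "a \<ge> 0" "b \<ge> 0"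
    by (cases "excess I f s"; cases "excess I g s") auto
  have "a + b \<le> e" using * ab s(2) by (simp add: ennreal_plus[symmetric] del: ennreal_plus)
  moreover have "mass f t \<le> t * s + a" "mass g t \<le> t * s + b"
    using ab s by (auto intro!: mass_le f g t)
  ultimately show ?thesis using s(4) by simp
qed

lemma L1Linf_cmult: assumes "f \<in> L1Linf" shows "(\<lambda>t. c * f t) \<in> L1Linf"
proof (cases "c = 0")
  case True
  show ?thesis using True by (auto simp: L1_plus_Linf_iff excess_def intro!: exI[of _ 0])
next
  case False
  obtain s where s: "s \<ge> 0" "excess I f s < \<infinity>" "meas f" using assms by (auto simp: L1_plus_Linf_iff)
  have "excess I (\<lambda>u. c * f u) (\<bar>c\<bar> * s) = excess I (\<lambda>u. \<bar>c\<bar> * f u) (\<bar>c\<bar> * s)"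
    by (simp add: excess_def abs_mult)
  also have "\<dots> < \<infinity>" using s False by (simp add: excess_cmult ennreal_mult_less_top)
  finally show ?thesis using s by (auto simp: L1_plus_Linf_iff intro!: exI[of _ "\<bar>c\<bar> * s"])
qed

lemma mass_cmult_le:
  assumes f: "f \<in> L1Linf" and t: "t > 0" and c: "c > 0"
  shows "mass (\<lambda>u. c * f u) t \<le> c * mass f t"
proof -
  obtain s e where s: "s \<ge> 0" "e \<ge> 0" "excess I f s = ennreal e" "mass f t = t * s + e"
    using mass_attained[OF f t] .
  have "mass (\<lambda>u. c * f u) t \<le> t * (c * s) + c * e"
    using s c by (intro mass_le L1Linf_cmult f t) (auto simp: excess_cmult L1_plus_Linf_measD[OF f] ennreal_mult)
  then show ?thesis using s by (simp add: algebra_simps)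
qed

lemma mass_cmult:
  assumes f: "f \<in> L1Linf" and t: "t > 0" and c: "c > 0"
  shows "mass (\<lambda>u. c * f u) t = c * mass f t"
proof -
  have "mass (\<lambda>u. (1/c) * (c * f u)) t \<le> (1/c) * mass (\<lambda>u. c * f u) t"
    using c by (intro mass_cmult_le L1Linf_cmult f t) auto
  then show ?thesis using mass_cmult_le[OF f t c] c by (simp add: field_simps)
qed

text \<open>
  The mass is a minimum of affine functions of \<open>t\<close> with nonnegative value at zero, so \<open>mass f t / t\<close>
  decreases.
\<close>
lemma mass_concave:
  assumes f: "f \<in> L1Linf" and t: "0 < t" "t \<le> \<tau>"
  shows "t / \<tau> * mass f \<tau> \<le> mass f t"
proof -
  obtain s e where s: "s \<ge> 0" "e \<ge> 0" "excess I f s = ennreal e" "mass f t = t * s + e"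
    using mass_attained[OF f t(1)] .
  have "mass f \<tau> \<le> \<tau> * s + e" using s t by (intro mass_le f) auto
  then have "t / \<tau> * mass f \<tau> \<le> t / \<tau> * (\<tau> * s + e)" using t by (intro mult_left_mono) auto
  also have "\<dots> = t * s + t / \<tau> * e" using t by (simp add: field_simps)
  also have "\<dots> \<le> t * s + e" using t s(2) mult_right_mono[of "t / \<tau>" 1 e] by simp
  finally show ?thesis using s(4) by simp
qed

lemma rearr_mono_fun:
  assumes f: "f \<in> L1Linf" and g: "g \<in> L1Linf" and le: "AE u in lebesgue_on I. \<bar>f u\<bar> \<le> \<bar>g u\<bar>" and t: "t > 0"
  shows "rearr I f t \<le> rearr I g t"
proof -
  have "distrib f s \<le> distrib g s" for s
    unfolding distrib_on[OF L1_plus_Linf_measD[OF f], symmetric] distrib_on[OF L1_plus_Linf_measD[OF g], symmetric]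
    using le distrib_set[OF L1_plus_Linf_measD[OF g], of s]
    by (intro emeasure_mono_AE) (auto simp: sets_restrict_space_iff elim!: eventually_mono)
  then show ?thesis unfolding rearr_set_eq using distrib_small[OF g t]
    by (intro cInf_superset_mono) (auto intro: order_trans)
qed

lemma rearr_mass_split:
  assumes f: "f \<in> L1Linf" and "0 < u" "u \<le> v"
  shows "rearr_mass I f v = rearr_mass I f u + (\<integral>\<^sup>+s\<in>{u..<v}. ennreal (pos_rearr I f s) \<partial>lborel)"
proof -
  note pos_rearr_borel[OF f, measurable]
  have "rearr_mass I f v = (\<integral>\<^sup>+s. ennreal (pos_rearr I f s) * indicator {0<..<u} s + ennreal (pos_rearr I f s) * indicator {u..<v} s \<partial>lborel)"
    unfolding rearr_mass_pos using assms by (intro nn_integral_cong) (auto simp: indicator_def)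
  also have "\<dots> = rearr_mass I f u + (\<integral>\<^sup>+s\<in>{u..<v}. ennreal (pos_rearr I f s) \<partial>lborel)"
    unfolding rearr_mass_pos by (rule nn_integral_add) auto
  finally show ?thesis .
qed

text \<open>
  If \<open>\<bar>f\<bar> \<le> \<bar>g\<bar>\<close> then the rearrangements are ordered pointwise, so not only the masses but also their
  increments are ordered. The inequality is written without subtraction.
\<close>
lemma mass_increment_mono:
  assumes f: "f \<in> L1Linf" and g: "g \<in> L1Linf" and le: "AE u in lebesgue_on I. \<bar>f u\<bar> \<le> \<bar>g u\<bar>"
    and uv: "0 < u" "u \<le> v"
  shows "mass f v + mass g u \<le> mass g v + mass f u"
proof -
  have v: "0 < v" using uv by simp
  have "(\<integral>\<^sup>+s\<in>{u..<v}. ennreal (pos_rearr I f s) \<partial>lborel) \<le> (\<integral>\<^sup>+s\<in>{u..<v}. ennreal (pos_rearr I g s) \<partial>lborel)"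
    using rearr_mono_fun[OF f g le] by (intro nn_integral_mono) (auto simp: indicator_def pos_rearr_def intro!: ennreal_leI)
  then have "rearr_mass I f v + rearr_mass I g u \<le> rearr_mass I g v + rearr_mass I f u"
    unfolding rearr_mass_split[OF f uv] rearr_mass_split[OF g uv]
    by (simp add: add.assoc add_left_mono add.commute add.left_commute)
  then have "ennreal (mass f v + mass g u) \<le> ennreal (mass g v + mass f u)"
    using uv v f g by (simp add: ennreal_mass[symmetric] del: ennreal_plus flip: ennreal_plus)
  then show ?thesis by (subst (asm) ennreal_le_iff) (auto intro: add_nonneg_nonneg)
qed

lemma excess_borel:
  assumes [measurable]: "f \<in> borel_measurable borel"
  shows "excess I f s = (\<integral>\<^sup>+u\<in>I. ennreal (\<bar>f u\<bar> - s) \<partial>lborel)"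
  unfolding excess_def by (subst nn_integral_restrict_space) (auto simp: nn_integral_completion)

lemma emeasure_initial: "t > 0 \<Longrightarrow> emeasure lborel ({0<..<t} \<inter> I) \<le> ennreal t"
  by (rule order_trans[OF emeasure_mono[of _ "{0<..<t}"]]) auto

text \<open>
  The easy half of the Hardy-Littlewood inequality, for initial intervals only.
\<close>
lemma integral_le_rearr_mass:
  assumes [measurable]: "f \<in> borel_measurable borel" and f: "f \<in> L1Linf" and t: "t > 0"
  shows "(\<integral>\<^sup>+u\<in>{0<..<t} \<inter> I. ennreal (f u) \<partial>lborel) \<le> rearr_mass I f t"
proof -
  obtain s where s: "s \<ge> 0" "rearr_mass I f t = ennreal (t * s) + excess I f s"
    using rearr_mass_attained[OF f t] by auto
  have "(\<integral>\<^sup>+u\<in>{0<..<t} \<inter> I. ennreal (f u) \<partial>lborel) \<le>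
    (\<integral>\<^sup>+u. ennreal s * indicator ({0<..<t} \<inter> I) u + ennreal (\<bar>f u\<bar> - s) * indicator I u \<partial>lborel)"
    using s(1) by (intro nn_integral_mono) (auto simp: indicator_def ennreal_plus_if simp del: ennreal_plus intro!: ennreal_leI)
  also have "\<dots> = ennreal s * emeasure lborel ({0<..<t} \<inter> I) + excess I f s"
    by (subst nn_integral_add) (auto simp: nn_integral_cmult_indicator excess_borel)
  also have "\<dots> \<le> ennreal s * ennreal t + excess I f s" using emeasure_initial[OF t] by (intro add_mono mult_left_mono) auto
  also have "\<dots> = rearr_mass I f t" using s t by (simp add: ennreal_mult mult.commute)
  finally show ?thesis .
qed

text \<open>
  For a decreasing function the level \<open>f t\<close> in the minimum formula leaves exactly the integral of \<open>f\<close>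
  over \<open>(0,t)\<close>. For \<open>t\<close> beyond the end of \<open>I\<close> the level zero does.
\<close>
lemma rearr_mass_le_integral:
  assumes [measurable]: "f \<in> borel_measurable borel" and f: "f \<in> L1Linf" and t: "t > 0"
    and nonneg: "\<And>t. t > 0 \<Longrightarrow> 0 \<le> f t" and dec: "\<And>s t. 0 < s \<Longrightarrow> s \<le> t \<Longrightarrow> f t \<le> f s"
  shows "rearr_mass I f t \<le> (\<integral>\<^sup>+u\<in>{0<..<t} \<inter> I. ennreal (f u) \<partial>lborel)"
proof (cases "t \<in> I")
  case True
  then have sub: "{0<..<t} \<inter> I = {0<..<t}" using I_down by auto
  have "rearr_mass I f t \<le> ennreal (t * f t) + excess I f (f t)" using nonneg[OF t] by (intro rearr_mass_le f t)
  also have "excess I f (f t) = (\<integral>\<^sup>+u. ennreal (f u - f t) * indicator {0<..<t} u \<partial>lborel)"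
    unfolding excess_borel[OF assms(1)] using dec[of t] t dec[of _ t] nonneg sub I_pos
    by (intro nn_integral_cong) (auto simp: indicator_def ennreal_neg)
  also have "ennreal (t * f t) = (\<integral>\<^sup>+u. ennreal (f t) * indicator {0<..<t} u \<partial>lborel)"
    using t nonneg[OF t] by (subst nn_integral_cmult_indicator) (auto simp: ennreal_mult mult.commute)
  also have "\<dots> + (\<integral>\<^sup>+u. ennreal (f u - f t) * indicator {0<..<t} u \<partial>lborel)
     = (\<integral>\<^sup>+u. ennreal (f t) * indicator {0<..<t} u + ennreal (f u - f t) * indicator {0<..<t} u \<partial>lborel)"
    by (rule nn_integral_add[symmetric]) auto
  also have "\<dots> = (\<integral>\<^sup>+u\<in>{0<..<t} \<inter> I. ennreal (f u) \<partial>lborel)"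
    unfolding sub using dec[of _ t] nonneg t
    by (intro nn_integral_cong) (auto simp: indicator_def ennreal_plus[symmetric] simp del: ennreal_plus)
  finally show ?thesis .
next
  case False
  then have sub: "{0<..<t} \<inter> I = I" using I_down[of _ t] t I_pos I_cases by auto
  have "rearr_mass I f t \<le> ennreal (t * 0) + excess I f 0" by (intro rearr_mass_le f t) auto
  also have "\<dots> = (\<integral>\<^sup>+u\<in>I. ennreal (f u) \<partial>lborel)"
    using nonneg I_pos by (auto simp: excess_borel intro!: nn_integral_cong simp: indicator_def)
  finally show ?thesis using sub by simp
qed

lemma pos_rearr_outside:
  assumes f: "f \<in> L1Linf" and "t \<notin> I" shows "pos_rearr I f t = 0"
proof (cases "t > 0")
  case True
  then have I: "I = {0<..<1}" "t \<ge> 1" using assms(2) I_cases by auto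
  have "distrib f 0 \<le> emeasure lebesgue {0<..<1::real}"
    unfolding distrib_def using I by (intro emeasure_mono) auto
  also have "\<dots> = ennreal 1" by simp
  also have "\<dots> \<le> ennreal t" using I by (intro ennreal_leI)
  finally have "\<not> 0 < rearr I f t" using rearr_greater_iff[OF f True, of 0] by auto
  then show ?thesis using rearr_nonneg[OF f True] True by (simp add: pos_rearr_def)
qed (simp add: pos_rearr_def)

lemma pos_rearr_antimono: "f \<in> L1Linf \<Longrightarrow> 0 < s \<Longrightarrow> s \<le> t \<Longrightarrow> pos_rearr I f t \<le> pos_rearr I f s"
  by (simp add: pos_rearr_def rearr_antimono)

lemma excess_pos_rearr:
  assumes f: "f \<in> L1Linf" and "s \<ge> 0" shows "excess I (pos_rearr I f) s = excess I f s"
  unfolding excess_borel[OF pos_rearr_borel[OF f]] excess_rearr[OF assms]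
  using pos_rearr_outside[OF f] pos_rearr_nonneg[OF f] assms(2)
  by (intro nn_integral_cong) (auto simp: indicator_def ennreal_neg)

lemma pos_rearr_L1Linf: assumes f: "f \<in> L1Linf" shows "pos_rearr I f \<in> L1Linf"
  by (rule excess_le_in_L1_plus_Linf[OF borel_meas[OF pos_rearr_borel[OF f]] f]) (simp add: excess_pos_rearr f)

end

section \<open>A Hahn-Banach theorem for spaces of real functions\<close>

definition function_subspace :: "('a \<Rightarrow> real) set \<Rightarrow> bool" where
  "function_subspace E \<longleftrightarrow> (\<lambda>t. 0) \<in> E \<and> (\<forall>x\<in>E. \<forall>y\<in>E. (\<lambda>t. x t + y t) \<in> E) \<and> (\<forall>c. \<forall>x\<in>E. (\<lambda>t. c * x t) \<in> E)"

text \<open>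
  Only one inequality is demanded for positive multiples; equality follows by scaling back.
\<close>
definition sublinear_on :: "('a \<Rightarrow> real) set \<Rightarrow> (('a \<Rightarrow> real) \<Rightarrow> real) \<Rightarrow> bool" where
  "sublinear_on E q \<longleftrightarrow> (\<forall>x\<in>E. \<forall>y\<in>E. q (\<lambda>t. x t + y t) \<le> q x + q y) \<and> (\<forall>c>0. \<forall>x\<in>E. q (\<lambda>t. c * x t) \<le> c * q x)"

lemma function_subspaceD:
  assumes "function_subspace E"
  shows "(\<lambda>t. 0) \<in> E" "x \<in> E \<Longrightarrow> y \<in> E \<Longrightarrow> (\<lambda>t. x t + y t) \<in> E" "x \<in> E \<Longrightarrow> (\<lambda>t. c * x t) \<in> E" "x \<in> E \<Longrightarrow> (\<lambda>t. - x t) \<in> E"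
proof -
  show "(\<lambda>t. - x t) \<in> E" if "x \<in> E"
  proof -
    have "(\<lambda>t. (-1) * x t) \<in> E" using assms that unfolding function_subspace_def by blast
    then show ?thesis by simp
  qed
qed (use assms in \<open>auto simp: function_subspace_def\<close>)

lemma sublinear_homogeneous:
  assumes E: "function_subspace E" and q: "sublinear_on E q" and "c > 0" "x \<in> E"
  shows "q (\<lambda>t. c * x t) = c * q x"
proof -
  have le: "q (\<lambda>t. d * y t) \<le> d * q y" if "d > 0" "y \<in> E" for d y
    using q that by (auto simp: sublinear_on_def)
  have "q (\<lambda>t. (1/c) * (c * x t)) \<le> (1/c) * q (\<lambda>t. c * x t)"
    using assms(3) function_subspaceD(3)[OF E assms(4)] by (intro le) auto
  then have "c * q x \<le> q (\<lambda>t. c * x t)" using assms(3) by (simp add: field_simps)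
  moreover have "q (\<lambda>t. c * x t) \<le> c * q x" using assms by (intro le) auto
  ultimately show ?thesis by simp
qed

lemma sublinear_zero:
  assumes E: "function_subspace E" and q: "sublinear_on E q" shows "q (\<lambda>t. 0) = 0"
  using sublinear_homogeneous[OF E q, of 2 "\<lambda>t. 0"] function_subspaceD(1)[OF E] by simp

lemma sublinear_minus:
  assumes E: "function_subspace E" and q: "sublinear_on E q" and x: "x \<in> E"
  shows "- q (\<lambda>t. - x t) \<le> q x"
proof -
  have "q (\<lambda>t. x t + (- x t)) \<le> q x + q (\<lambda>t. - x t)"
    using q x function_subspaceD(4)[OF E x] unfolding sublinear_on_def by (elim conjE) (drule bspec, assumption)+
  then show ?thesis using sublinear_zero[OF E q] by simp
qed

text \<open>
  Replacing \<open>q x\<close> by the infimum of \<open>q (x + r z) - r q z\<close> over \<open>r \<ge> 0\<close> lowers a sublinear functional and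
  makes it linear along \<open>z\<close>. Hence a minimal sublinear functional is linear. The value zero outside \<open>E\<close>
  makes the pointwise order antisymmetric, as Zorn's lemma requires.
\<close>
lemma sublinear_descent:
  assumes E: "function_subspace E" and q: "sublinear_on E q" and z: "z \<in> E"
  obtains q' where "sublinear_on E q'" "\<And>x. x \<in> E \<Longrightarrow> q' x \<le> q x" "q' (\<lambda>t. - z t) \<le> - q z" "\<And>x. x \<notin> E \<Longrightarrow> q' x = 0"
proof -
  note D = function_subspaceD[OF E]
  have qadd: "q (\<lambda>t. x t + y t) \<le> q x + q y" if "x \<in> E" "y \<in> E" for x y using q that by (auto simp: sublinear_on_def)
  have qhom: "q (\<lambda>t. c * x t) = c * q x" if "c \<ge> 0" "x \<in> E" for c x
    using sublinear_homogeneous[OF E q, of c x] sublinear_zero[OF E q] that by (cases "c = 0") auto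
  define g where "g x r = q (\<lambda>t. x t + r * z t) - r * q z" for x r
  define q' where "q' x = (if x \<in> E then INF r\<in>{0..}. g x r else 0)" for x
  have low: "- q (\<lambda>t. - x t) \<le> g x r" if "x \<in> E" "r \<ge> 0" for x r
  proof -
    have "q (\<lambda>t. r * z t) \<le> q (\<lambda>t. x t + r * z t) + q (\<lambda>t. - x t)"
      using qadd[of "\<lambda>t. x t + r * z t" "\<lambda>t. - x t"] that D z by (simp add: algebra_simps)
    then show ?thesis using qhom[OF that(2) z] by (simp add: g_def)
  qed
  have bdd: "bdd_below (g x ` {0..})" if "x \<in> E" for x
    using low[OF that] by (intro bdd_belowI[of _ "- q (\<lambda>t. - x t)"]) auto
  have le: "q' x \<le> g x r" if "x \<in> E" "r \<ge> 0" for x r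
    unfolding q'_def using that bdd[OF that(1)] by (auto intro: cINF_lower)
  have ge: "a \<le> q' x" if "x \<in> E" "\<And>r. r \<ge> 0 \<Longrightarrow> a \<le> g x r" for a x
    unfolding q'_def using that by (auto intro: cINF_greatest)
  show thesis
  proof (rule that)
    show "sublinear_on E q'" unfolding sublinear_on_def
    proof (intro conjI ballI allI impI)
      fix x y assume xy: "x \<in> E" "y \<in> E"
      have "q' (\<lambda>t. x t + y t) - g y s \<le> g x r" if "r \<ge> 0" "s \<ge> 0" for r s
      proof -
        have "q' (\<lambda>t. x t + y t) \<le> g (\<lambda>t. x t + y t) (r + s)" using that xy D by (intro le) auto
        also have "\<dots> = q (\<lambda>t. (x t + r * z t) + (y t + s * z t)) - (r + s) * q z"
          unfolding g_def by (simp add: algebra_simps)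
        also have "\<dots> \<le> g x r + g y s"
          unfolding g_def using qadd[of "\<lambda>t. x t + r * z t" "\<lambda>t. y t + s * z t"] xy z D by (simp add: algebra_simps)
        finally show ?thesis by simp
      qed
      then have "q' (\<lambda>t. x t + y t) - g y s \<le> q' x" if "s \<ge> 0" for s using ge[OF xy(1)] that by blast
      then have "q' (\<lambda>t. x t + y t) - q' x \<le> q' y" by (intro ge xy) (simp add: algebra_simps)
      then show "q' (\<lambda>t. x t + y t) \<le> q' x + q' y" by simp
    next
      fix c :: real and x assume c: "c > 0" and x: "x \<in> E"
      have "q' (\<lambda>t. c * x t) / c \<le> g x r" if "r \<ge> 0" for r
      proof -
        have "q' (\<lambda>t. c * x t) \<le> g (\<lambda>t. c * x t) (c * r)" using that x D c by (intro le) auto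
        also have "\<dots> = q (\<lambda>t. c * (x t + r * z t)) - c * r * q z" unfolding g_def by (simp add: algebra_simps)
        also have "\<dots> = c * g x r" using qhom[of c "\<lambda>t. x t + r * z t"] c x z D by (simp add: g_def algebra_simps)
        finally show ?thesis using c by (simp add: field_simps)
      qed
      then have "q' (\<lambda>t. c * x t) / c \<le> q' x" using ge[OF x] by blast
      then show "q' (\<lambda>t. c * x t) \<le> c * q' x" using c by (simp add: field_simps)
    qed
    show "q' x \<le> q x" if "x \<in> E" for x using le[OF that, of 0] by (simp add: g_def)
    show "q' (\<lambda>t. - z t) \<le> - q z" using le[OF D(4)[OF z], of 1] sublinear_zero[OF E q] by (simp add: g_def)
    show "q' x = 0" if "x \<notin> E" for x using that by (simp add: q'_def)
  qed
qed

text \<open>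
  No domain has to be extended: the functional is first lowered along \<open>z0\<close>, which forces the value
  at \<open>z0\<close>, and then a minimal sublinear functional below the result is taken.
\<close>
lemma hahn_banach_functions:
  assumes E: "function_subspace E" and p: "sublinear_on E p" and z0: "z0 \<in> E"
  obtains \<phi> where "\<And>x y. x \<in> E \<Longrightarrow> y \<in> E \<Longrightarrow> \<phi> (\<lambda>t. x t + y t) = \<phi> x + \<phi> y"
    "\<And>c x. x \<in> E \<Longrightarrow> \<phi> (\<lambda>t. c * x t) = c * \<phi> x" "\<And>x. x \<in> E \<Longrightarrow> \<phi> x \<le> p x" "p z0 \<le> \<phi> z0"
proof -
  note D = function_subspaceD[OF E]
  obtain p1 where p1: "sublinear_on E p1" "\<And>x. x \<in> E \<Longrightarrow> p1 x \<le> p x" "p1 (\<lambda>t. - z0 t) \<le> - p z0" "\<And>x. x \<notin> E \<Longrightarrow> p1 x = 0"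
    using sublinear_descent[OF E p z0] by blast
  define A where "A = {q. sublinear_on E q \<and> (\<forall>x\<in>E. q x \<le> p1 x) \<and> (\<forall>x. x \<notin> E \<longrightarrow> q x = 0)}"
  define P where "P a b \<longleftrightarrow> (\<forall>x. b x \<le> (a x :: real))" for a b :: "('a \<Rightarrow> real) \<Rightarrow> real"
  have "\<exists>m\<in>A. \<forall>a\<in>A. P m a \<longrightarrow> a = m"
  proof (rule predicate_Zorn)
    show "partial_order_on A (relation_of P A)"
      by (rule partial_order_on_relation_ofI) (auto simp: P_def fun_eq_iff intro: order_trans antisym)
  next
    fix C assume C: "C \<in> Chains (relation_of P A)"
    then have CA: "C \<subseteq> A" and ch: "\<And>a b. a \<in> C \<Longrightarrow> b \<in> C \<Longrightarrow> P a b \<or> P b a"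
      unfolding Chains_def relation_of_def by auto
    show "\<exists>u\<in>A. \<forall>a\<in>C. P a u"
    proof (cases "C = {}")
      case True then show ?thesis using p1 by (auto simp: A_def)
    next
      case False
      define u where "u x = (if x \<in> E then INF q\<in>C. q x else 0)" for x
      have bdd: "bdd_below ((\<lambda>q. q x) ` C)" if "x \<in> E" for x
      proof (intro bdd_belowI2[of _ "- p1 (\<lambda>t. - x t)"])
        fix q assume "q \<in> C"
        then have q: "sublinear_on E q" "q (\<lambda>t. - x t) \<le> p1 (\<lambda>t. - x t)" using CA D(4)[OF that] by (auto simp: A_def)
        show "- p1 (\<lambda>t. - x t) \<le> q x" using sublinear_minus[OF E q(1) that] q(2) by simp
      qed
      have le: "u x \<le> q x" if "x \<in> E" "q \<in> C" for x q
        unfolding u_def using that bdd[OF that(1)] by (auto intro: cINF_lower)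
      have ge: "a \<le> u x" if "x \<in> E" "\<And>q. q \<in> C \<Longrightarrow> a \<le> q x" for a x
        unfolding u_def using that False by (auto intro: cINF_greatest)
      have "sublinear_on E u" unfolding sublinear_on_def
      proof (intro conjI ballI allI impI)
        fix x y assume xy: "x \<in> E" "y \<in> E"
        have "u (\<lambda>t. x t + y t) - q2 y \<le> q1 x" if q: "q1 \<in> C" "q2 \<in> C" for q1 q2
        proof -
          obtain q where q3: "q \<in> C" "q x \<le> q1 x" "q y \<le> q2 y" using ch[OF q] q unfolding P_def by blast
          have "u (\<lambda>t. x t + y t) \<le> q (\<lambda>t. x t + y t)" using le xy D q3 by auto
          also have "\<dots> \<le> q x + q y" using q3 CA xy by (auto simp: A_def sublinear_on_def)
          finally show ?thesis using q3 by simp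
        qed
        then have "u (\<lambda>t. x t + y t) - q2 y \<le> u x" if "q2 \<in> C" for q2 using ge[OF xy(1)] that by blast
        then have "u (\<lambda>t. x t + y t) - u x \<le> u y" by (intro ge xy) (simp add: algebra_simps)
        then show "u (\<lambda>t. x t + y t) \<le> u x + u y" by simp
      next
        fix c :: real and x assume c: "c > 0" and x: "x \<in> E"
        have "u (\<lambda>t. c * x t) / c \<le> q x" if "q \<in> C" for q
        proof -
          have "u (\<lambda>t. c * x t) \<le> q (\<lambda>t. c * x t)" using le x D that by auto
          also have "\<dots> \<le> c * q x" using that CA x c by (auto simp: A_def sublinear_on_def)
          finally show ?thesis using c by (simp add: field_simps)
        qed
        then have "u (\<lambda>t. c * x t) / c \<le> u x" using ge[OF x] by blast
        then show "u (\<lambda>t. c * x t) \<le> c * u x" using c by (simp add: field_simps)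
      qed
      moreover have "u x \<le> p1 x" if "x \<in> E" for x
        using False le[OF that] CA that by (fastforce simp: A_def)
      ultimately have "u \<in> A" by (auto simp: A_def u_def)
      moreover have "P a u" if "a \<in> C" for a
        unfolding P_def
      proof
        fix x show "u x \<le> a x"
        proof (cases "x \<in> E")
          case False then show ?thesis using that CA by (auto simp: A_def u_def)
        qed (use le that in auto)
      qed
      ultimately show ?thesis by blast
    qed
  qed
  then obtain m where m: "m \<in> A" and min: "\<And>a. a \<in> A \<Longrightarrow> P m a \<Longrightarrow> a = m" by auto
  have sub: "sublinear_on E m" and mp: "\<And>x. x \<in> E \<Longrightarrow> m x \<le> p1 x" and m0: "\<And>x. x \<notin> E \<Longrightarrow> m x = 0" using m by (auto simp: A_def)
  have neg: "m (\<lambda>t. - z t) = - m z" if z: "z \<in> E" for z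
  proof -
    obtain m1 where m1: "sublinear_on E m1" "\<And>x. x \<in> E \<Longrightarrow> m1 x \<le> m x" "m1 (\<lambda>t. - z t) \<le> - m z" "\<And>x. x \<notin> E \<Longrightarrow> m1 x = 0"
      using sublinear_descent[OF E sub z] by blast
    have "m1 \<in> A" using m1 mp by (auto simp: A_def intro: order_trans)
    moreover have "P m m1" unfolding P_def using m1 m0 by (metis order_refl)
    ultimately have "m1 = m" by (rule min)
    then show ?thesis using m1(3) sublinear_minus[OF E sub z] by simp
  qed
  have add_le: "m (\<lambda>t. x t + y t) \<le> m x + m y" if "x \<in> E" "y \<in> E" for x y using sub that by (auto simp: sublinear_on_def)
  show thesis
  proof (rule that[of m])
    fix x y assume xy: "x \<in> E" "y \<in> E"
    have "m (\<lambda>t. - x t + - y t) = - m (\<lambda>t. x t + y t)" using neg[of "\<lambda>t. x t + y t"] xy D by simp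
    moreover have "m (\<lambda>t. - x t + - y t) \<le> - m x - m y" using add_le[of "\<lambda>t. - x t" "\<lambda>t. - y t"] xy D neg by simp
    ultimately show "m (\<lambda>t. x t + y t) = m x + m y" using add_le[OF xy] by simp
  next
    fix c x assume x: "x \<in> E"
    show "m (\<lambda>t. c * x t) = c * m x"
    proof (cases c "0::real" rule: linorder_cases)
      case less
      then have "m (\<lambda>t. - c * x t) = - c * m x" using sublinear_homogeneous[OF E sub, of "- c" x] x by simp
      then show ?thesis using neg[of "\<lambda>t. c * x t"] x D(3) by simp
    qed (use sublinear_zero[OF E sub] sublinear_homogeneous[OF E sub] x in auto)
  next
    fix x assume "x \<in> E" then show "m x \<le> p x" using mp p1(2) order_trans by blast
  next
    show "p z0 \<le> m z0" using mp[OF D(4)[OF z0]] neg[OF z0] p1(3) by simp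
  qed
qed

section \<open>Positive symmetric functionals detect domination up to equivalence\<close>

locale fs_space = unit_or_half_line +
  fixes E :: "(real \<Rightarrow> real) set" and N :: "(real \<Rightarrow> real) \<Rightarrow> real"
  assumes fs: "fully_symmetric_space I E N"
begin

lemma bfs: "banach_function_space I E N" using fs by (simp add: fully_symmetric_space_def)

lemma E_L1Linf: "x \<in> E \<Longrightarrow> x \<in> L1Linf" using bfs by (auto simp: banach_function_space_def)
lemma E_meas: "x \<in> E \<Longrightarrow> meas x" using E_L1Linf L1_plus_Linf_measD by blast
lemma E_subspace: "function_subspace E" using bfs by (auto simp: banach_function_space_def function_subspace_def)
lemmas E_zero = function_subspaceD(1)[OF E_subspace]
  and E_add = function_subspaceD(2)[OF E_subspace]
  and E_cmult = function_subspaceD(3)[OF E_subspace]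
lemma N_nonneg: "x \<in> E \<Longrightarrow> 0 \<le> N x" using bfs by (auto simp: banach_function_space_def)
lemma N_add: "x \<in> E \<Longrightarrow> y \<in> E \<Longrightarrow> N (\<lambda>t. x t + y t) \<le> N x + N y"
  using bfs by (auto simp: banach_function_space_def)
lemma N_cmult: "x \<in> E \<Longrightarrow> N (\<lambda>t. c * x t) = \<bar>c\<bar> * N x" using bfs by (auto simp: banach_function_space_def)
lemma N_zero: "N (\<lambda>t. 0) = 0" using N_cmult[OF E_zero, of 0] by simp

lemma dominated:
  assumes "x \<in> E" "y \<in> L1Linf" "\<And>t. t > 0 \<Longrightarrow> mass y t \<le> mass x t"
  shows "y \<in> E" "N y \<le> N x"
  using fs assms submajorizedI[of y x] E_L1Linf unfolding fully_symmetric_space_def by blast+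

lemma dominated_excess:
  assumes "x \<in> E" "meas y" "\<And>s. s \<ge> 0 \<Longrightarrow> excess I y s \<le> excess I x s"
  shows "y \<in> E" "N y \<le> N x"
proof -
  have y: "y \<in> L1Linf" using assms E_L1Linf excess_le_in_L1_plus_Linf by blast
  show "y \<in> E" "N y \<le> N x" using assms y E_L1Linf mass_mono_excess
    by (auto intro!: dominated[of x])
qed

lemma dominated_AE:
  assumes "x \<in> E" "meas y" "AE u in lebesgue_on I. \<bar>y u\<bar> \<le> \<bar>x u\<bar>"
  shows "y \<in> E" "N y \<le> N x"
  using dominated_excess[OF assms(1,2)] excess_mono_fun[OF assms(3)] by auto

text \<open>
  Contains all pairs of positive equimeasurable functions but, unlike these, is stable under sums of pairs.
  The price is the dilation \<open>L\<close>, which depends on the pair.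
\<close>
definition mass_equiv :: "(real \<Rightarrow> real) \<Rightarrow> (real \<Rightarrow> real) \<Rightarrow> bool" where
  "mass_equiv u v \<longleftrightarrow> u \<in> E \<and> v \<in> E \<and> (AE t in lebesgue_on I. 0 \<le> u t) \<and> (AE t in lebesgue_on I. 0 \<le> v t) \<and>
     (\<exists>L\<ge>1. \<forall>t>0. mass u t \<le> mass v (L * t) \<and> mass v t \<le> mass u (L * t))"

text \<open>
  Subadditivity of the mass and its converse with doubled time combine, so that the sum of two equivalent pairs
  is equivalent with a larger constant.
\<close>
lemma mass_equiv_add:
  assumes "mass_equiv u v" "mass_equiv u' v'"
  shows "mass_equiv (\<lambda>t. u t + u' t) (\<lambda>t. v t + v' t)"
proof -
  have half: "\<exists>K\<ge>1. \<forall>L\<ge>K. \<forall>t>0. mass (\<lambda>t. u t + u' t) t \<le> mass (\<lambda>t. v t + v' t) (L * t)"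
    if uv: "mass_equiv u v" "mass_equiv u' v'" for u v u' v'
  proof -
    obtain L where L: "L \<ge> 1" "\<forall>t>0. mass u t \<le> mass v (L * t)" using uv(1) by (auto simp: mass_equiv_def)
    obtain L' where L': "L' \<ge> 1" "\<forall>t>0. mass u' t \<le> mass v' (L' * t)" using uv(2) by (auto simp: mass_equiv_def)
    have E: "u \<in> L1Linf" "v \<in> L1Linf" "u' \<in> L1Linf" "v' \<in> L1Linf" using uv E_L1Linf by (auto simp: mass_equiv_def)
    define K where "K = L + L'"
    show ?thesis
    proof (intro exI[of _ "2 * K"] conjI allI impI)
      show "1 \<le> 2 * K" using L L' by (simp add: K_def)
      fix J t :: real assume J: "2 * K \<le> J" and t: "t > 0"
      have "mass (\<lambda>t. u t + u' t) t \<le> mass u t + mass u' t" by (rule mass_add_le[OF E(1,3) t])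
      also have "\<dots> \<le> mass v (L * t) + mass v' (L' * t)" using L L' t by (intro add_mono) auto
      also have "\<dots> \<le> mass v (K * t) + mass v' (K * t)"
        using L L' t E by (intro add_mono mass_mono) (auto simp: K_def)
      also have "\<dots> \<le> mass (\<lambda>t. v t + v' t) (2 * (K * t))"
        using L L' t E uv by (intro mass_add_ge) (auto simp: mass_equiv_def K_def)
      also have "\<dots> \<le> mass (\<lambda>t. v t + v' t) (J * t)"
        using L L' t J mult_right_mono[OF J, of t] by (intro mass_mono L1Linf_add E) (auto simp: K_def)
      finally show "mass (\<lambda>t. u t + u' t) t \<le> mass (\<lambda>t. v t + v' t) (J * t)" .
    qed
  qed
  have sym: "mass_equiv v u" if "mass_equiv u v" for u v using that unfolding mass_equiv_def by blast
  obtain K where K: "K \<ge> 1" "\<And>L t. L \<ge> K \<Longrightarrow> t > 0 \<Longrightarrow> mass (\<lambda>t. u t + u' t) t \<le> mass (\<lambda>t. v t + v' t) (L * t)"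
    using half[OF assms] by blast
  obtain K' where K': "K' \<ge> 1" "\<And>L t. L \<ge> K' \<Longrightarrow> t > 0 \<Longrightarrow> mass (\<lambda>t. v t + v' t) t \<le> mass (\<lambda>t. u t + u' t) (L * t)"
    using half[OF sym[OF assms(1)] sym[OF assms(2)]] by blast
  have "\<exists>L\<ge>1. \<forall>t>0. mass (\<lambda>t. u t + u' t) t \<le> mass (\<lambda>t. v t + v' t) (L * t) \<and> mass (\<lambda>t. v t + v' t) t \<le> mass (\<lambda>t. u t + u' t) (L * t)"
    using K K' by (intro exI[of _ "K + K'"]) auto
  moreover have "AE t in lebesgue_on I. 0 \<le> u t + u' t" "AE t in lebesgue_on I. 0 \<le> v t + v' t"
    using assms by (auto simp: mass_equiv_def)
  ultimately show ?thesis using assms E_add by (auto simp: mass_equiv_def)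
qed

lemma mass_equiv_cmult:
  assumes "mass_equiv u v" "c > 0" shows "mass_equiv (\<lambda>t. c * u t) (\<lambda>t. c * v t)"
proof -
  obtain L where L: "L \<ge> 1" "\<forall>t>0. mass u t \<le> mass v (L * t) \<and> mass v t \<le> mass u (L * t)"
    using assms(1) by (auto simp: mass_equiv_def)
  have E: "u \<in> L1Linf" "v \<in> L1Linf" using assms E_L1Linf by (auto simp: mass_equiv_def)
  have "\<forall>t>0. mass (\<lambda>t. c * u t) t \<le> mass (\<lambda>t. c * v t) (L * t) \<and> mass (\<lambda>t. c * v t) t \<le> mass (\<lambda>t. c * u t) (L * t)"
    using L assms(2) by (auto simp: mass_cmult E)
  then show ?thesis using assms E_cmult L(1) by (auto simp: mass_equiv_def)
qed

lemma mass_equiv_rearr: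
  assumes "u \<in> E" "v \<in> E" "AE t in lebesgue_on I. 0 \<le> u t" "AE t in lebesgue_on I. 0 \<le> v t" "\<forall>t>0. rearr I u t = rearr I v t"
  shows "mass_equiv u v"
proof -
  have "mass u t = mass v t" for t
    unfolding mass_def rearr_mass_def using assms(5) by (auto intro!: arg_cong[of _ _ enn2real] nn_integral_cong simp: indicator_def)
  then show ?thesis using assms unfolding mass_equiv_def by (auto intro!: exI[of _ 1])
qed

lemma mass_equiv_zero: "mass_equiv (\<lambda>t. 0) (\<lambda>t. 0)"
  by (rule mass_equiv_rearr) (auto simp: E_zero)

text \<open>
  What remains of \<open>z\<close> above a difference \<open>u - v\<close>, which the functionals constructed below annihilate.
\<close>
definition remainder :: "(real \<Rightarrow> real) \<Rightarrow> (real \<Rightarrow> real) \<Rightarrow> bool" where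
  "remainder z e \<longleftrightarrow> e \<in> E \<and> (AE t in lebesgue_on I. 0 \<le> e t) \<and>
     (\<exists>u v. mass_equiv u v \<and> (AE t in lebesgue_on I. z t + v t \<le> u t + e t))"

definition remainder_norm :: "(real \<Rightarrow> real) \<Rightarrow> real" where
  "remainder_norm z = Inf (N ` Collect (remainder z))"

lemma remainder_norm_le: "remainder z e \<Longrightarrow> remainder_norm z \<le> N e"
  unfolding remainder_norm_def
  by (intro cInf_lower imageI bdd_belowI2[of _ 0]) (auto simp: remainder_def N_nonneg)

lemma remainder_abs:
  assumes "z \<in> E" shows "remainder z (\<lambda>t. \<bar>z t\<bar>)"
proof -
  note E_meas[OF assms, measurable]
  have "(\<lambda>t. \<bar>z t\<bar>) \<in> E" by (rule dominated_AE(1)[OF assms]) auto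
  then show ?thesis unfolding remainder_def using mass_equiv_zero by (auto intro!: exI[of _ "\<lambda>t. 0"])
qed

lemma remainder_near:
  assumes "z \<in> E" "\<epsilon> > 0" obtains e where "remainder z e" "N e < remainder_norm z + \<epsilon>"
proof -
  have "N ` Collect (remainder z) \<noteq> {}" using remainder_abs[OF assms(1)] by blast
  from cInf_lessD[OF this, of "remainder_norm z + \<epsilon>"] assms(2) that show thesis
    unfolding remainder_norm_def by auto
qed

lemma remainder_norm_sublinear: "sublinear_on E remainder_norm"
  unfolding sublinear_on_def
proof (intro conjI ballI allI impI)
  fix x y assume xy: "x \<in> E" "y \<in> E"
  show "remainder_norm (\<lambda>t. x t + y t) \<le> remainder_norm x + remainder_norm y"
  proof (rule field_le_epsilon)
    fix \<epsilon> :: real assume "\<epsilon> > 0"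
    then have h: "\<epsilon> / 2 > 0" by simp
    obtain e where e: "remainder x e" "N e < remainder_norm x + \<epsilon> / 2" using remainder_near[OF xy(1) h] .
    obtain d where d: "remainder y d" "N d < remainder_norm y + \<epsilon> / 2" using remainder_near[OF xy(2) h] .
    obtain u v where uv: "mass_equiv u v" "AE t in lebesgue_on I. x t + v t \<le> u t + e t" using e by (auto simp: remainder_def)
    obtain u' v' where uv': "mass_equiv u' v'" "AE t in lebesgue_on I. y t + v' t \<le> u' t + d t" using d by (auto simp: remainder_def)
    have ed: "e \<in> E" "d \<in> E" "AE t in lebesgue_on I. 0 \<le> e t" "AE t in lebesgue_on I. 0 \<le> d t" using e d by (auto simp: remainder_def)
    have "remainder (\<lambda>t. x t + y t) (\<lambda>t. e t + d t)" unfolding remainder_def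
    proof (intro conjI exI)
      show "(\<lambda>t. e t + d t) \<in> E" using ed E_add by auto
      show "AE t in lebesgue_on I. 0 \<le> e t + d t" using ed(3,4) by eventually_elim auto
      show "mass_equiv (\<lambda>t. u t + u' t) (\<lambda>t. v t + v' t)" by (rule mass_equiv_add[OF uv(1) uv'(1)])
      show "AE t in lebesgue_on I. x t + y t + (v t + v' t) \<le> u t + u' t + (e t + d t)"
        using uv(2) uv'(2) by eventually_elim auto
    qed
    from remainder_norm_le[OF this] N_add[OF ed(1,2)] e(2) d(2)
    show "remainder_norm (\<lambda>t. x t + y t) \<le> remainder_norm x + remainder_norm y + \<epsilon>" by linarith
  qed
next
  fix c :: real and x assume c: "c > 0" and x: "x \<in> E"
  show "remainder_norm (\<lambda>t. c * x t) \<le> c * remainder_norm x"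
  proof (rule field_le_epsilon)
    fix \<epsilon> :: real assume "\<epsilon> > 0"
    then have h: "\<epsilon> / c > 0" using c by simp
    obtain e where e: "remainder x e" "N e < remainder_norm x + \<epsilon> / c" using remainder_near[OF x h] .
    obtain u v where uv: "mass_equiv u v" "AE t in lebesgue_on I. x t + v t \<le> u t + e t" using e by (auto simp: remainder_def)
    have ee: "e \<in> E" "AE t in lebesgue_on I. 0 \<le> e t" using e by (auto simp: remainder_def)
    have "remainder (\<lambda>t. c * x t) (\<lambda>t. c * e t)" unfolding remainder_def
    proof (intro conjI exI)
      show "(\<lambda>t. c * e t) \<in> E" using ee E_cmult by auto
      show "AE t in lebesgue_on I. 0 \<le> c * e t" using ee(2) by eventually_elim (use c in simp)
      show "mass_equiv (\<lambda>t. c * u t) (\<lambda>t. c * v t)" by (rule mass_equiv_cmult[OF uv(1) c])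
      show "AE t in lebesgue_on I. c * x t + c * v t \<le> c * u t + c * e t"
        using uv(2) by eventually_elim (use c in \<open>simp flip: distrib_left\<close>)
    qed
    from remainder_norm_le[OF this] have "remainder_norm (\<lambda>t. c * x t) \<le> c * N e" using N_cmult[OF ee(1), of c] c by simp
    also have "\<dots> \<le> c * (remainder_norm x + \<epsilon> / c)" using e(2) c by (intro mult_left_mono) auto
    finally show "remainder_norm (\<lambda>t. c * x t) \<le> c * remainder_norm x + \<epsilon>" using c by (simp add: distrib_left)
  qed
qed

lemma remainder_norm_nonpos:
  assumes "mass_equiv u v" "AE t in lebesgue_on I. z t + v t \<le> u t" shows "remainder_norm z \<le> 0"
  using remainder_norm_le[of z "\<lambda>t. 0"] assms by (auto simp: remainder_def E_zero N_zero)

text \<open>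
  A linear functional below \<open>remainder_norm\<close> is positive, since negative elements have remainder zero, and it
  is symmetric, since differences of equimeasurable positive functions have remainder zero. Taking one that
  attains the value at \<open>y - x\<close> shows that this value is at most zero.
\<close>
lemma symmetric_functionals_detect:
  assumes x: "x \<in> E" and y: "y \<in> E" and \<epsilon>: "\<epsilon> > 0"
    and le: "\<And>\<phi>. symmetric_functional_on I E \<phi> \<Longrightarrow> positive_functional_on I E \<phi> \<Longrightarrow> \<phi> y \<le> \<phi> x"
  obtains u v e where "mass_equiv u v" "e \<in> E" "AE t in lebesgue_on I. 0 \<le> e t" "N e < \<epsilon>"
    "AE t in lebesgue_on I. y t + v t \<le> x t + u t + e t"
proof -
  define z0 where "z0 t = y t + (-1) * x t" for t
  have z0: "z0 \<in> E" unfolding z0_def by (intro E_add y E_cmult x)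
  obtain \<phi> where add: "\<And>x y. x \<in> E \<Longrightarrow> y \<in> E \<Longrightarrow> \<phi> (\<lambda>t. x t + y t) = \<phi> x + \<phi> y"
    and hom: "\<And>c x. x \<in> E \<Longrightarrow> \<phi> (\<lambda>t. c * x t) = c * \<phi> x"
    and below: "\<And>x. x \<in> E \<Longrightarrow> \<phi> x \<le> remainder_norm x" and top: "remainder_norm z0 \<le> \<phi> z0"
    using hahn_banach_functions[OF E_subspace remainder_norm_sublinear z0] by blast
  have diff: "\<phi> a \<le> \<phi> b" if ab: "a \<in> E" "b \<in> E" and "mass_equiv u v" "AE t in lebesgue_on I. a t + v t \<le> b t + u t" for a b u v
  proof -
    have "\<phi> a - \<phi> b = \<phi> (\<lambda>t. a t + (-1) * b t)" using add[OF ab(1) E_cmult[OF ab(2), of "-1"]] hom[OF ab(2), of "-1"] by simp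
    also have "\<dots> \<le> remainder_norm (\<lambda>t. a t + (-1) * b t)" by (intro below E_add ab E_cmult)
    also have "\<dots> \<le> 0" using that(3) by (rule remainder_norm_nonpos) (use that(4) in eventually_elim, auto)
    finally show ?thesis by simp
  qed
  have mono: "\<phi> a \<le> \<phi> b" if ab: "a \<in> E" "b \<in> E" "AE t in lebesgue_on I. a t \<le> b t" for a b
    using diff[OF ab(1,2) mass_equiv_zero] ab(3) by simp
  have pos: "positive_functional_on I E \<phi>"
    unfolding positive_functional_on_def using mono[OF E_zero] hom[OF E_zero, of 0] by auto
  have "\<phi> a = \<phi> b" if "a \<in> E" "b \<in> E" "AE t in lebesgue_on I. a t = b t" for a b
    by (intro antisym mono that) (use that(3) in \<open>eventually_elim, simp\<close>)+
  moreover have "\<phi> b = \<phi> a" if "a \<in> E" "b \<in> E" "AE t in lebesgue_on I. 0 \<le> a t" "AE t in lebesgue_on I. 0 \<le> b t" "\<forall>t>0. rearr I b t = rearr I a t" for a b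
    using that by (intro antisym diff[OF _ _ mass_equiv_rearr[of b a]] diff[OF _ _ mass_equiv_rearr[of a b]]) auto
  ultimately have "symmetric_functional_on I E \<phi>"
    unfolding symmetric_functional_on_def linear_functional_on_def using add hom by blast
  from le[OF this pos] have "\<phi> z0 \<le> 0" unfolding z0_def using add[OF y E_cmult[OF x, of "-1"]] hom[OF x, of "-1"] by simp
  then have "remainder_norm z0 \<le> 0" using top by simp
  moreover obtain e where e: "remainder z0 e" "N e < remainder_norm z0 + \<epsilon>" using remainder_near[OF z0 \<epsilon>] .
  moreover obtain u v where uv: "mass_equiv u v" "AE t in lebesgue_on I. z0 t + v t \<le> u t + e t"
    using e by (auto simp: remainder_def)
  moreover have "AE t in lebesgue_on I. y t + v t \<le> x t + u t + e t"
    using uv(2) by eventually_elim (simp add: z0_def)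
  ultimately show thesis using that[of u v e] by (auto simp: remainder_def)
qed

end

section \<open>Averaging a decreasing function over cells\<close>

text \<open>
  Averages over infinitely many cells are compared with the original function cell by cell.
\<close>
lemma nn_integral_le_on_cells:
  assumes [measurable]: "f \<in> borel_measurable M" "g \<in> borel_measurable M"
    and C: "countable C" and D: "\<And>c. c \<in> C \<Longrightarrow> D c \<in> sets M" "disjoint_family_on D C"
    and out: "\<And>u. u \<in> space M \<Longrightarrow> u \<notin> (\<Union>c\<in>C. D c) \<Longrightarrow> f u = g u"
    and le: "\<And>c. c \<in> C \<Longrightarrow> (\<integral>\<^sup>+u\<in>D c. f u \<partial>M) \<le> (\<integral>\<^sup>+u\<in>D c. g u \<partial>M)"
  shows "(\<integral>\<^sup>+u. f u \<partial>M) \<le> (\<integral>\<^sup>+u. g u \<partial>M)"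
proof -
  define U where "U = (\<Union>c\<in>C. D c)"
  have U[measurable]: "U \<in> sets M" unfolding U_def using C D by (intro sets.countable_UN'') auto
  have split: "(\<integral>\<^sup>+u. h u \<partial>M) = (\<integral>\<^sup>+c. (\<integral>\<^sup>+u\<in>D c. h u \<partial>M) \<partial>count_space C) + (\<integral>\<^sup>+u\<in>space M - U. h u \<partial>M)"
    if [measurable]: "h \<in> borel_measurable M" for h
  proof -
    have "(\<integral>\<^sup>+u. h u \<partial>M) = (\<integral>\<^sup>+u. h u * indicator U u + h u * indicator (space M - U) u \<partial>M)"
      by (intro nn_integral_cong) (auto simp: indicator_def)
    also have "\<dots> = (\<integral>\<^sup>+u\<in>U. h u \<partial>M) + (\<integral>\<^sup>+u\<in>space M - U. h u \<partial>M)"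
      by (intro nn_integral_add) auto
    also have "(\<integral>\<^sup>+u\<in>U. h u \<partial>M) = emeasure (density M h) U" by (simp add: emeasure_density)
    also have "\<dots> = (\<integral>\<^sup>+c. emeasure (density M h) (D c) \<partial>count_space C)"
      unfolding U_def using C D by (intro emeasure_UN_countable) auto
    also have "\<dots> = (\<integral>\<^sup>+c. (\<integral>\<^sup>+u\<in>D c. h u \<partial>M) \<partial>count_space C)"
      using D by (intro nn_integral_cong) (simp add: emeasure_density)
    finally show ?thesis .
  qed
  have "(\<integral>\<^sup>+u\<in>space M - U. f u \<partial>M) = (\<integral>\<^sup>+u\<in>space M - U. g u \<partial>M)"
    using out by (intro nn_integral_cong) (auto simp: indicator_def U_def)
  moreover have "(\<integral>\<^sup>+c. (\<integral>\<^sup>+u\<in>D c. f u \<partial>M) \<partial>count_space C) \<le> (\<integral>\<^sup>+c. (\<integral>\<^sup>+u\<in>D c. g u \<partial>M) \<partial>count_space C)"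
    by (rule nn_integral_mono) (simp add: le)
  ultimately show ?thesis unfolding split[OF assms(1)] split[OF assms(2)] by (simp add: add_mono)
qed

context unit_or_half_line
begin

text \<open>
  Monotonicity is required on the whole positive half-line, also when \<open>I\<close> is bounded: rearrangements have
  it, and dilations and averages preserve it.
\<close>
definition decreasing :: "(real \<Rightarrow> real) \<Rightarrow> bool" where
  "decreasing f \<longleftrightarrow> f \<in> borel_measurable borel \<and> f \<in> L1Linf \<and> (\<forall>t>0. 0 \<le> f t) \<and> (\<forall>s t. 0 < s \<longrightarrow> s \<le> t \<longrightarrow> f t \<le> f s)"

lemma decreasingD:
  assumes "decreasing f"
  shows "f \<in> borel_measurable borel" "f \<in> L1Linf"
    "t > 0 \<Longrightarrow> 0 \<le> f t" "0 < s \<Longrightarrow> s \<le> t \<Longrightarrow> f t \<le> f s"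
  using assms by (auto simp: decreasing_def)

lemma decreasing_pos_rearr: "f \<in> L1Linf \<Longrightarrow> decreasing (pos_rearr I f)"
  unfolding decreasing_def using pos_rearr_borel pos_rearr_L1Linf pos_rearr_nonneg pos_rearr_antimono by blast

text \<open>
  Decreasing functions need no rearrangement. Consequently the mass is additive on them and its increments
  are integrals over intervals.
\<close>
lemma rearr_mass_decreasing:
  assumes "decreasing f" "t > 0"
  shows "rearr_mass I f t = (\<integral>\<^sup>+u\<in>{0<..<t} \<inter> I. ennreal (f u) \<partial>lborel)"
  using assms unfolding decreasing_def
  by (intro antisym rearr_mass_le_integral integral_le_rearr_mass) auto

lemma mass_increment:
  assumes f: "decreasing f" and ab: "0 < a" "a \<le> b" "b \<in> I"
  shows "ennreal (mass f b - mass f a) = (\<integral>\<^sup>+u\<in>{a<..<b}. ennreal (f u) \<partial>lborel)"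
proof -
  have fL: "f \<in> L1Linf" and [measurable]: "f \<in> borel_measurable borel" using f by (auto simp: decreasing_def)
  have sub: "{0<..<b} \<inter> I = {0<..<b}" "{0<..<a} \<inter> I = {0<..<a}" using I_down ab by auto
  have "ennreal (mass f b) = (\<integral>\<^sup>+u\<in>{0<..<b}. ennreal (f u) \<partial>lborel)"
    using rearr_mass_decreasing[OF f, of b] ab sub by (simp add: ennreal_mass[OF fL])
  also have "\<dots> = (\<integral>\<^sup>+u. ennreal (f u) * indicator {0<..<a} u + ennreal (f u) * indicator {a<..<b} u \<partial>lborel)"
    by (rule nn_integral_cong_AE, use AE_lborel_singleton[of a] in eventually_elim) (use ab in \<open>auto simp: indicator_def\<close>)
  also have "\<dots> = ennreal (mass f a) + (\<integral>\<^sup>+u\<in>{a<..<b}. ennreal (f u) \<partial>lborel)"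
    using rearr_mass_decreasing[OF f ab(1)] ab sub by (subst nn_integral_add) (auto simp: ennreal_mass[OF fL])
  finally have *: "ennreal (mass f b) = ennreal (mass f a) + (\<integral>\<^sup>+u\<in>{a<..<b}. ennreal (f u) \<partial>lborel)" .
  have "(\<integral>\<^sup>+u\<in>{a<..<b}. ennreal (f u) \<partial>lborel) = ennreal (mass f b) - ennreal (mass f a)"
    unfolding * by simp
  then show ?thesis by (simp add: ennreal_minus)
qed

lemma nn_integral_const_interval:
  fixes a b c :: real assumes "a \<le> b" "c \<ge> 0" shows "(\<integral>\<^sup>+u\<in>{a<..<b}. ennreal c \<partial>lborel) = ennreal ((b - a) * c)"
  using assms by (subst nn_integral_cmult_indicator) (auto simp: ennreal_mult mult.commute)

lemma mass_increment_const:
  assumes f: "decreasing f" and ab: "0 < a" "a \<le> b" "b \<in> I" and c: "\<And>u. a < u \<Longrightarrow> u < b \<Longrightarrow> f u = c" "c \<ge> 0"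
  shows "mass f b - mass f a = (b - a) * c"
proof -
  have "ennreal (mass f b - mass f a) = (\<integral>\<^sup>+u\<in>{a<..<b}. ennreal c \<partial>lborel)"
    unfolding mass_increment[OF f ab] using c by (intro nn_integral_cong) (auto simp: indicator_def)
  also have "\<dots> = ennreal ((b - a) * c)" using ab c by (intro nn_integral_const_interval) auto
  finally show ?thesis
    using mass_mono[of f a b] f ab c by (subst (asm) ennreal_inj) (auto simp: decreasing_def)
qed

lemma mass_increment_bounds:
  assumes f: "decreasing f" and ab: "0 < a" "a \<le> b" "b \<in> I"
  shows "(b - a) * f b \<le> mass f b - mass f a" "mass f b - mass f a \<le> (b - a) * f a"
proof -
  have m: "mass f a \<le> mass f b" using mass_mono[of f a b] f ab by (auto simp: decreasing_def)
  have f0: "f a \<ge> 0" "f b \<ge> 0" using f ab by (auto simp: decreasing_def)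
  have "ennreal ((b - a) * f b) = (\<integral>\<^sup>+u\<in>{a<..<b}. ennreal (f b) \<partial>lborel)"
    using ab f0 by (intro nn_integral_const_interval[symmetric]) auto
  also have "\<dots> \<le> ennreal (mass f b - mass f a)" unfolding mass_increment[OF f ab]
    using f ab by (intro nn_integral_mono) (auto simp: indicator_def decreasing_def intro!: ennreal_leI)
  finally show "(b - a) * f b \<le> mass f b - mass f a" using m by (subst (asm) ennreal_le_iff) auto
  have "ennreal (mass f b - mass f a) \<le> (\<integral>\<^sup>+u\<in>{a<..<b}. ennreal (f a) \<partial>lborel)" unfolding mass_increment[OF f ab]
    using f ab by (intro nn_integral_mono) (auto simp: indicator_def decreasing_def intro!: ennreal_leI)
  also have "\<dots> = ennreal ((b - a) * f a)"
    using ab f0 by (intro nn_integral_const_interval) auto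
  finally show "mass f b - mass f a \<le> (b - a) * f a" using f0 ab by (subst (asm) ennreal_le_iff) auto
qed

text \<open>
  A cell is given by its pair of end points; distinct cells may share an end point, as consecutive ones do.
\<close>
definition cell_family :: "(real \<times> real) set \<Rightarrow> bool" where
  "cell_family C \<longleftrightarrow> countable C \<and> (\<forall>(\<alpha>,\<beta>)\<in>C. 0 < \<alpha> \<and> \<alpha> < \<beta> \<and> \<beta> \<in> I) \<and>
     (\<forall>(\<alpha>,\<beta>)\<in>C. \<forall>(\<alpha>',\<beta>')\<in>C. (\<alpha>,\<beta>) = (\<alpha>',\<beta>') \<or> \<beta> \<le> \<alpha>' \<or> \<beta>' \<le> \<alpha>)"

definition cell_mean :: "(real \<Rightarrow> real) \<Rightarrow> real \<times> real \<Rightarrow> real" where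
  "cell_mean f c = (mass f (snd c) - mass f (fst c)) / (snd c - fst c)"

definition average :: "(real \<times> real) set \<Rightarrow> (real \<Rightarrow> real) \<Rightarrow> real \<Rightarrow> real" where
  "average C f t = (if \<exists>c\<in>C. fst c < t \<and> t < snd c
     then cell_mean f (SOME c. c \<in> C \<and> fst c < t \<and> t < snd c) else f t)"

context
  fixes C :: "(real \<times> real) set" and f :: "real \<Rightarrow> real"
  assumes C: "cell_family C" and f: "decreasing f"
begin

lemma cellD:
  assumes "c \<in> C" shows "0 < fst c" "fst c < snd c" "snd c \<in> I"
  using C assms unfolding cell_family_def by (auto simp: case_prod_beta)

lemma cells_apart: "c \<in> C \<Longrightarrow> d \<in> C \<Longrightarrow> c = d \<or> snd c \<le> fst d \<or> snd d \<le> fst c"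
  using C unfolding cell_family_def by (auto simp: case_prod_beta prod_eq_iff)

lemma average_in:
  assumes "c \<in> C" "fst c < t" "t < snd c" shows "average C f t = cell_mean f c"
proof -
  have "(SOME c. c \<in> C \<and> fst c < t \<and> t < snd c) = c"
    using assms cells_apart[of _ c] by (intro some_equality) force+
  then show ?thesis using assms by (auto simp: average_def)
qed

lemma average_out: "(\<And>c. c \<in> C \<Longrightarrow> \<not> (fst c < t \<and> t < snd c)) \<Longrightarrow> average C f t = f t"
  by (auto simp: average_def)

lemma cell_mean_bounds:
  assumes "c \<in> C" shows "f (snd c) \<le> cell_mean f c" "cell_mean f c \<le> f (fst c)"
  using mass_increment_bounds[OF f, of "fst c" "snd c"] cellD[OF assms]
  by (auto simp: cell_mean_def field_simps)

lemma cell_mean_nonneg: "c \<in> C \<Longrightarrow> 0 \<le> cell_mean f c"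
  using cell_mean_bounds(1)[of c] decreasingD(3)[OF f, of "snd c"] cellD[of c] by linarith

lemma average_nonneg: "t > 0 \<Longrightarrow> 0 \<le> average C f t"
proof (cases "\<exists>c\<in>C. fst c < t \<and> t < snd c")
  case True
  then show ?thesis using average_in cell_mean_nonneg by metis
next
  case False
  then show "t > 0 \<Longrightarrow> ?thesis" using average_out[of t] decreasingD(3)[OF f] by auto
qed

text \<open>
  The mean over a cell lies between the values of \<open>f\<close> at the two ends of the cell.
\<close>
lemma average_antimono:
  assumes "0 < s" "s \<le> t" shows "average C f t \<le> average C f s"
proof (cases "\<exists>c\<in>C. fst c < s \<and> s < snd c"; cases "\<exists>d\<in>C. fst d < t \<and> t < snd d")
  assume "\<exists>c\<in>C. fst c < s \<and> s < snd c" "\<exists>d\<in>C. fst d < t \<and> t < snd d"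
  then obtain c d where cd: "c \<in> C" "fst c < s" "s < snd c" "d \<in> C" "fst d < t" "t < snd d" by auto
  have "cell_mean f d \<le> cell_mean f c"
  proof (cases "c = d")
    case False
    then have "snd c \<le> fst d" using cells_apart[OF cd(1,4)] cd assms by auto
    then show ?thesis using cell_mean_bounds(1)[OF cd(1)] cell_mean_bounds(2)[OF cd(4)]
        decreasingD(4)[OF f, of "snd c" "fst d"] cellD[OF cd(1)] by linarith
  qed simp
  then show ?thesis using cd by (simp add: average_in[of c] average_in[of d])
next
  assume "\<exists>c\<in>C. fst c < s \<and> s < snd c" and nt: "\<not> (\<exists>d\<in>C. fst d < t \<and> t < snd d)"
  then obtain c where c: "c \<in> C" "fst c < s" "s < snd c" by auto
  then have "snd c \<le> t" using nt assms by (meson dual_order.strict_trans1 linorder_not_le order_less_le_trans)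
  then have "f t \<le> cell_mean f c" using cell_mean_bounds(1)[OF c(1)] decreasingD(4)[OF f, of "snd c" t] cellD[OF c(1)] by linarith
  then show ?thesis using c nt by (simp add: average_in[of c] average_out)
next
  assume ns: "\<not> (\<exists>c\<in>C. fst c < s \<and> s < snd c)" and "\<exists>d\<in>C. fst d < t \<and> t < snd d"
  then obtain d where d: "d \<in> C" "fst d < t" "t < snd d" by auto
  then have "s \<le> fst d" using ns assms by (meson linorder_not_le order_le_less_trans)
  then have "cell_mean f d \<le> f s" using cell_mean_bounds(2)[OF d(1)] decreasingD(4)[OF f, of s "fst d"] assms by linarith
  then show ?thesis using d ns by (simp add: average_in[of d] average_out)
next
  assume "\<not> (\<exists>c\<in>C. fst c < s \<and> s < snd c)" "\<not> (\<exists>d\<in>C. fst d < t \<and> t < snd d)"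
  then show ?thesis using decreasingD(4)[OF f] assms by (simp add: average_out)
qed

lemma average_borel: "average C f \<in> borel_measurable borel"
proof -
  note decreasingD(1)[OF f, measurable]
  have "mono_on {0<..} (\<lambda>t. - average C f t)" using average_antimono by (auto simp: mono_on_def)
  then have neg: "(\<lambda>t. - average C f t) \<in> borel_measurable (restrict_space borel {0<..})"
    by (rule borel_measurable_mono_on_fnc)
  have "average C f \<in> borel_measurable (restrict_space borel {0<..})"
    using borel_measurable_uminus[OF neg] by simp
  moreover have "average C f \<in> borel_measurable (restrict_space borel {..0})"
  proof (rule measurable_cong[THEN iffD2])
    show "f \<in> borel_measurable (restrict_space borel {..0})" by (rule measurable_restrict_space1) simp
    fix t assume "t \<in> space (restrict_space borel {..0::real})"
    then have "t \<le> 0" by (auto simp: space_restrict_space)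
    then show "average C f t = f t" using cellD by (intro average_out) force
  qed
  ultimately show ?thesis
    by - (rule measurable_piecewise_restrict[of "{{0<..},{..0}}"], auto)
qed

lemma cell_integral:
  assumes "c \<in> C"
  shows "(\<integral>\<^sup>+u\<in>{fst c<..<snd c}. ennreal (f u) \<partial>lborel) = ennreal ((snd c - fst c) * cell_mean f c)"
    "(\<integral>\<^sup>+u\<in>{fst c<..<snd c}. ennreal (average C f u - s) \<partial>lborel) = ennreal ((snd c - fst c) * (cell_mean f c - s))"
proof -
  note c = cellD[OF assms]
  show "(\<integral>\<^sup>+u\<in>{fst c<..<snd c}. ennreal (f u) \<partial>lborel) = ennreal ((snd c - fst c) * cell_mean f c)"
    using c by (simp add: mass_increment[OF f, symmetric] cell_mean_def)
  have "(\<integral>\<^sup>+u\<in>{fst c<..<snd c}. ennreal (average C f u - s) \<partial>lborel) = (\<integral>\<^sup>+u\<in>{fst c<..<snd c}. ennreal (max 0 (cell_mean f c - s)) \<partial>lborel)"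
    by (intro nn_integral_cong) (auto simp: indicator_def average_in[OF assms] max_def ennreal_neg)
  also have "\<dots> = ennreal ((snd c - fst c) * (max 0 (cell_mean f c - s)))"
    using c by (intro nn_integral_const_interval) auto
  also have "\<dots> = ennreal ((snd c - fst c) * (cell_mean f c - s))"
    using c by (auto simp: max_def ennreal_neg mult_nonneg_nonpos)
  finally show "(\<integral>\<^sup>+u\<in>{fst c<..<snd c}. ennreal (average C f u - s) \<partial>lborel) = ennreal ((snd c - fst c) * (cell_mean f c - s))" .
qed

text \<open>
  Jensen's inequality for \<open>r \<mapsto> (r - s)\<^sub>+\<close>. It is the reason why an average is submajorized by
  the original function.
\<close>
lemma cell_jensen:
  assumes "c \<in> C" "s \<ge> 0"
  shows "(\<integral>\<^sup>+u\<in>{fst c<..<snd c}. ennreal (average C f u - s) \<partial>lborel) \<le> (\<integral>\<^sup>+u\<in>{fst c<..<snd c}. ennreal (f u - s) \<partial>lborel)"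
proof -
  note decreasingD(1)[OF f, measurable]
  let ?D = "{fst c<..<snd c}"
  note c = cellD[OF assms(1)]
  have "ennreal ((snd c - fst c) * cell_mean f c) \<le> (\<integral>\<^sup>+u. ennreal (f u - s) * indicator ?D u + ennreal s * indicator ?D u \<partial>lborel)"
    unfolding cell_integral(1)[OF assms(1), symmetric] using assms(2)
    by (intro nn_integral_mono) (auto simp: indicator_def ennreal_plus_if simp del: ennreal_plus intro!: ennreal_leI)
  also have "\<dots> = (\<integral>\<^sup>+u\<in>?D. ennreal (f u - s) \<partial>lborel) + ennreal ((snd c - fst c) * s)"
    using c assms(2) by (subst nn_integral_add) (auto simp: nn_integral_const_interval)
  finally have "ennreal ((snd c - fst c) * cell_mean f c) - ennreal ((snd c - fst c) * s) \<le> (\<integral>\<^sup>+u\<in>?D. ennreal (f u - s) \<partial>lborel)"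
    by (simp add: ennreal_minus_le_iff add.commute)
  also have "ennreal ((snd c - fst c) * cell_mean f c) - ennreal ((snd c - fst c) * s) = ennreal ((snd c - fst c) * (cell_mean f c - s))"
    using c assms(2) by (simp add: ennreal_minus right_diff_distrib)
  finally show ?thesis unfolding cell_integral(2)[OF assms(1)] .
qed

lemma cells_disjoint: "disjoint_family_on (\<lambda>c. {fst c<..<snd c}) C"
  unfolding disjoint_family_on_def
proof (intro ballI impI)
  fix c d assume "c \<in> C" "d \<in> C" "c \<noteq> d"
  then have "snd c \<le> fst d \<or> snd d \<le> fst c" using cells_apart by blast
  then show "{fst c<..<snd c} \<inter> {fst d<..<snd d} = {}" by auto
qed

lemma cell_subset_I: "c \<in> C \<Longrightarrow> {fst c<..<snd c} \<subseteq> I"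
proof
  fix u assume "c \<in> C" "u \<in> {fst c<..<snd c}"
  then show "u \<in> I" using cellD[of c] I_down[of "snd c" u] by auto
qed

lemma countable_C: "countable C" using C by (simp add: cell_family_def)

lemma excess_average_le:
  assumes "s \<ge> 0" shows "excess I (average C f) s \<le> excess I f s"
proof -
  note decreasingD(1)[OF f, measurable] and average_borel [measurable]
  have "(\<integral>\<^sup>+u\<in>I. ennreal (average C f u - s) \<partial>lborel) \<le> (\<integral>\<^sup>+u\<in>I. ennreal (f u - s) \<partial>lborel)"
  proof (rule nn_integral_le_on_cells[OF _ _ countable_C _ cells_disjoint])
    fix c assume c: "c \<in> C"
    have r: "(\<integral>\<^sup>+u\<in>{fst c<..<snd c}. h u * indicator I u \<partial>lborel) = (\<integral>\<^sup>+u\<in>{fst c<..<snd c}. h u \<partial>lborel)" for h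
      using cell_subset_I[OF c] by (intro nn_integral_cong) (auto simp: indicator_def)
    show "(\<integral>\<^sup>+u\<in>{fst c<..<snd c}. (ennreal (average C f u - s) * indicator I u) \<partial>lborel) \<le> (\<integral>\<^sup>+u\<in>{fst c<..<snd c}. (ennreal (f u - s) * indicator I u) \<partial>lborel)"
      unfolding r by (rule cell_jensen[OF c assms])
  qed (use average_out in \<open>auto simp: indicator_def\<close>)
  moreover have "(\<integral>\<^sup>+u\<in>I. ennreal (\<bar>g u\<bar> - s) \<partial>lborel) = (\<integral>\<^sup>+u\<in>I. ennreal (g u - s) \<partial>lborel)"
    if "\<And>u. u > 0 \<Longrightarrow> g u \<ge> 0" for g :: "real \<Rightarrow> real"
    using that I_pos by (intro nn_integral_cong) (auto simp: indicator_def)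
  ultimately show ?thesis using average_nonneg decreasingD(3)[OF f] by (simp add: excess_borel)
qed

lemma decreasing_average: "decreasing (average C f)"
  unfolding decreasing_def
  using excess_le_in_L1_plus_Linf[OF borel_meas[OF average_borel] decreasingD(2)[OF f] excess_average_le] average_nonneg average_antimono average_borel by simp

lemma mass_average_le: "t > 0 \<Longrightarrow> mass (average C f) t \<le> mass f t"
  using decreasing_average decreasingD(2)[OF f] excess_average_le by (intro mass_mono_excess) (auto simp: decreasing_def)

text \<open>
  Averaging moves mass only within cells, so the masses agree at every time that is not interior to a cell.
\<close>
lemma mass_average_outside:
  assumes "t > 0" "\<And>c. c \<in> C \<Longrightarrow> \<not> (fst c < t \<and> t < snd c)"
  shows "mass (average C f) t = mass f t"
proof -
  note decreasingD(1)[OF f, measurable] and average_borel [measurable]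
  have in_or_out: "(\<integral>\<^sup>+u\<in>{fst c<..<snd c}. (ennreal (average C f u) * indicator ({0<..<t} \<inter> I) u) \<partial>lborel)
     = (\<integral>\<^sup>+u\<in>{fst c<..<snd c}. (ennreal (f u) * indicator ({0<..<t} \<inter> I) u) \<partial>lborel)"
    if c: "c \<in> C" for c
  proof (cases "snd c \<le> t")
    case True
    have "(\<integral>\<^sup>+u\<in>{fst c<..<snd c}. (h u * indicator ({0<..<t} \<inter> I) u) \<partial>lborel) = (\<integral>\<^sup>+u\<in>{fst c<..<snd c}. h u \<partial>lborel)" for h
      using cell_subset_I[OF c] True cellD[OF c] by (intro nn_integral_cong) (auto simp: indicator_def)
    then show ?thesis using cell_integral(1)[OF c] cell_integral(2)[OF c, of 0] by simp
  next
    case False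
    then have "t \<le> fst c" using assms(2)[OF c] by auto
    then show ?thesis by (intro nn_integral_cong) (auto simp: indicator_def)
  qed
  have "(\<integral>\<^sup>+u\<in>{0<..<t} \<inter> I. ennreal (average C f u) \<partial>lborel) = (\<integral>\<^sup>+u\<in>{0<..<t} \<inter> I. ennreal (f u) \<partial>lborel)"
  proof (rule antisym)
    have out: "average C f u = f u" if "u \<notin> (\<Union>c\<in>C. {fst c<..<snd c})" for u
      using that by (intro average_out) auto
    show "(\<integral>\<^sup>+u\<in>{0<..<t} \<inter> I. ennreal (average C f u) \<partial>lborel) \<le> (\<integral>\<^sup>+u\<in>{0<..<t} \<inter> I. ennreal (f u) \<partial>lborel)"
    proof (rule nn_integral_le_on_cells[OF _ _ countable_C _ cells_disjoint])
      fix u assume "u \<notin> (\<Union>c\<in>C. {fst c<..<snd c})"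
      then show "ennreal (average C f u) * indicator ({0<..<t} \<inter> I) u = ennreal (f u) * indicator ({0<..<t} \<inter> I) u" using out by simp
    qed (simp_all only: in_or_out order_refl, measurable)
    show "(\<integral>\<^sup>+u\<in>{0<..<t} \<inter> I. ennreal (f u) \<partial>lborel) \<le> (\<integral>\<^sup>+u\<in>{0<..<t} \<inter> I. ennreal (average C f u) \<partial>lborel)"
    proof (rule nn_integral_le_on_cells[OF _ _ countable_C _ cells_disjoint])
      fix u assume "u \<notin> (\<Union>c\<in>C. {fst c<..<snd c})"
      then show "ennreal (f u) * indicator ({0<..<t} \<inter> I) u = ennreal (average C f u) * indicator ({0<..<t} \<inter> I) u" using out by simp
    qed (simp_all only: in_or_out order_refl, measurable)
  qed
  then show ?thesis unfolding mass_def using rearr_mass_decreasing[OF f assms(1)] rearr_mass_decreasing[OF decreasing_average assms(1)] by simp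
qed

text \<open>
  On a cell the mass of the average interpolates the mass of \<open>f\<close> linearly.
\<close>
lemma mass_average_cell:
  assumes c: "c \<in> C" and r: "fst c \<le> r" "r \<le> snd c"
  shows "mass (average C f) (snd c) = mass f (snd c)"
    "mass f (snd c) - mass (average C f) r = (snd c - r) * cell_mean f c"
proof -
  have no: "\<not> (fst d < snd c \<and> snd c < snd d)" if "d \<in> C" for d
    using cells_apart[OF c that] cellD[OF c] by auto
  show e: "mass (average C f) (snd c) = mass f (snd c)"
    using cellD[OF c] no by (intro mass_average_outside) auto
  have "mass (average C f) (snd c) - mass (average C f) r = (snd c - r) * cell_mean f c"
    using cellD[OF c] r average_in[OF c] cell_mean_nonneg[OF c]
    by (intro mass_increment_const decreasing_average) auto
  then show "mass f (snd c) - mass (average C f) r = (snd c - r) * cell_mean f c" using e by simp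
qed

end
end

section \<open>Sparse nodes and the telescoping estimate\<close>

text \<open>
  Pigeonhole: the block from \<open>p\<close> to \<open>\<kappa>\<^sup>2\<^sup>k p\<close> splits into \<open>k\<close> pieces of ratio \<open>\<kappa>\<^sup>2\<close>, and one of them carries at most the
  fraction \<open>1/k\<close> of the increment of \<open>X\<close>. The node is the geometric centre of that piece.
\<close>
lemma sparse_block:
  fixes X :: "real \<Rightarrow> real"
  assumes k: "k \<ge> 1" and \<kappa>1: "\<kappa> \<ge> 1" and p: "p > 0"
  obtains \<tau> where "p \<le> \<tau> / \<kappa>" "\<kappa> * \<tau> \<le> (\<kappa>^2)^k * p" "X (\<kappa> * \<tau>) - X (\<tau> / \<kappa>) \<le> (X ((\<kappa>^2)^k * p) - X p) / real k"
proof -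
  have \<kappa>: "\<kappa> > 0" using \<kappa>1 by simp
  define q where "q r = p * (\<kappa>^2)^r" for r
  have "\<exists>r<k. X (q (Suc r)) - X (q r) \<le> (X (q k) - X (q 0)) / real k"
  proof (rule ccontr)
    assume "\<not> ?thesis"
    then have "(\<Sum>r<k. (X (q k) - X (q 0)) / real k) < (\<Sum>r<k. X (q (Suc r)) - X (q r))"
      using k by (intro sum_strict_mono) (auto simp: lessThan_empty_iff)
    also have "\<dots> = X (q k) - X (q 0)" by (rule sum_lessThan_telescope)
    finally show False using k by simp
  qed
  then obtain r where r: "r < k" "X (q (Suc r)) - X (q r) \<le> (X (q k) - X (q 0)) / real k" by auto
  show thesis
  proof (rule that[of "q r * \<kappa>"])
    have 1: "(\<kappa>^2)^r \<ge> 1" using \<kappa>1 by (intro one_le_power) auto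
    then show "p \<le> q r * \<kappa> / \<kappa>" using \<kappa> p by (simp add: q_def)
    have "(\<kappa>^2)^(Suc r) \<le> (\<kappa>^2)^k" using r \<kappa>1 by (intro power_increasing one_le_power) auto
    then have "q (Suc r) \<le> q k" using p by (simp add: q_def)
    moreover have e: "\<kappa> * (q r * \<kappa>) = q (Suc r)" "q r * \<kappa> / \<kappa> = q r" "q k = (\<kappa>^2)^k * p" "q 0 = p"
      using \<kappa> by (simp_all add: q_def power2_eq_square)
    ultimately show "\<kappa> * (q r * \<kappa>) \<le> (\<kappa>^2)^k * p" by simp
    show "X (\<kappa> * (q r * \<kappa>)) - X (q r * \<kappa> / \<kappa>) \<le> (X ((\<kappa>^2)^k * p) - X p) / real k"
      using r(2) unfolding e .
  qed
qed

text \<open>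
  The neighbourhood from \<open>\<tau> / node_ratio k\<close> to \<open>node_ratio k * \<tau>\<close> of a node has room for \<open>k + 1\<close> factors
  \<open>k\<close> on either side: \<open>k\<close> of them for the telescoping sum and one to spare, which on the left keeps the
  times \<open>ka\<close> below \<open>\<tau> / 2\<close>.
\<close>
definition node_ratio :: "nat \<Rightarrow> real" where "node_ratio k = real k ^ (k + 1)"
definition block_ratio :: "nat \<Rightarrow> nat" where "block_ratio k = ((k ^ (k + 1))^2)^k"

lemma real_block_ratio: "real (block_ratio k) = (node_ratio k ^ 2) ^ k"
  by (simp add: block_ratio_def node_ratio_def)

lemma node_ratio_ge: assumes "k \<ge> 2" shows "node_ratio k \<ge> 2" "node_ratio k > 0" "block_ratio k \<ge> 2"
proof -
  have "real k ^ 1 \<le> real k ^ (k + 1)" using assms by (intro power_increasing) auto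
  then show 1: "node_ratio k \<ge> 2" using assms unfolding node_ratio_def power_one_right by linarith
  then show "node_ratio k > 0" by simp
  have "2 \<le> (node_ratio k)^1" using 1 by simp
  also have "\<dots> \<le> (node_ratio k)^(2 * k)" using 1 assms by (intro power_increasing) auto
  finally have "2 \<le> real (block_ratio k)" by (simp add: real_block_ratio power_mult)
  then show "block_ratio k \<ge> 2" by linarith
qed

text \<open>
  Here \<open>h\<close> is a lower bound for the mass of \<open>y\<close> between \<open>t / 2\<close> and \<open>t\<close>. The assumption \<open>core\<close> is used for the
  \<open>k\<close> pairs \<open>a = t k\<^sup>l / node_ratio k\<close>, \<open>b = t k\<^sup>l\<close>; in the sum the increments of \<open>U\<close> and \<open>V\<close> telescope, whereas
  those of \<open>X\<close> and \<open>D\<close> are estimated separately for each pair.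
\<close>
lemma node_increment:
  fixes X Y U V D :: "real \<Rightarrow> real"
  assumes k: "k \<ge> 2" and t: "t > 0"
    and mono: "\<And>F a b. F \<in> {X, Y, U, V, D} \<Longrightarrow> 0 < a \<Longrightarrow> a \<le> b \<Longrightarrow> F a \<le> F b"
    and core: "\<And>a b. 0 < a \<Longrightarrow> a \<le> b \<Longrightarrow>
       Y b + V b + X a + U a + D a \<le> X (k * b) + V (k * b) + D (k * b) + Y (k * a) + U (k * a)"
    and gap: "\<And>r. t / node_ratio k \<le> r \<Longrightarrow> r \<le> t / 2 \<Longrightarrow> h \<le> Y t - Y r"
  defines "inc F \<equiv> F (node_ratio k * t) - F (t / node_ratio k)"
  shows "h \<le> inc X + inc D + (inc U + inc V) / real k"
proof -
  have mm: "\<And>a b. 0 < a \<Longrightarrow> a \<le> b \<Longrightarrow> X a \<le> X b" "\<And>a b. 0 < a \<Longrightarrow> a \<le> b \<Longrightarrow> Y a \<le> Y b"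
    "\<And>a b. 0 < a \<Longrightarrow> a \<le> b \<Longrightarrow> U a \<le> U b" "\<And>a b. 0 < a \<Longrightarrow> a \<le> b \<Longrightarrow> V a \<le> V b"
    "\<And>a b. 0 < a \<Longrightarrow> a \<le> b \<Longrightarrow> D a \<le> D b"
    by (rule mono; simp)+
  define \<kappa> where "\<kappa> = node_ratio k"
  have \<kappa>: "\<kappa> = real k ^ (k + 1)" "\<kappa> > 0" "\<kappa> \<ge> 1" using node_ratio_ge[OF k] by (auto simp: \<kappa>_def node_ratio_def)
  define b where "b l = t * real k ^ l" for l
  have bpos: "b l > 0" for l using k t by (simp add: b_def)
  have kb: "k * b l = b (Suc l)" for l by (simp add: b_def)
  have bmono: "l \<le> m \<Longrightarrow> b l \<le> b m" for l m using k t by (auto simp: b_def intro!: mult_left_mono power_increasing)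
  have b0: "b 0 = t" by (simp add: b_def)
  have bk: "b (Suc k) = \<kappa> * t" by (simp add: b_def \<kappa>)
  have each: "h \<le> inc X + inc D + (V (b (Suc l)) - V (b l)) + (U (b (Suc l) / \<kappa>) - U (b l / \<kappa>))" if l: "l < k" for l
  proof -
    have "b l / \<kappa> \<le> b l / 1" using bpos[of l] \<kappa> by (intro divide_left_mono) auto
    then have a: "0 < b l / \<kappa>" "b l / \<kappa> \<le> b l" using bpos[of l] \<kappa>(2) by auto
    have ka: "k * (b l / \<kappa>) = b (Suc l) / \<kappa>" using kb[of l] by simp
    have "b (Suc l) / \<kappa> \<le> b k / \<kappa>" using bmono[of "Suc l" k] l \<kappa>(2) by (intro divide_right_mono) auto
    also have "\<dots> = t / real k" using k by (simp add: b_def \<kappa>)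
    also have "\<dots> \<le> t / 2" using k t by (intro divide_left_mono) auto
    finally have r: "b (Suc l) / \<kappa> \<le> t / 2" .
    have "t / \<kappa> \<le> b (Suc l) / \<kappa>" using bmono[of 0 "Suc l"] b0 \<kappa>(2) by (intro divide_right_mono) auto
    then have "h \<le> Y t - Y (b (Suc l) / \<kappa>)" using gap r unfolding \<kappa>_def by blast
    also have "Y t \<le> Y (b l)" using bmono[of 0 l] b0 t by (intro mm) auto
    also have "Y (b l) - Y (b (Suc l) / \<kappa>) \<le> (X (b (Suc l)) - X (b l / \<kappa>)) + (D (b (Suc l)) - D (b l / \<kappa>))
        + (V (b (Suc l)) - V (b l)) + (U (b (Suc l) / \<kappa>) - U (b l / \<kappa>))"
      using core[OF a] unfolding ka kb by simp
    also have "\<dots> \<le> inc X + inc D + (V (b (Suc l)) - V (b l)) + (U (b (Suc l) / \<kappa>) - U (b l / \<kappa>))"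
    proof -
      have i1: "b (Suc l) \<le> \<kappa> * t" using bmono[of "Suc l" "Suc k"] l bk by simp
      have i2: "t / \<kappa> \<le> b l / \<kappa>" using bmono[of 0 l] b0 \<kappa>(2) by (intro divide_right_mono) auto
      have "X (b (Suc l)) \<le> X (\<kappa> * t)" "D (b (Suc l)) \<le> D (\<kappa> * t)" using i1 bpos by (auto intro!: mm)
      moreover have "X (t / \<kappa>) \<le> X (b l / \<kappa>)" "D (t / \<kappa>) \<le> D (b l / \<kappa>)" using i2 t \<kappa>(2) by (auto intro!: mm)
      ultimately show ?thesis by (simp add: inc_def \<kappa>_def)
    qed
    finally show ?thesis by simp
  qed
  have "real k * h = (\<Sum>l<k. h)" by simp
  also have "\<dots> \<le> (\<Sum>l<k. inc X + inc D + (V (b (Suc l)) - V (b l)) + (U (b (Suc l) / \<kappa>) - U (b l / \<kappa>)))"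
    using each by (intro sum_mono) auto
  also have "\<dots> = real k * (inc X + inc D) + (V (b k) - V (b 0)) + (U (b k / \<kappa>) - U (b 0 / \<kappa>))"
    by (simp add: sum.distrib sum_lessThan_telescope[of "\<lambda>l. V (b l)"] sum_lessThan_telescope[of "\<lambda>l. U (b l / \<kappa>)"])
  also have "\<dots> \<le> real k * (inc X + inc D) + inc V + inc U"
  proof -
    have "V (b k) \<le> V (\<kappa> * t)" using bmono[of k "Suc k"] bk bpos by (auto intro!: mm)
    moreover have "V (t / \<kappa>) \<le> V (b 0)" using b0 \<kappa>(2,3) t mult_left_mono[of 1 \<kappa> t] by (auto intro!: mm simp: field_simps)
    moreover have "b k / \<kappa> \<le> \<kappa> * t"
    proof -
      have "b k / \<kappa> \<le> b k / 1" using \<kappa>(2,3) bpos[of k] by (intro divide_left_mono) auto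
      then show ?thesis using bmono[of k "Suc k"] bk by simp
    qed
    then have "U (b k / \<kappa>) \<le> U (\<kappa> * t)" using bpos[of k] \<kappa>(2) by (auto intro!: mm)
    ultimately show ?thesis by (simp add: inc_def \<kappa>_def b0)
  qed
  finally show ?thesis using k by (simp add: field_simps)
qed

text \<open>
  The assumptions on \<open>\<tau>\<close> say that it has one node in each block \<open>[p i, p (i + 1)]\<close>, together with its
  neighbourhood, and that \<open>X\<close> has a small increment there. The assumption on \<open>Y\<close> says that \<open>Y\<close> is
  linear between consecutive nodes. The part beyond \<open>t/2\<close> of the cell that ends at a node \<open>t\<close> is
  estimated by \<open>node_increment\<close>; the sum over the cells telescopes on both sides.
\<close>
lemma window_increments:
  fixes X Y U V D :: "real \<Rightarrow> real" and \<tau> :: "nat \<Rightarrow> real"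
  assumes k: "k \<ge> 2" and s: "s > 0"
    and mono: "\<And>F a b. F \<in> {X, Y, U, V, D} \<Longrightarrow> 0 < a \<Longrightarrow> a \<le> b \<Longrightarrow> F a \<le> F b"
    and nonneg: "\<And>F a. F \<in> {X, Y, U, V, D} \<Longrightarrow> 0 < a \<Longrightarrow> 0 \<le> F a"
    and core: "\<And>a b. 0 < a \<Longrightarrow> a \<le> b \<Longrightarrow>
       Y b + V b + X a + U a + D a \<le> X (k * b) + V (k * b) + D (k * b) + Y (k * a) + U (k * a)"
  defines "p i \<equiv> s * real (block_ratio k) ^ i"
  defines "H t \<equiv> D t + (X t + U t + V t) / real k"
  assumes \<tau>: "\<And>i. p i \<le> \<tau> i / node_ratio k" "\<And>i. node_ratio k * \<tau> i \<le> p (Suc i)"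
      "\<And>i. X (node_ratio k * \<tau> i) - X (\<tau> i / node_ratio k) \<le> (X (p (Suc i)) - X (p i)) / real k"
    and Y: "\<And>i r. i < n \<Longrightarrow> \<tau> i \<le> r \<Longrightarrow> r \<le> \<tau> (Suc i) \<Longrightarrow>
       Y (\<tau> (Suc i)) - Y r = (\<tau> (Suc i) - r) * ((X (\<tau> (Suc i)) - X (\<tau> i)) / (\<tau> (Suc i) - \<tau> i))"
    and j: "j \<le> n"
  shows "X (p j) - X (p 1) \<le> 2 * H (p (Suc j))"
proof -
  have mm: "\<And>a b. 0 < a \<Longrightarrow> a \<le> b \<Longrightarrow> X a \<le> X b" "\<And>a b. 0 < a \<Longrightarrow> a \<le> b \<Longrightarrow> Y a \<le> Y b"
    "\<And>a b. 0 < a \<Longrightarrow> a \<le> b \<Longrightarrow> U a \<le> U b" "\<And>a b. 0 < a \<Longrightarrow> a \<le> b \<Longrightarrow> V a \<le> V b"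
    "\<And>a b. 0 < a \<Longrightarrow> a \<le> b \<Longrightarrow> D a \<le> D b"
    by (rule mono; simp)+
  note \<kappa> = node_ratio_ge[OF k]
  have ppos: "p i > 0" for i using s \<kappa>(3) by (simp add: p_def)
  have tpos: "\<tau> i > 0" for i
  proof -
    have "0 < \<tau> i / node_ratio k" using \<tau>(1)[of i] ppos[of i] by linarith
    then show ?thesis using \<kappa>(2) by (simp add: zero_less_divide_iff)
  qed
  have tl: "\<tau> i / node_ratio k \<le> \<tau> i" "\<tau> i \<le> node_ratio k * \<tau> i" for i
    using tpos[of i] \<kappa> mult_right_mono[of 1 "node_ratio k" "\<tau> i"] by (auto simp: field_simps)
  have step: "(X (\<tau> (Suc i)) - X (\<tau> i)) / 2 \<le> H (p (Suc (Suc i))) - H (p (Suc i))" if i: "i < n" for i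
  proof -
    define t where "t = \<tau> (Suc i)"
    have t: "t > 0" using tpos by (simp add: t_def)
    have lower: "\<tau> i \<le> t / node_ratio k" using tl(2)[of i] \<tau>(2)[of i] \<tau>(1)[of "Suc i"] by (simp add: t_def)
    have less: "\<tau> i \<le> t / 2"
    proof -
      have "t / node_ratio k \<le> t / 2" using t \<kappa> by (intro divide_left_mono) auto
      then show ?thesis using lower by linarith
    qed
    have inc: "X (\<tau> i) \<le> X t" using less t tpos by (intro mm) auto
    have half_mult: "c / 2 = w / 2 * (c / w)" if "w \<noteq> 0" for c w :: real using that by simp
    have gap: "(X t - X (\<tau> i)) / 2 \<le> Y t - Y r" if "t / node_ratio k \<le> r" "r \<le> t / 2" for r
    proof -
      have e: "Y t - Y r = (t - r) * ((X t - X (\<tau> i)) / (t - \<tau> i))"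
        using Y[OF i, of r] that lower t by (simp add: t_def)
      have "(X t - X (\<tau> i)) / 2 = (t - \<tau> i) / 2 * ((X t - X (\<tau> i)) / (t - \<tau> i))"
        using half_mult[of "t - \<tau> i" "X t - X (\<tau> i)"] less t by simp
      also have "\<dots> \<le> (t - r) * ((X t - X (\<tau> i)) / (t - \<tau> i))"
        using that less t tpos[of i] inc by (intro mult_right_mono) auto
      finally show ?thesis unfolding e .
    qed
    define inc' where "inc' F = F (node_ratio k * t) - F (t / node_ratio k)" for F :: "real \<Rightarrow> real"
    have "(X t - X (\<tau> i)) / 2 \<le> inc' X + inc' D + (inc' U + inc' V) / real k"
      unfolding inc'_def using k t mono core gap by (rule node_increment[where X = X and Y = Y and U = U and V = V and D = D])
    also have "\<dots> \<le> (X (p (Suc (Suc i))) - X (p (Suc i))) / real k + (D (p (Suc (Suc i))) - D (p (Suc i)))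
       + ((U (p (Suc (Suc i))) - U (p (Suc i))) + (V (p (Suc (Suc i))) - V (p (Suc i)))) / real k"
    proof -
      have "inc' F \<le> F (p (Suc (Suc i))) - F (p (Suc i))" if F: "F \<in> {X,Y,U,V,D}" for F
        using mono[OF F, of "node_ratio k * t" "p (Suc (Suc i))"] mono[OF F, of "p (Suc i)" "t / node_ratio k"]
          \<tau>(1)[of "Suc i"] \<tau>(2)[of "Suc i"] ppos[of "Suc i"] t \<kappa> by (simp add: inc'_def t_def)
      moreover have "inc' X \<le> (X (p (Suc (Suc i))) - X (p (Suc i))) / real k"
        using \<tau>(3)[of "Suc i"] by (simp add: inc'_def t_def)
      ultimately show ?thesis by (intro add_mono divide_right_mono) auto
    qed
    also have "\<dots> = H (p (Suc (Suc i))) - H (p (Suc i))" by (simp add: H_def diff_divide_distrib add_divide_distrib)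
    finally show ?thesis by (simp add: t_def)
  qed
  have "(X (\<tau> j) - X (\<tau> 0)) / 2 \<le> H (p (Suc j)) - H (p (Suc 0))" using j
  proof (induction j)
    case (Suc j)
    then show ?case using step[of j] by simp
  qed simp
  moreover have "H (p (Suc 0)) \<ge> 0" using nonneg ppos by (auto simp: H_def)
  moreover have "X (p j) \<le> X (\<tau> j)" using \<tau>(1)[of j] tl(1)[of j] ppos[of j] by (intro mm) auto
  moreover have "\<tau> 0 \<le> p 1" using \<tau>(2)[of 0] tl(2)[of 0] by (metis One_nat_def order_trans)
  then have "X (\<tau> 0) \<le> X (p 1)" using tpos by (intro mm) auto
  ultimately show ?thesis by simp
qed

lemma block_index:
  fixes s M t :: real
  assumes "s > 0" "M > 1" "s * M ^ i \<le> t" "t < s * M ^ n"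
  obtains j where "i \<le> j" "j < n" "s * M ^ j \<le> t" "t < s * M ^ Suc j"
proof -
  define j where "j = Max {j. j < n \<and> s * M ^ j \<le> t}"
  have "s * M ^ i < s * M ^ n" using assms by linarith
  then have "i < n" using assms by (simp add: power_strict_increasing_iff)
  then have i: "i \<in> {j. j < n \<and> s * M ^ j \<le> t}" using assms by simp
  have fin: "finite {j. j < n \<and> s * M ^ j \<le> t}" by simp
  have j: "j \<in> {j. j < n \<and> s * M ^ j \<le> t}" unfolding j_def using i fin by (intro Max_in) auto
  have "i \<le> j" unfolding j_def using i fin by (intro Max_ge) auto
  moreover have "t < s * M ^ Suc j"
  proof (cases "Suc j = n")
    case False
    show ?thesis
    proof (rule ccontr)
      assume "\<not> ?thesis"
      then have "Suc j \<in> {j. j < n \<and> s * M ^ j \<le> t}" using j False by auto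
      then have "Suc j \<le> j" unfolding j_def using fin by (intro Max_ge) auto
      then show False by simp
    qed
  qed (use assms in simp)
  ultimately show thesis using that j by blast
qed

section \<open>Spreading and truncation\<close>

context unit_or_half_line
begin

text \<open>
  The dilation divided by \<open>m\<close>, which preserves the integral over the half-line.
\<close>
definition spread :: "nat \<Rightarrow> (real \<Rightarrow> real) \<Rightarrow> real \<Rightarrow> real" where
  "spread m z t = 1 / real m * z (t / real m)"

definition window :: "(real \<Rightarrow> real) \<Rightarrow> real set \<Rightarrow> real \<Rightarrow> real" where
  "window f W t = f t * indicator W t"

lemma spread_borel:
  assumes [measurable]: "z \<in> borel_measurable borel" shows "spread m z \<in> borel_measurable borel"
  unfolding spread_def by measurable

text \<open>
  An inequality, because on \<open>(0,1)\<close> the part of \<open>z\<close> beyond \<open>1/m\<close> is pushed out of the interval.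
\<close>
lemma excess_spread:
  assumes [measurable]: "z \<in> borel_measurable borel" and m: "m \<ge> 1"
  shows "excess I (spread m z) s \<le> excess I z (real m * s)"
proof -
  note spread_borel[OF assms(1), measurable]
  have "excess I (spread m z) s = (\<integral>\<^sup>+u\<in>I. ennreal (\<bar>spread m z u\<bar> - s) \<partial>lborel)"
    by (rule excess_borel) measurable
  also have "\<dots> = ennreal (real m) * (\<integral>\<^sup>+u. ennreal (\<bar>spread m z (real m * u)\<bar> - s) * indicator I (real m * u) \<partial>lborel)"
    using m by (subst nn_integral_real_affine[where c = "real m" and t = 0]) auto
  also have "\<dots> = (\<integral>\<^sup>+u. ennreal (real m) * (ennreal (\<bar>spread m z (real m * u)\<bar> - s) * indicator I (real m * u)) \<partial>lborel)"
    by (subst nn_integral_cmult) auto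
  also have "\<dots> \<le> (\<integral>\<^sup>+u\<in>I. ennreal (\<bar>z u\<bar> - real m * s) \<partial>lborel)"
  proof (rule nn_integral_mono)
    fix u
    show "ennreal (real m) * (ennreal (\<bar>spread m z (real m * u)\<bar> - s) * indicator I (real m * u)) \<le> ennreal (\<bar>z u\<bar> - real m * s) * indicator I u"
    proof (cases "real m * u \<in> I")
      case True
      have "0 < u" using I_pos[OF True] m by (simp add: zero_less_mult_iff)
      then have "u \<in> I" using I_down[OF True, of u] m mult_right_mono[of 1 "real m" u] by simp
      moreover have "real m * (\<bar>spread m z (real m * u)\<bar> - s) = \<bar>z u\<bar> - real m * s"
        using m by (simp add: spread_def abs_mult right_diff_distrib)
      then have "ennreal (real m) * ennreal (\<bar>spread m z (real m * u)\<bar> - s) = ennreal (\<bar>z u\<bar> - real m * s)"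
        by (simp flip: ennreal_mult')
      ultimately show ?thesis using True by simp
    qed simp
  qed
  also have "\<dots> = excess I z (real m * s)" by (rule excess_borel[symmetric]) measurable
  finally show ?thesis .
qed

lemma spread_L1Linf:
  assumes "z \<in> borel_measurable borel" "z \<in> L1Linf" "m \<ge> 1" shows "spread m z \<in> L1Linf"
proof -
  obtain s where s: "s \<ge> 0" "excess I z s < \<infinity>" using assms(2) by (auto simp: L1_plus_Linf_iff)
  have "excess I (spread m z) (s / real m) \<le> excess I z s" using excess_spread[OF assms(1,3), of "s / real m"] assms(3) by simp
  then have "excess I (spread m z) (s / real m) < \<infinity>" using s by simp
  then show ?thesis unfolding L1_plus_Linf_iff using borel_meas[OF spread_borel[OF assms(1)]] s
    by (auto intro!: exI[of _ "s / real m"])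
qed

lemma mass_spread:
  assumes z: "z \<in> borel_measurable borel" "z \<in> L1Linf" and m: "m \<ge> 1" and t: "t > 0"
  shows "mass (spread m z) t \<le> mass z (t / real m)"
proof -
  have tm: "t / real m > 0" using t m by simp
  obtain s e where s: "s \<ge> 0" "e \<ge> 0" "excess I z s = ennreal e" "mass z (t / real m) = t / real m * s + e"
    using mass_attained[OF z(2) tm] .
  have "mass (spread m z) t \<le> t * (s / real m) + e"
    using s m excess_spread[OF z(1) m, of "s / real m"] by (intro mass_le spread_L1Linf z m t) auto
  then show ?thesis using s by simp
qed

lemma window_borel:
  assumes [measurable]: "f \<in> borel_measurable borel" "W \<in> sets borel" shows "window f W \<in> borel_measurable borel"
  unfolding window_def by measurable

lemma window_L1Linf:
  assumes "f \<in> borel_measurable borel" "f \<in> L1Linf" "W \<in> sets borel" shows "window f W \<in> L1Linf"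
  by (rule excess_le_in_L1_plus_Linf[OF borel_meas[OF window_borel] assms(2)])
     (use assms in \<open>auto intro!: excess_mono_fun simp: window_def indicator_def\<close>)

context
  fixes f :: "real \<Rightarrow> real" and a b :: real
  assumes f: "decreasing f" and ab: "0 < a" "b \<in> I"
begin

text \<open>
  The window function lies below the part of \<open>f\<close> to the right of \<open>q\<close>, whose rearrangement is the translate of \<open>f\<close>
  by \<open>q\<close>.
\<close>
lemma window_mass_le:
  assumes q: "0 < q" "q \<le> a" "q + r \<in> I" and r: "r > 0"
  shows "mass (window f {a<..<b}) r \<le> mass f (q + r) - mass f q"
proof -
  note decreasingD(1)[OF f, measurable]
  let ?z = "window f {a<..<b}" and ?s = "f (q + r)"
  have s: "?s \<ge> 0" using decreasingD(3)[OF f] q r by simp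
  have inc: "ennreal (mass f (q + r) - mass f q) = (\<integral>\<^sup>+u\<in>{q<..<q + r}. ennreal (f u) \<partial>lborel)"
    using q r by (intro mass_increment f) auto
  have neg: "ennreal (f u - ?s) = 0" if "\<not> u < q + r" for u
    using decreasingD(4)[OF f, of "q + r" u] q r that by (simp add: ennreal_neg)
  have "excess I ?z ?s = (\<integral>\<^sup>+u\<in>I. ennreal (\<bar>?z u\<bar> - ?s) \<partial>lborel)"
    by (rule excess_borel) (intro window_borel, auto)
  also have "\<dots> \<le> (\<integral>\<^sup>+u. ennreal (f u - ?s) * indicator {q<..<q + r} u \<partial>lborel)"
    using decreasingD(3,4)[OF f] q s ab
    by (intro nn_integral_mono) (auto simp: window_def indicator_def ennreal_neg neg)
  finally have "excess I ?z ?s \<le> (\<integral>\<^sup>+u. ennreal (f u - ?s) * indicator {q<..<q + r} u \<partial>lborel)" .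
  moreover have "rearr_mass I ?z r \<le> ennreal (r * ?s) + excess I ?z ?s"
    by (intro rearr_mass_le window_L1Linf decreasingD[OF f] s r) auto
  ultimately have "rearr_mass I ?z r \<le> ennreal (r * ?s) + (\<integral>\<^sup>+u. ennreal (f u - ?s) * indicator {q<..<q + r} u \<partial>lborel)"
    by (meson add_left_mono order_trans)
  also have "ennreal (r * ?s) = (\<integral>\<^sup>+u\<in>{q<..<q + r}. ennreal ?s \<partial>lborel)"
    using r s by (subst nn_integral_const_interval) auto
  also have "\<dots> + (\<integral>\<^sup>+u. ennreal (f u - ?s) * indicator {q<..<q + r} u \<partial>lborel)
     = (\<integral>\<^sup>+u. ennreal ?s * indicator {q<..<q + r} u + ennreal (f u - ?s) * indicator {q<..<q + r} u \<partial>lborel)"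
    by (rule nn_integral_add[symmetric]) auto
  also have "\<dots> = (\<integral>\<^sup>+u\<in>{q<..<q + r}. ennreal (f u) \<partial>lborel)"
    using decreasingD(4)[OF f, of _ "q + r"] q s
    by (intro nn_integral_cong) (auto simp: indicator_def ennreal_plus[symmetric] simp del: ennreal_plus)
  also note inc[symmetric]
  finally have "ennreal (mass ?z r) \<le> ennreal (mass f (q + r) - mass f q)"
    using r by (subst ennreal_mass) (auto intro!: window_L1Linf decreasingD[OF f])
  then show ?thesis using mass_mono[OF decreasingD(2)[OF f], of q "q + r"] q r by (subst (asm) ennreal_le_iff) auto
qed

lemma window_mass_total:
  assumes q: "0 < q" "q \<le> a" "q \<le> d" "b \<le> d" "d \<in> I" and r: "r > 0"
  shows "mass (window f {a<..<b}) r \<le> mass f d - mass f q"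
proof -
  note decreasingD(1)[OF f, measurable]
  let ?z = "window f {a<..<b}"
  have "excess I ?z 0 = (\<integral>\<^sup>+u\<in>I. ennreal (\<bar>?z u\<bar> - 0) \<partial>lborel)"
    by (rule excess_borel) (intro window_borel, auto)
  also have "\<dots> \<le> (\<integral>\<^sup>+u\<in>{q<..<d}. ennreal (f u) \<partial>lborel)"
    using decreasingD(3)[OF f] q ab by (intro nn_integral_mono) (auto simp: window_def indicator_def)
  also have "\<dots> = ennreal (mass f d - mass f q)" using q by (intro mass_increment[symmetric] f) auto
  finally have "mass ?z r \<le> r * 0 + (mass f d - mass f q)"
    using mass_mono[OF decreasingD(2)[OF f], of q d] q by (intro mass_le window_L1Linf decreasingD[OF f] r) auto
  then show ?thesis by simp
qed

lemma window_mass_bounded: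
  assumes q: "0 < q" "q \<le> a" and r: "r > 0"
  shows "mass (window f {a<..<b}) r \<le> r * f q"
proof -
  note decreasingD(1)[OF f, measurable]
  let ?z = "window f {a<..<b}"
  have fq: "f q \<ge> 0" using decreasingD(3)[OF f] q by simp
  have "excess I ?z (f q) = (\<integral>\<^sup>+u\<in>I. ennreal (\<bar>?z u\<bar> - f q) \<partial>lborel)"
    by (rule excess_borel) (intro window_borel, auto)
  also have "\<dots> = (\<integral>\<^sup>+u. 0 \<partial>(lborel :: real measure))"
    using decreasingD(3)[OF f] decreasingD(4)[OF f, of q] q fq by (intro nn_integral_cong) (auto simp: window_def indicator_def ennreal_neg)
  finally have "mass ?z r \<le> r * f q + 0"
    using fq q(1) by (intro mass_le window_L1Linf decreasingD[OF f] r) auto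
  then show ?thesis by simp
qed

text \<open>
  The hypothesis \<open>grid\<close> controls the masses at the points \<open>p j\<close> only, and bounds \<open>H\<close> from below only from \<open>p 3\<close> on.
  Between grid points monotonicity loses a factor \<open>M\<close> in time. Below \<open>p 3\<close> the window function is
  bounded by \<open>f (p 2)\<close>, so its mass grows at most linearly, while \<open>H\<close> grows at least linearly by concavity.
  The exponent three of the dilation covers all these losses.
\<close>
lemma spread_window_mass_le:
  fixes p :: "nat \<Rightarrow> real" and H :: "real \<Rightarrow> real" and M :: nat
  assumes s: "s > 0" and M: "M \<ge> 2" and p: "\<And>i. p i = s * real M ^ i"
    and inI: "p (Suc n) \<in> I" and W: "p 2 \<le> a" "b \<le> p n" and n: "n \<ge> 2"
    and grid: "\<And>j. j \<le> n \<Longrightarrow> mass f (p j) - mass f (p 1) \<le> 2 * H (p (Suc j))"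
    and Hmono: "\<And>t u. 0 < t \<Longrightarrow> t \<le> u \<Longrightarrow> H t \<le> H u"
    and Hconc: "\<And>t u. 0 < t \<Longrightarrow> t \<le> u \<Longrightarrow> t / u * H u \<le> H t"
    and t: "t > 0"
  shows "mass (spread (M ^ 3) (window f {a<..<b})) t \<le> 2 * H t"
proof -
  let ?z = "window f {a<..<b}"
  have Mr: "real M \<ge> 2" using M by simp
  have ppos: "p i > 0" for i using s M by (simp add: p)
  have pS: "p (Suc i) = real M * p i" for i by (simp add: p)
  have pmono: "i \<le> j \<Longrightarrow> p i \<le> p j" for i j using s Mr by (auto simp: p intro!: mult_left_mono power_increasing)
  have pI: "i \<le> Suc n \<Longrightarrow> p i \<in> I" for i using I_down[OF inI ppos] pmono by blast
  define r where "r = t / real M ^ 3"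
  have r: "r > 0" using t M by (simp add: r_def)
  have "mass (spread (M ^ 3) ?z) t \<le> mass ?z r"
    using mass_spread[of ?z "M ^ 3" t] t M decreasingD[OF f] by (simp add: r_def window_borel window_L1Linf)
  also have "mass ?z r \<le> 2 * H t"
  proof -
    consider "t \<ge> p (Suc n)" | "p 3 \<le> t" "t < p (Suc n)" | "t < p 3" by linarith
    then show ?thesis
    proof cases
      case 1
      have "mass ?z r \<le> mass f (p n) - mass f (p 1)"
        using W pmono[of 1 2] pmono[of 1 n] n ppos pI r by (intro window_mass_total) auto
      also have "\<dots> \<le> 2 * H (p (Suc n))" by (rule grid) simp
      also have "\<dots> \<le> 2 * H t" using 1 Hmono[OF ppos] by simp
      finally show ?thesis .
    next
      case 2
      have "s * real M ^ 3 \<le> t" "t < s * real M ^ Suc n" "real M > 1" using 2 Mr by (auto simp: p)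
      then obtain i where i: "3 \<le> i" "i < Suc n" "p i \<le> t" "t < p (Suc i)" using block_index[of s "real M" 3 t "Suc n"] s unfolding p by metis
      then obtain j where j: "i = Suc j" "2 \<le> j" "j \<le> n" by (cases i) auto
      obtain l where l: "j = Suc l" "1 \<le> l" using j by (cases j) auto
      have "t < real M ^ 3 * p l" using i(4) j(1) l(1) by (simp add: pS power3_eq_cube)
      then have "r < p l" using M by (simp add: r_def field_simps)
      moreover have "p 1 \<le> p l" "2 * p l \<le> real M * p l" "p j = real M * p l"
        using pmono[OF l(2)] ppos[of l] mult_right_mono[OF Mr, of "p l"] by (auto simp: l(1) pS)
      ultimately have rj: "p 1 + r \<le> p j" by linarith
      have "mass ?z r \<le> mass f (p 1 + r) - mass f (p 1)"
        using W pmono[of 1 2] ppos[of 1] rj pI[of j] j(3) r I_down[of "p j" "p 1 + r"] by (intro window_mass_le) auto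
      also have "\<dots> \<le> mass f (p j) - mass f (p 1)" using mass_mono[OF decreasingD(2)[OF f] _ rj] ppos[of 1] r by simp
      also have "\<dots> \<le> 2 * H (p (Suc j))" by (rule grid[OF j(3)])
      also have "\<dots> \<le> 2 * H t" using i(3) j(1) Hmono[OF ppos] by simp
      finally show ?thesis .
    next
      case 3
      have p3: "p 3 = real M ^ 2 * p 1" "p 2 = real M * p 1" by (simp_all add: p power2_eq_square power3_eq_cube)
      have f2: "f (p 2) \<ge> 0" using decreasingD(3)[OF f] ppos by simp
      have "mass ?z r \<le> r * f (p 2)" using W ppos r by (intro window_mass_bounded) auto
      also have "\<dots> \<le> t / p 3 * ((p 2 - p 1) * f (p 2))"
      proof -
        have "1 / real M ^ 3 \<le> (p 2 - p 1) / p 3"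
        proof -
          have "(p 2 - p 1) / p 3 = (real M - 1) / real M ^ 2"
            using ppos[of 1] M by (simp add: p3 field_simps)
          moreover have "1 \<le> real M * (real M - 1)" using mult_mono[of 1 "real M" 1 "real M - 1"] Mr by simp
          then have "1 / real M ^ 3 \<le> (real M * (real M - 1)) / real M ^ 3" using Mr by (intro divide_right_mono) auto
          moreover have "(real M * (real M - 1)) / real M ^ 3 = (real M - 1) / real M ^ 2" using Mr by (simp add: power2_eq_square power3_eq_cube)
          ultimately show ?thesis by simp
        qed
        then have "t * f (p 2) * (1 / real M ^ 3) \<le> t * f (p 2) * ((p 2 - p 1) / p 3)" using t f2 by (intro mult_left_mono) auto
        then show ?thesis by (simp add: r_def mult_ac)
      qed
      also have "\<dots> \<le> t / p 3 * (mass f (p 2) - mass f (p 1))"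
        using mass_increment_bounds(1)[OF f, of "p 1" "p 2"] ppos pmono[of 1 2] pI[of 2] n t less_imp_le[OF ppos[of 3]]
        by (intro mult_left_mono) auto
      also have "\<dots> \<le> t / p 3 * (2 * H (p (Suc 2)))" using grid[of 2] n t less_imp_le[OF ppos[of 3]] by (intro mult_left_mono) auto
      also have "\<dots> = 2 * (t / p 3 * H (p 3))" by (simp add: numeral_3_eq_3)
      also have "\<dots> \<le> 2 * H t" using Hconc[OF t, of "p 3"] 3 by linarith
      finally show ?thesis .
    qed
  qed
  finally show ?thesis .
qed

end
end

section \<open>Spreads of bounded functions with bounded support\<close>

lemma null_or_bounded_below:
  fixes a :: "nat \<Rightarrow> real"
  assumes anti: "\<And>m n. 1 \<le> n \<Longrightarrow> n \<le> m \<Longrightarrow> a m \<le> a n" and nonneg: "\<And>m. 1 \<le> m \<Longrightarrow> 0 \<le> a m"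
  obtains "a \<longlonglongrightarrow> 0" | c where "c > 0" "\<And>m. 1 \<le> m \<Longrightarrow> c \<le> a m"
proof (cases "\<exists>c>0. \<forall>m\<ge>1. c \<le> a m")
  case False
  have "a \<longlonglongrightarrow> 0"
  proof (rule LIMSEQ_I)
    fix r :: real assume "0 < r"
    then obtain n where n: "n \<ge> 1" "a n < r" using False by force
    have "norm (a m - 0) < r" if "m \<ge> n" for m using anti[OF n(1) that] nonneg[of m] n that by simp
    then show "\<exists>no. \<forall>n\<ge>no. norm (a n - 0) < r" by blast
  qed
  then show thesis using that by blast
qed (use that in blast)

context unit_or_half_line
begin

lemma excess_antimono: "s \<le> r \<Longrightarrow> excess I f r \<le> excess I f s"
  unfolding excess_def by (intro nn_integral_mono ennreal_leI) auto

lemma decreasing_add: "decreasing f \<Longrightarrow> decreasing g \<Longrightarrow> decreasing (\<lambda>t. f t + g t)"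
  unfolding decreasing_def by (auto intro!: L1Linf_add add_mono borel_measurable_add)

lemma decreasing_cmult: "decreasing f \<Longrightarrow> c \<ge> 0 \<Longrightarrow> decreasing (\<lambda>t. c * f t)"
  unfolding decreasing_def by (auto intro!: L1Linf_cmult mult_left_mono borel_measurable_times)

lemma mass_decreasing_add:
  assumes f: "decreasing f" and g: "decreasing g" and t: "t > 0"
  shows "mass (\<lambda>t. f t + g t) t = mass f t + mass g t"
proof -
  have [measurable]: "f \<in> borel_measurable borel" "g \<in> borel_measurable borel"
    and nonneg: "\<And>u. u > 0 \<Longrightarrow> 0 \<le> f u" "\<And>u. u > 0 \<Longrightarrow> 0 \<le> g u"
    and L: "f \<in> L1Linf" "g \<in> L1Linf" using f g by (auto simp: decreasing_def)
  have "rearr_mass I (\<lambda>t. f t + g t) t = (\<integral>\<^sup>+u. ennreal (f u) * indicator ({0<..<t} \<inter> I) u + ennreal (g u) * indicator ({0<..<t} \<inter> I) u \<partial>lborel)"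
    unfolding rearr_mass_decreasing[OF decreasing_add[OF f g] t] using nonneg
    by (intro nn_integral_cong) (auto simp: indicator_def)
  also have "\<dots> = rearr_mass I f t + rearr_mass I g t"
    unfolding rearr_mass_decreasing[OF f t] rearr_mass_decreasing[OF g t] by (rule nn_integral_add) auto
  finally have "ennreal (mass (\<lambda>t. f t + g t) t) = ennreal (mass f t + mass g t)"
    using L t by (simp add: ennreal_mass[symmetric] L1Linf_add)
  then show ?thesis by (subst (asm) ennreal_inj) auto
qed

lemma mass_pos_rearr: "f \<in> L1Linf \<Longrightarrow> t > 0 \<Longrightarrow> mass (pos_rearr I f) t = mass f t"
  by (intro antisym mass_mono_excess pos_rearr_L1Linf) (auto simp: excess_pos_rearr)

lemma mass_abs: "mass (\<lambda>t. \<bar>f t\<bar>) t = mass f t"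
  by (simp add: mass_def rearr_mass_def rearr_def)

lemma spread_mult: "spread (m * n) z = spread m (spread n z)"
  by (auto simp: spread_def fun_eq_iff field_simps)

lemma decreasing_spread:
  assumes f: "decreasing f" and m: "m \<ge> 1" shows "decreasing (spread m f)"
proof -
  have "0 < s \<Longrightarrow> s \<le> t \<Longrightarrow> f (t / real m) \<le> f (s / real m)" for s t
    using f m unfolding decreasing_def by (simp add: divide_right_mono)
  then show ?thesis using f m spread_borel[of f m] spread_L1Linf[of f m]
    unfolding decreasing_def by (auto simp: spread_def divide_right_mono)
qed

text \<open>
  For decreasing \<open>f\<close> the spread by \<open>m\<close> has on \<open>(0,t)\<close> the same integral as \<open>f\<close> on the
  initial interval of all \<open>r\<close> with \<open>mr\<close> in \<open>(0,t) \<inter> I\<close>, which shrinks as \<open>m\<close> grows.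
\<close>
lemma mass_spread_antimono:
  assumes f: "decreasing f" and mn: "1 \<le> n" "n \<le> m" and t: "t > 0"
  shows "mass (spread m f) t \<le> mass (spread n f) t"
proof -
  have [measurable]: "f \<in> borel_measurable borel" and L: "f \<in> L1Linf" using f by (auto simp: decreasing_def)
  have eq: "rearr_mass I (spread k f) t = (\<integral>\<^sup>+u. ennreal (f u) * indicator ({0<..<t} \<inter> I) (real k * u) \<partial>lborel)" if k: "k \<ge> 1" for k
  proof -
    have [measurable]: "spread k f \<in> borel_measurable borel" by (rule spread_borel) measurable
    have "rearr_mass I (spread k f) t = (\<integral>\<^sup>+u\<in>{0<..<t} \<inter> I. ennreal (spread k f u) \<partial>lborel)"
      by (rule rearr_mass_decreasing[OF decreasing_spread[OF f k] t])
    also have "\<dots> = ennreal (real k) * (\<integral>\<^sup>+u. ennreal (spread k f (real k * u)) * indicator ({0<..<t} \<inter> I) (real k * u) \<partial>lborel)"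
      using k by (subst nn_integral_real_affine[where c = "real k" and t = 0]) auto
    also have "\<dots> = (\<integral>\<^sup>+u. ennreal (real k) * (ennreal (spread k f (real k * u)) * indicator ({0<..<t} \<inter> I) (real k * u)) \<partial>lborel)"
      by (subst nn_integral_cmult) auto
    also have "\<dots> = (\<integral>\<^sup>+u. ennreal (f u) * indicator ({0<..<t} \<inter> I) (real k * u) \<partial>lborel)"
    proof (rule nn_integral_cong)
      fix u
      have "ennreal (real k) * ennreal (spread k f (real k * u)) = ennreal (real k * spread k f (real k * u))" by (simp add: ennreal_mult')
      also have "\<dots> = ennreal (f u)" using k by (simp add: spread_def)
      finally show "ennreal (real k) * (ennreal (spread k f (real k * u)) * indicator ({0<..<t} \<inter> I) (real k * u)) = ennreal (f u) * indicator ({0<..<t} \<inter> I) (real k * u)"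
        by (metis mult.assoc)
    qed
    finally show ?thesis .
  qed
  have "rearr_mass I (spread m f) t \<le> rearr_mass I (spread n f) t"
  proof -
    have "indicator ({0<..<t} \<inter> I) (real m * u) \<le> (indicator ({0<..<t} \<inter> I) (real n * u) :: ennreal)" for u
    proof (cases "real m * u \<in> {0<..<t} \<inter> I")
      case True
      then have "0 < u" using mn by (auto simp: zero_less_mult_iff)
      then have "0 < real n * u" "real n * u \<le> real m * u" using mn by (auto intro: mult_right_mono)
      then have "real n * u \<in> {0<..<t} \<inter> I" using True I_down by auto
      then show ?thesis by (simp add: indicator_def)
    qed simp
    then show ?thesis using mn eq by (auto intro!: nn_integral_mono mult_left_mono)
  qed
  then have "ennreal (mass (spread m f) t) \<le> ennreal (mass (spread n f) t)"
    using L mn t by (subst (1 2) ennreal_mass) (auto intro!: spread_L1Linf)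
  then show ?thesis by (subst (asm) ennreal_le_iff) auto
qed

definition bump :: "real \<Rightarrow> real \<Rightarrow> real" where "bump r t = indicator {0<..<r} t"

lemma decreasing_bump: "decreasing (bump r)"
proof -
  have [measurable]: "bump r \<in> borel_measurable borel" unfolding bump_def by measurable
  have "excess I (bump r) 1 = 0" unfolding excess_def bump_def by (auto simp: indicator_def ennreal_neg)
  then have "bump r \<in> L1Linf" using borel_meas[of "bump r"] by (auto simp: L1_plus_Linf_iff intro!: exI[of _ 1])
  then show ?thesis by (auto simp: decreasing_def) (auto simp: bump_def indicator_def)
qed

lemma mass_bump_le:
  assumes "r > 0" "t > 0" shows "mass (bump r) t \<le> min r t"
proof -
  have L: "bump r \<in> L1Linf" and b: "bump r \<in> borel_measurable borel" using decreasing_bump by (auto simp: decreasing_def)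
  have "excess I (bump r) 1 = 0" unfolding excess_def bump_def by (auto simp: indicator_def ennreal_neg)
  then have 1: "mass (bump r) t \<le> t * 1 + 0" using assms by (intro mass_le L) auto
  have "excess I (bump r) 0 \<le> (\<integral>\<^sup>+u. indicator {0<..<r} u \<partial>lborel)" unfolding excess_borel[OF b]
    by (intro nn_integral_mono) (auto simp: bump_def indicator_def)
  also have "\<dots> = ennreal r" using assms by simp
  finally have "mass (bump r) t \<le> t * 0 + r" using assms by (intro mass_le L) auto
  then show ?thesis using 1 by simp
qed

text \<open>
  The supremum of the masses is the integral of the rearrangement, which is the integral of \<open>\<bar>g\<bar>\<close>.
\<close>
lemma finite_mass_integrable:
  assumes g: "g \<in> L1Linf" and B: "\<And>j::nat. j \<ge> 1 \<Longrightarrow> mass g (real j) \<le> B"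
  shows "integrable (lebesgue_on I) g"
proof -
  note pos_rearr_borel[OF g, measurable]
  have "excess I g 0 = (\<integral>\<^sup>+t. ennreal (pos_rearr I g t) \<partial>lborel)" using excess_rearr[OF g, of 0] by simp
  also have "\<dots> = (\<integral>\<^sup>+t\<in>(\<Union>j. {0<..<real (Suc j)}). ennreal (pos_rearr I g t) \<partial>lborel)"
  proof (rule nn_integral_cong)
    fix t :: real
    have "t \<in> (\<Union>j. {0<..<real (Suc j)})" if "t > 0"
    proof -
      obtain n where "t < real n" using reals_Archimedean2 by blast
      then have "t \<in> {0<..<real (Suc n)}" using that by simp
      then show ?thesis by blast
    qed
    then show "ennreal (pos_rearr I g t) = ennreal (pos_rearr I g t) * indicator (\<Union>j. {0<..<real (Suc j)}) t"
      by (cases "t > 0") (auto simp: pos_rearr_def)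
  qed
  also have "\<dots> = emeasure (density lborel (pos_rearr I g)) (\<Union>j. {0<..<real (Suc j)})"
    by (subst emeasure_density) auto
  also have "\<dots> = (SUP j. emeasure (density lborel (pos_rearr I g)) {0<..<real (Suc j)})"
    by (rule SUP_emeasure_incseq[symmetric]) (auto simp: incseq_def)
  also have "\<dots> \<le> ennreal B"
  proof (rule SUP_least)
    fix j
    have "emeasure (density lborel (pos_rearr I g)) {0<..<real (Suc j)} = rearr_mass I g (real (Suc j))"
      by (subst emeasure_density) (auto simp: rearr_mass_pos)
    also have "\<dots> = ennreal (mass g (real (Suc j)))" by (rule ennreal_mass[symmetric, OF g]) simp
    also have "\<dots> \<le> ennreal B" using B[of "Suc j"] by (intro ennreal_leI) simp
    finally show "emeasure (density lborel (pos_rearr I g)) {0<..<real (Suc j)} \<le> ennreal B" .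
  qed
  finally have "excess I g 0 < \<infinity>" by (simp add: order_le_less_trans)
  then show ?thesis using L1_plus_Linf_measD[OF g] by (simp add: excess_def integrable_iff_bounded)
qed

end

context fs_space
begin

lemma pos_rearr_E:
  assumes "x \<in> E" shows "pos_rearr I x \<in> E" "N (pos_rearr I x) \<le> N x"
  using dominated_excess[OF assms borel_meas[OF pos_rearr_borel[OF E_L1Linf[OF assms]]]] excess_pos_rearr[OF E_L1Linf[OF assms]] by auto

lemma spread_E:
  assumes z: "z \<in> E" "z \<in> borel_measurable borel" and m: "m \<ge> 1"
  shows "spread m z \<in> E" "N (spread m z) \<le> N z"
proof -
  have "excess I (spread m z) s \<le> excess I z s" if "s \<ge> 0" for s
    using order_trans[OF excess_spread[OF z(2) m, of s] excess_antimono[of s "real m * s"]] that m mult_right_mono[of 1 "real m" s] by auto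
  then show "spread m z \<in> E" "N (spread m z) \<le> N z"
    using dominated_excess[OF z(1) borel_meas[OF spread_borel[OF z(2)]]] by auto
qed

lemma N_AE_cong:
  assumes "x \<in> E" "meas y" "AE t in lebesgue_on I. y t = x t" shows "y \<in> E" "N y = N x"
proof -
  show y: "y \<in> E" by (rule dominated_AE(1)[OF assms(1,2)]) (use assms(3) in \<open>eventually_elim, simp\<close>)
  show "N y = N x"
    by (intro antisym dominated_AE(2) assms(1,2) y E_meas) (use assms(3) in \<open>eventually_elim, simp\<close>)+
qed

lemma spread_norm_antimono:
  assumes f: "decreasing f" "f \<in> E" and "1 \<le> n" "n \<le> m"
  shows "N (spread m f) \<le> N (spread n f)"
proof -
  have b: "f \<in> borel_measurable borel" using f by (simp add: decreasing_def)
  have "1 \<le> m" using assms by simp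
  show ?thesis
    by (rule dominated(2)[OF spread_E(1)[OF f(2) b assms(3)] E_L1Linf[OF spread_E(1)[OF f(2) b \<open>1 \<le> m\<close>]]])
       (rule mass_spread_antimono[OF f(1) assms(3,4)])
qed

text \<open>
  On \<open>(0,1)\<close> the spread by \<open>j\<close> is the constant \<open>1/j\<close>. On the half-line, suppose that the norms stay above
  \<open>c\<close>. For every \<open>g\<close> in \<open>E\<close> the spread by \<open>j\<close> of the indicator of \<open>(0,1)\<close>, multiplied by \<open>mass g j\<close>, is
  submajorized by \<open>g\<close>; so \<open>mass g j \<le> N g / c\<close> for all \<open>j\<close>, and \<open>g\<close> is integrable, contrary to the
  assumption on \<open>E\<close>.
\<close>
lemma bump_spread_null:
  assumes unit: "bump 1 \<in> E" and cond: "I = {0<..<1} \<or> (I = {0<..} \<and> \<not> E \<subseteq> {f. integrable (lebesgue_on I) f})"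
  shows "(\<lambda>j. N (spread j (bump 1))) \<longlonglongrightarrow> 0"
proof -
  have b: "bump 1 \<in> borel_measurable borel" "bump 1 \<in> L1Linf" using decreasing_bump by (auto simp: decreasing_def)
  have S: "spread j (bump 1) \<in> E" if "j \<ge> 1" for j by (rule spread_E(1)[OF unit b(1) that])
  from null_or_bounded_below[of "\<lambda>j. N (spread j (bump 1))", OF spread_norm_antimono[OF decreasing_bump unit] N_nonneg[OF S]]
  consider "(\<lambda>j. N (spread j (bump 1))) \<longlonglongrightarrow> 0" | c where "c > 0" "\<And>m. 1 \<le> m \<Longrightarrow> c \<le> N (spread m (bump 1))"
    by metis
  then show ?thesis
  proof cases
    case 2
    from cond show ?thesis
    proof
      assume I: "I = {0<..<1}"
      have "N (spread j (bump 1)) = (1 / real j) * N (bump 1)" if j: "j \<ge> 1" for j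
      proof -
        have "AE t in lebesgue_on I. spread j (bump 1) t = (1 / real j) * bump 1 t"
        proof (rule AE_I2)
          fix t assume t: "t \<in> space (lebesgue_on I)"
          then have "t / real j < 1" "0 < t" "t < 1" using I j by (auto simp: divide_less_eq)
          then show "spread j (bump 1) t = (1 / real j) * bump 1 t" using j by (simp add: spread_def bump_def)
        qed
        from N_AE_cong(2)[OF E_cmult[OF unit] borel_meas[OF spread_borel[OF b(1)]] this]
        show ?thesis using N_cmult[OF unit, of "1 / real j"] by simp
      qed
      then have "\<forall>\<^sub>F j in sequentially. N (spread j (bump 1)) = (1 / real j) * N (bump 1)"
        by (intro eventually_sequentiallyI[of 1])
      moreover have "(\<lambda>j. (1 / real j) * N (bump 1)) \<longlonglongrightarrow> 0 * N (bump 1)"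
        by (intro tendsto_mult tendsto_const lim_1_over_n)
      ultimately show ?thesis by (simp add: filterlim_cong)
    next
      assume "I = {0<..} \<and> \<not> E \<subseteq> {f. integrable (lebesgue_on I) f}"
      then obtain g where g: "g \<in> E" "\<not> integrable (lebesgue_on I) g" by auto
      have gL: "g \<in> L1Linf" by (rule E_L1Linf[OF g(1)])
      have "mass g (real j) \<le> N g / c" if j: "j \<ge> 1" for j
      proof (cases "mass g (real j) = 0")
        case True
        then show ?thesis using N_nonneg[OF g(1)] 2(1) by simp
      next
        case False
        then have pos: "mass g (real j) > 0" using mass_nonneg[of g "real j"] by linarith
        have "N (\<lambda>t. mass g (real j) * spread j (bump 1) t) \<le> N g"
        proof (rule dominated(2)[OF g(1)])
          show "(\<lambda>t. mass g (real j) * spread j (bump 1) t) \<in> L1Linf" using S[OF j] E_cmult E_L1Linf by blast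
          fix t :: real assume t: "t > 0"
          have "mass (\<lambda>u. mass g (real j) * spread j (bump 1) u) t = mass g (real j) * mass (spread j (bump 1)) t"
            by (rule mass_cmult[OF E_L1Linf[OF S[OF j]] t pos])
          also have "\<dots> \<le> mass g (real j) * mass (bump 1) (t / real j)"
            using mass_spread[OF b j t] by (intro mult_left_mono) auto
          also have "\<dots> \<le> mass g (real j) * min 1 (t / real j)"
            using mass_bump_le[of 1 "t / real j"] t j by (intro mult_left_mono) auto
          also have "\<dots> \<le> mass g t"
          proof (cases "t \<le> real j")
            case True
            then have "min 1 (t / real j) = t / real j" using j by (simp add: min_def)
            then show ?thesis using mass_concave[OF gL t True] by (simp add: mult.commute)
          next
            case False
            then have "min 1 (t / real j) = 1" using j by (simp add: min_def)
            then show ?thesis using mass_mono[OF gL, of "real j" t] False j by simp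
          qed
          finally show "mass (\<lambda>u. mass g (real j) * spread j (bump 1) u) t \<le> mass g t" .
        qed
        then have "mass g (real j) * N (spread j (bump 1)) \<le> N g" using N_cmult[OF S[OF j]] pos by simp
        moreover have "mass g (real j) * c \<le> mass g (real j) * N (spread j (bump 1))"
          using 2(2)[OF j] pos by (intro mult_left_mono) auto
        ultimately have "mass g (real j) * c \<le> N g" by linarith
        then show ?thesis using 2(1) by (simp add: field_simps)
      qed
      from finite_mass_integrable[OF gL this] g(2) show ?thesis by blast
    qed
  qed
qed

lemma window_E: "f \<in> E \<Longrightarrow> f \<in> borel_measurable borel \<Longrightarrow> W \<in> sets borel \<Longrightarrow> window f W \<in> E"
  using dominated_AE(1)[of f "window f W"] borel_meas[OF window_borel[of f W]]
  by (auto simp: window_def indicator_def)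

text \<open>
  Unless \<open>f\<close> vanishes from \<open>P\<close> on, a multiple of \<open>f\<close> dominates the indicator of \<open>(0,P)\<close>, so by spreading and
  domination all indicators of bounded initial intervals belong to \<open>E\<close>. The window lies below a multiple of one of them.
\<close>
lemma bounded_window_null:
  assumes f: "decreasing f" "f \<in> E" and P: "0 < P"
    and cond: "I = {0<..<1} \<or> (I = {0<..} \<and> \<not> E \<subseteq> {f. integrable (lebesgue_on I) f})"
  shows "(\<lambda>j. N (spread j (window f {P..Q}))) \<longlonglongrightarrow> 0"
proof -
  have fb: "f \<in> borel_measurable borel" and f0: "\<And>t. t > 0 \<Longrightarrow> 0 \<le> f t"
    and fd: "\<And>s t. 0 < s \<Longrightarrow> s \<le> t \<Longrightarrow> f t \<le> f s" using f by (auto simp: decreasing_def)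
  let ?w = "window f {P..Q}"
  have wE: "?w \<in> E" and wb: "?w \<in> borel_measurable borel" using f fb window_E window_borel by auto
  have wle: "0 \<le> ?w t" "?w t \<le> f P" for t
    using f0[of t] fd[of P t] P f0[of P] by (auto simp: window_def indicator_def)
  show ?thesis
  proof (cases "f P = 0")
    case True
    then have "?w t = 0" for t using wle[of t] by simp
    then have "spread j ?w = (\<lambda>t. 0)" for j by (simp add: spread_def fun_eq_iff)
    then show ?thesis by (simp add: N_zero)
  next
    case False
    then have fP: "f P > 0" using f0[OF P] by simp
    have bb: "bump r \<in> borel_measurable borel" for r using decreasing_bump by (simp add: decreasing_def)
    have bumpP: "bump P \<in> E"
    proof (rule dominated_AE(1)[OF E_cmult[OF f(2), of "1 / f P"] borel_meas[OF bb]])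
      show "AE u in lebesgue_on I. \<bar>bump P u\<bar> \<le> \<bar>1 / f P * f u\<bar>"
        using fd[of _ P] fP f0 by (intro AE_I2) (auto simp: bump_def indicator_def abs_of_nonneg)
    qed
    have scale: "bump (real m * r) = (\<lambda>t. real m * spread m (bump r) t)" if "m \<ge> 1" for m r
      using that by (auto simp: bump_def spread_def indicator_def fun_eq_iff field_simps)
    obtain m :: nat where m: "1 / P < real m" using reals_Archimedean2 by blast
    then have m1: "m \<ge> 1" using P by (cases m) auto
    have "bump (real m * P) \<in> E" unfolding scale[OF m1] by (intro E_cmult spread_E bumpP bb m1)
    then have unit: "bump 1 \<in> E"
      using m P by (rule_tac dominated_AE(1)[OF _ borel_meas[OF bb]]) (auto simp: bump_def indicator_def field_simps)
    obtain q :: nat where q: "max 1 Q < real q" using reals_Archimedean2 by blast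
    then have q1: "q \<ge> 1" by (cases q) auto
    have bq: "bump (real q) = (\<lambda>t. real q * spread q (bump 1) t)" using scale[OF q1, of 1] by simp
    have bqE: "bump (real q) \<in> E" unfolding bq by (intro E_cmult spread_E unit bb q1)
    have le: "N (spread j ?w) \<le> f P * (real q * N (spread j (bump 1)))" if j: "j \<ge> 1" for j
    proof -
      have "spread j (bump (real q)) = (\<lambda>t. real q * spread q (spread j (bump 1)) t)"
        unfolding bq by (simp add: spread_def fun_eq_iff field_simps)
      then have "N (spread j (bump (real q))) = real q * N (spread q (spread j (bump 1)))"
        using N_cmult[OF spread_E(1)[OF spread_E(1)[OF unit bb j] spread_borel[OF bb] q1], of "real q"] by simp
      also have "\<dots> \<le> real q * N (spread j (bump 1))"
        by (intro mult_left_mono spread_E spread_borel unit bb j q1) auto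
      finally have 1: "N (spread j (bump (real q))) \<le> real q * N (spread j (bump 1))" .
      have "N (spread j ?w) \<le> N (\<lambda>t. f P * spread j (bump (real q)) t)"
      proof (rule dominated_AE(2)[OF E_cmult[OF spread_E(1)[OF bqE bb j]] borel_meas[OF spread_borel[OF wb]]])
        have "\<bar>?w t\<bar> \<le> f P * bump (real q) t" for t
          using wle[of t] q P by (auto simp: bump_def window_def indicator_def)
        then have "\<bar>spread j ?w t\<bar> \<le> f P * spread j (bump (real q)) t" for t
          unfolding spread_def by (simp add: abs_mult divide_right_mono)
        then show "AE u in lebesgue_on I. \<bar>spread j ?w u\<bar> \<le> \<bar>f P * spread j (bump (real q)) u\<bar>"
          by (intro AE_I2) (meson abs_ge_self order_trans)
      qed
      also have "\<dots> = f P * N (spread j (bump (real q)))" using N_cmult[OF spread_E(1)[OF bqE bb j], of "f P"] fP by simp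
      also have "\<dots> \<le> f P * (real q * N (spread j (bump 1)))" using 1 fP by (intro mult_left_mono) auto
      finally show ?thesis .
    qed
    have "(\<lambda>j. f P * (real q * N (spread j (bump 1)))) \<longlonglongrightarrow> f P * (real q * 0)"
      by (intro tendsto_mult tendsto_const bump_spread_null[OF unit cond])
    then have lim: "(\<lambda>j. f P * (real q * N (spread j (bump 1)))) \<longlonglongrightarrow> 0" by simp
    show ?thesis
      by (rule tendsto_sandwich[OF _ _ tendsto_const lim])
         (auto intro!: eventually_sequentiallyI[of 1] le N_nonneg spread_E wE wb)
  qed
qed

end

section \<open>Separated windows with large spreads\<close>

context fs_space
begin

text \<open>
  Windows with end points in \<open>I\<close> exhaust the side \<open>G\<close>. If all their spreads had norm below \<open>d\<close>, then the limit of these,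
  the spread of the part of \<open>f\<close> on \<open>G\<close>, would have norm at most \<open>d\<close>, because the norm is a Fatou norm.
\<close>
lemma truncated_window:
  assumes f: "decreasing f" "f \<in> E" and fat: "fatou_norm I E N" and m: "m \<ge> 1"
    and G: "G = {0<..<P} \<or> G = {Q<..}" and P: "P \<in> I"
    and big: "d < N (spread m (window f G))" and d: "d > 0"
  obtains a b where "0 < a" "a < b" "b \<in> I" "{a<..<b} \<subseteq> G" "d \<le> N (spread m (window f {a<..<b}))"
proof -
  have fb: "f \<in> borel_measurable borel" using f by (simp add: decreasing_def)
  have Gb: "G \<in> sets borel" using G by auto
  \<comment> \<open>Points of \<open>I\<close> that tend to its right end.\<close>
  define top :: "nat \<Rightarrow> real" where "top n = (if I = {0<..<1} then 1 - 1 / real (n + 2) else real (n + 2))" for n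
  define a where "a n = max (1 / real (n + 2)) (if G = {0<..<P} then 0 else Q)" for n :: nat
  define b where "b n = (if G = {0<..<P} then min P (top n) else top n)" for n
  have topI: "top n \<in> I" for n using I_cases by (auto simp: top_def)
  have a0: "a n > 0" for n unfolding a_def by (simp add: less_max_iff_disj)
  have bI: "b n \<in> I" for n using topI[of n] P by (auto simp: b_def min_def)
  have sub: "{a n<..<b n} \<subseteq> G" for n
  proof
    fix t assume t: "t \<in> {a n<..<b n}"
    show "t \<in> G"
    proof (cases "G = {0<..<P}")
      case True
      then have "b n \<le> P" by (simp add: b_def)
      then have "t \<in> {0<..<P}" using t a0[of n] by simp
      then show ?thesis using True by simp
    next
      case False
      then have "Q \<le> a n" by (simp add: a_def)
      then show ?thesis using G False t by auto
    qed
  qed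
  have small: "\<forall>\<^sub>F n in sequentially. 1 / real (n + 2) < r" if "r > 0" for r
  proof -
    have "(\<lambda>n. 1 / real (n + 2)) \<longlonglongrightarrow> 0" using LIMSEQ_ignore_initial_segment[OF lim_1_over_n, of 2] by simp
    from order_tendstoD(2)[OF this that] show ?thesis .
  qed
  have in_window: "\<forall>\<^sub>F n in sequentially. a n < t \<and> t < b n" if t: "t \<in> I" "t \<in> G" for t
  proof -
    have t0: "t > 0" using I_pos t by auto
    have "\<forall>\<^sub>F n in sequentially. t < top n"
    proof (cases "I = {0<..<1}")
      case True
      then have "1 - t > 0" using t by auto
      from small[OF this] show ?thesis by eventually_elim (use True in \<open>simp add: top_def\<close>)
    next
      case False
      obtain n0 :: nat where "t < real n0" using reals_Archimedean2 by blast
      then have "t < top n" if "n \<ge> n0" for n using that False by (simp add: top_def)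
      then show ?thesis by (rule eventually_sequentiallyI)
    qed
    then show ?thesis using small[OF t0]
    proof eventually_elim
      case (elim n)
      show ?case
      proof (cases "G = {0<..<P}")
        case True
        then have "t < P" using t by simp
        then show ?thesis using True elim t0 by (simp add: a_def b_def)
      next
        case False
        then have "Q < t" using t G by auto
        then show ?thesis using False elim by (simp add: a_def b_def)
      qed
    qed
  qed
  have "\<exists>n. d \<le> N (spread m (window f {a n<..<b n}))"
  proof (rule ccontr)
    assume "\<not> ?thesis"
    then have lt: "N (spread m (window f {a n<..<b n})) < d" for n by (simp add: not_le)
    define X where "X n = (\<lambda>t. (1 / d) * spread m (window f {a n<..<b n}) t)" for n
    let ?x = "\<lambda>t. (1 / d) * spread m (window f G) t"
    have wE: "spread m (window f W) \<in> E" if "W \<in> sets borel" for W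
      by (intro spread_E window_E window_borel f fb that m)
    have XE: "X n \<in> E" for n unfolding X_def by (intro E_cmult wE) simp
    have XN: "N (X n) \<le> 1" for n
    proof -
      have "N (X n) = \<bar>1 / d\<bar> * N (spread m (window f {a n<..<b n}))"
        unfolding X_def by (intro N_cmult wE) simp
      also have "\<dots> \<le> \<bar>1 / d\<bar> * d" using lt[of n] by (intro mult_left_mono) auto
      finally show ?thesis using d by simp
    qed
    have lim: "AE t in lebesgue_on I. (\<lambda>n. X n t) \<longlonglongrightarrow> ?x t"
    proof (rule AE_I2)
      fix t assume "t \<in> space (lebesgue_on I)"
      then have t: "t \<in> I" by simp
      have tm: "t / real m \<in> I" using I_down[OF t, of "t / real m"] I_pos[OF t] m by (simp add: field_simps)
      have "\<forall>\<^sub>F n in sequentially. X n t = ?x t"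
      proof (cases "t / real m \<in> G")
        case True
        from in_window[OF tm True] show ?thesis
          by eventually_elim (use True in \<open>simp add: X_def spread_def window_def\<close>)
      next
        case False
        then have "t / real m \<notin> {a n<..<b n}" for n using sub by blast
        then show ?thesis using False by (simp add: X_def spread_def window_def)
      qed
      then show "(\<lambda>n. X n t) \<longlonglongrightarrow> ?x t" by (rule tendsto_eventually)
    qed
    have xm: "?x \<in> borel_measurable (lebesgue_on I)" by (intro E_meas E_cmult wE Gb)
    have bound: "\<forall>n. X n \<in> E \<and> N (X n) \<le> 1" using XE XN by simp
    have "N ?x \<le> 1"
      by (rule fat[unfolded fatou_norm_def, THEN spec[of _ X], THEN bspec, OF xm, THEN mp, OF bound, THEN mp, OF lim, THEN conjunct2])
    moreover have "N ?x = \<bar>1 / d\<bar> * N (spread m (window f G))" by (intro N_cmult wE Gb)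
    moreover have "\<bar>1 / d\<bar> * d < \<bar>1 / d\<bar> * N (spread m (window f G))" using big d by (intro mult_strict_left_mono) auto
    ultimately show False using d by simp
  qed
  then obtain n where n: "d \<le> N (spread m (window f {a n<..<b n}))" by blast
  have "a n < b n"
  proof (rule ccontr)
    assume "\<not> a n < b n"
    then have "spread m (window f {a n<..<b n}) = (\<lambda>t. 0)" by (auto simp: spread_def window_def fun_eq_iff)
    then show False using n N_zero d by simp
  qed
  then show thesis using that[OF a0 _ bI sub n] by blast
qed

text \<open>
  Spread by a large multiple \<open>j * m\<close> of \<open>m\<close>, the middle part of \<open>f\<close> has norm below \<open>c/3\<close>, so one of the two
  outer parts has norm above \<open>c/3\<close>. Spread by \<open>m\<close> only, that part has at least the same norm.
\<close>
lemma far_window: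
  assumes f: "decreasing f" "f \<in> E" and fat: "fatou_norm I E N" and m: "m \<ge> 1"
    and cond: "I = {0<..<1} \<or> (I = {0<..} \<and> \<not> E \<subseteq> {f. integrable (lebesgue_on I) f})"
    and PQ: "P \<in> I" "P \<le> Q" and c: "c > 0" "\<And>m. m \<ge> 1 \<Longrightarrow> c \<le> N (spread m f)"
  obtains a b where "0 < a" "a < b" "b \<in> I" "b \<le> P \<or> Q \<le> a" "c / 4 \<le> N (spread m (window f {a<..<b}))"
proof -
  have fb: "f \<in> borel_measurable borel" using f by (simp add: decreasing_def)
  have P: "P > 0" using PQ I_pos by blast
  have wE: "window f W \<in> E" "window f W \<in> borel_measurable borel" if "W \<in> sets borel" for W
    using that by (auto intro!: window_E window_borel f fb)
  from order_tendstoD(2)[OF bounded_window_null[OF f P cond, of Q], of "c / 3"] c(1)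
  obtain j0 where j0: "\<And>j. j \<ge> j0 \<Longrightarrow> N (spread j (window f {P..Q})) < c / 3"
    unfolding eventually_sequentially by auto
  define j where "j = max 1 j0"
  have j: "j \<ge> 1" "N (spread j (window f {P..Q})) < c / 3" using j0[of j] by (auto simp: j_def)
  have jm: "j * m \<ge> 1" using j m by (simp add: Suc_le_eq)
  let ?z = "\<lambda>W. spread (j * m) (window f W)"
  have E: "?z W \<in> E" if "W \<in> sets borel" for W by (intro spread_E wE that jm)
  have "c \<le> N (spread (j * m) f)" by (rule c(2)[OF jm])
  also have "\<dots> = N (\<lambda>t. (?z {0<..<P} t + ?z {P..Q} t) + ?z {Q<..} t)"
  proof (rule N_AE_cong(2))
    show "(\<lambda>t. (?z {0<..<P} t + ?z {P..Q} t) + ?z {Q<..} t) \<in> E"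
      by (intro E_add E) auto
    show "meas (spread (j * m) f)" by (intro borel_meas spread_borel fb)
    show "AE t in lebesgue_on I. spread (j * m) f t = (?z {0<..<P} t + ?z {P..Q} t) + ?z {Q<..} t"
    proof (rule AE_I2)
      fix t assume "t \<in> space (lebesgue_on I)"
      then have "t / real (j * m) > 0" using I_pos jm by simp
      moreover define u where "u = t / real (j * m)"
      ultimately have "f u = f u * indicator {0<..<P} u + f u * indicator {P..Q} u + f u * indicator {Q<..} u"
        using PQ by (auto simp: indicator_def)
      then show "spread (j * m) f t = (?z {0<..<P} t + ?z {P..Q} t) + ?z {Q<..} t"
        unfolding spread_def window_def u_def by (metis distrib_left)
    qed
  qed
  also have "\<dots> \<le> N (?z {0<..<P}) + N (?z {P..Q}) + N (?z {Q<..})"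
  proof -
    have "N (\<lambda>t. ?z {0<..<P} t + ?z {P..Q} t) \<le> N (?z {0<..<P}) + N (?z {P..Q})"
      by (intro N_add E) auto
    moreover have "N (\<lambda>t. (?z {0<..<P} t + ?z {P..Q} t) + ?z {Q<..} t)
       \<le> N (\<lambda>t. ?z {0<..<P} t + ?z {P..Q} t) + N (?z {Q<..})"
      by (intro N_add E_add E) auto
    ultimately show ?thesis by linarith
  qed
  finally have sum: "c \<le> N (?z {0<..<P}) + N (?z {P..Q}) + N (?z {Q<..})" .
  have "N (?z {P..Q}) = N (spread m (spread j (window f {P..Q})))"
    by (simp add: spread_mult[symmetric] mult.commute)
  also have "\<dots> \<le> N (spread j (window f {P..Q}))" by (intro spread_E spread_borel wE j m) auto
  finally have mid: "N (?z {P..Q}) < c / 3" using j(2) by simp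
  have outer: "N (?z W) \<le> N (spread m (window f W))" if "W \<in> sets borel" for W
    unfolding spread_mult by (intro spread_E spread_borel wE j m that)
  have "c / 3 < N (spread m (window f {0<..<P})) \<or> c / 3 < N (spread m (window f {Q<..}))"
    using sum mid outer[of "{0<..<P}"] outer[of "{Q<..}"] by auto
  then obtain G where G: "G = {0<..<P} \<or> G = {Q<..}" "c / 3 < N (spread m (window f G))" by auto
  then have "c / 4 < N (spread m (window f G))" using c(1) by linarith
  from truncated_window[OF f fat m G(1) PQ(1) this] c(1)
  obtain a b where ab: "0 < a" "a < b" "b \<in> I" "{a<..<b} \<subseteq> G" "c / 4 \<le> N (spread m (window f {a<..<b}))" by auto
  have "b \<le> P \<or> Q \<le> a"
    using G(1)
  proof
    assume "G = {0<..<P}"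
    then have "{a<..<b} \<subseteq> {..P}" using ab by auto
    then have "b \<le> P" using ab(2) by (metis closure_greaterThanLessThan atLeastAtMost_iff atMost_iff closed_atMost closure_minimal less_imp_le order_refl subsetD)
    then show ?thesis ..
  next
    assume "G = {Q<..}"
    then have "{a<..<b} \<subseteq> {Q..}" using ab by auto
    then have "Q \<le> a" using ab(2) by (metis closure_greaterThanLessThan atLeastAtMost_iff atLeast_iff closed_atLeast closure_minimal less_imp_le order_refl subsetD)
    then show ?thesis ..
  qed
  then show thesis using that ab by blast
qed

text \<open>
  The factor \<open>(M k)\<^sup>2\<close> on both sides is room for two blocks of nodes below the window and, above it,
  for rounding up to a whole number of blocks and one further block. The recursion keeps an interval \<open>[P, Q]\<close> that contains
  everything used so far; on \<open>(0,1)\<close> it starts with \<open>Q = 1\<close>, so that only windows to the left can occur.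
\<close>
lemma separated_windows:
  fixes M :: "nat \<Rightarrow> nat"
  assumes f: "decreasing f" "f \<in> E" and fat: "fatou_norm I E N"
    and cond: "I = {0<..<1} \<or> (I = {0<..} \<and> \<not> E \<subseteq> {f. integrable (lebesgue_on I) f})"
    and c: "c > 0" "\<And>m. m \<ge> 1 \<Longrightarrow> c \<le> N (spread m f)" and M: "\<And>k. M k \<ge> 2"
  obtains A B :: "nat \<Rightarrow> real" where
    "\<forall>k. 0 < A k \<and> A k < B k \<and> B k * real (M k)^2 \<in> I \<and> c / 4 \<le> N (spread (M k ^ 3) (window f {A k<..<B k}))"
    "\<forall>i k. i < k \<longrightarrow> B k * real (M k)^2 \<le> A i / real (M i)^2 \<or> B i * real (M i)^2 \<le> A k / real (M k)^2"
proof -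
  define Inv where "Inv = (\<lambda>(P,Q). P \<in> I \<and> P \<le> Q \<and> (I = {0<..} \<or> 1 \<le> Q))"
  define good where "good k P Q a b \<longleftrightarrow> 0 < a \<and> a < b \<and> b * real (M k)^2 \<in> I \<and> (b * real (M k)^2 \<le> P \<or> Q \<le> a / real (M k)^2)
     \<and> c / 4 \<le> N (spread (M k ^ 3) (window f {a<..<b}))" for k P Q a b
  define R where "R k = (\<lambda>(P,Q) (P',Q'). P' \<le> P \<and> Q \<le> Q' \<and> (\<exists>a b. good k P Q a b \<and> P' \<le> a / real (M k)^2 \<and> b * real (M k)^2 \<le> Q'))" for k
  have "\<exists>s. \<forall>n. Inv (s n) \<and> R n (s n) (s (Suc n))"
  proof (rule dependent_nat_choice)
    show "\<exists>x. Inv x" using I_cases by (intro exI[of _ "(1/2, 1)"]) (auto simp: Inv_def)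
    fix x k assume "Inv x"
    then obtain P Q where x: "x = (P,Q)" "P \<in> I" "P \<le> Q" "I = {0<..} \<or> 1 \<le> Q" by (cases x) (auto simp: Inv_def)
    define r where "r = real (M k)^2"
    have "(2::real)^2 \<le> r" unfolding r_def using M[of k] by (intro power_mono) auto
    then have r: "r > 0" "r \<ge> 1" by auto
    have P0: "P > 0" using x I_pos by auto
    have div: "u / r \<le> u" if "u > 0" for u using r that by (simp add: field_simps)
    have PI: "P / r \<in> I" using I_down[OF x(2), of "P / r"] P0 r div by auto
    have "Q \<le> Q * r" using x P0 mult_left_mono[OF r(2), of Q] by simp
    then have PQ: "P / r \<le> Q * r" using div[OF P0] x(3) by linarith
    have M3: "M k ^ 3 \<ge> 1" using M[of k] by simp
    obtain a b where ab: "0 < a" "a < b" "b \<in> I" "b \<le> P / r \<or> Q * r \<le> a" "c / 4 \<le> N (spread (M k ^ 3) (window f {a<..<b}))"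
      using far_window[OF f fat M3 cond PI PQ c] by metis
    have out: "b * r \<le> P \<or> Q \<le> a / r" using ab(4) r by (auto simp: field_simps)
    have brI: "b * r \<in> I"
    proof (cases "b * r \<le> P")
      case True
      then show ?thesis using I_down[OF x(2), of "b * r"] ab r by simp
    next
      case False
      then have "Q \<le> a / r" using out by simp
      then have "Q < b" using div[OF ab(1)] ab(2) by linarith
      then have "I = {0<..}" using x(4) ab(3) I_cases by auto
      then show ?thesis using ab r by simp
    qed
    have g: "good k P Q a b" unfolding good_def using ab out brI by (simp add: r_def)
    have arI: "a / r \<in> I" using I_down[OF ab(3), of "a / r"] div[OF ab(1)] ab r by auto
    have "Inv (min P (a / r), max Q (b * r))" unfolding Inv_def using x arI by (auto simp: min_def max_def)
    moreover have "R k x (min P (a / r), max Q (b * r))" unfolding R_def x(1) r_def prod.case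
      using g by (intro conjI exI[of _ a] exI[of _ b]) auto
    ultimately show "\<exists>y. Inv y \<and> R k x y" by blast
  qed
  then obtain s where s: "\<And>n. R n (s n) (s (Suc n))" by blast
  define P where "P n = fst (s n)" for n
  define Q where "Q n = snd (s n)" for n
  have R: "P (Suc n) \<le> P n" "Q n \<le> Q (Suc n)"
     "\<exists>a b. good n (P n) (Q n) a b \<and> P (Suc n) \<le> a / real (M n)^2 \<and> b * real (M n)^2 \<le> Q (Suc n)" for n
    using s[of n] unfolding R_def P_def Q_def by (auto simp: case_prod_beta)
  have Pm: "i \<le> k \<Longrightarrow> P k \<le> P i" and Qm: "i \<le> k \<Longrightarrow> Q i \<le> Q k" for i k
    using lift_Suc_antimono_le[of P, OF R(1)] lift_Suc_mono_le[of Q, OF R(2)] by auto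
  from R(3) obtain A B where AB: "\<And>n. good n (P n) (Q n) (A n) (B n)" "\<And>n. P (Suc n) \<le> A n / real (M n)^2" "\<And>n. B n * real (M n)^2 \<le> Q (Suc n)"
    by metis
  show thesis
  proof (rule that[of A B]; intro allI impI)
    fix i k :: nat assume "i < k"
    then have "P k \<le> A i / real (M i)^2" "B i * real (M i)^2 \<le> Q k" using Pm[of "Suc i" k] Qm[of "Suc i" k] AB(2,3)[of i] by auto
    moreover have "B k * real (M k)^2 \<le> P k \<or> Q k \<le> A k / real (M k)^2" using AB(1)[of k] by (simp add: good_def)
    ultimately show "B k * real (M k)^2 \<le> A i / real (M i)^2 \<or> B i * real (M i)^2 \<le> A k / real (M k)^2" by linarith
  qed (use AB(1) in \<open>auto simp: good_def\<close>)
qed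

section \<open>The inequality between the masses\<close>

text \<open>
  Put \<open>f = y + v\<close> and \<open>g = \<bar>x\<bar> + u + e\<close>. Increments of the mass of \<open>f\<close> over \<open>[4a, 4b]\<close> are at most those of \<open>g\<close>, and the masses of
  both sums are comparable with sums of masses up to a factor four in time: a factor two for each addition. The equivalence
  of \<open>u\<close> and \<open>v\<close> then trades \<open>U(4b)\<close> for \<open>V(\<kappa>b)\<close> and \<open>V(4a)\<close> for \<open>U(\<kappa>a)\<close>, so that the uncontrolled terms
  appear as increments of the same function.
\<close>
lemma core_inequality:
  assumes uv: "mass_equiv u v" and x: "x \<in> E" and y: "y \<in> E" and e: "e \<in> E"
    and pos: "AE t in lebesgue_on I. 0 \<le> y t" "AE t in lebesgue_on I. 0 \<le> e t"
    and le: "AE t in lebesgue_on I. y t + v t \<le> x t + u t + e t"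
  obtains L where "\<And>\<kappa> a b. L \<le> \<kappa> \<Longrightarrow> 0 < a \<Longrightarrow> a \<le> b \<Longrightarrow>
    mass y b + mass v b + mass x a + mass u a + mass e a
      \<le> mass x (\<kappa> * b) + mass v (\<kappa> * b) + mass e (\<kappa> * b) + mass y (\<kappa> * a) + mass u (\<kappa> * a)"
proof -
  obtain L where L: "L \<ge> 1" "\<And>t. t > 0 \<Longrightarrow> mass u t \<le> mass v (L * t)" "\<And>t. t > 0 \<Longrightarrow> mass v t \<le> mass u (L * t)"
    and uvE: "u \<in> E" "v \<in> E" "AE t in lebesgue_on I. 0 \<le> u t" "AE t in lebesgue_on I. 0 \<le> v t"
    using uv by (auto simp: mass_equiv_def)
  note E = E_L1Linf[OF x] E_L1Linf[OF y] E_L1Linf[OF e] E_L1Linf[OF uvE(1)] E_L1Linf[OF uvE(2)]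
  define x' where "x' t = \<bar>x t\<bar>" for t
  define xu where "xu t = x' t + u t" for t
  define f where "f t = y t + v t" for t
  define g where "g t = xu t + e t" for t
  have x': "x' \<in> L1Linf"
  proof (rule excess_le_in_L1_plus_Linf[OF _ E(1)])
    show "meas x'" using L1_plus_Linf_measD[OF E(1)] unfolding x'_def by measurable
    show "excess I x' s \<le> excess I x s" for s by (simp add: excess_def x'_def)
  qed
  have mx: "mass x' t = mass x t" for t unfolding x'_def by (rule mass_abs)
  have xu: "xu \<in> L1Linf" unfolding xu_def by (intro L1Linf_add x' E)
  have fL: "f \<in> L1Linf" unfolding f_def by (intro L1Linf_add E)
  have gL: "g \<in> L1Linf" unfolding g_def by (intro L1Linf_add xu E)
  have x'0: "AE t in lebesgue_on I. 0 \<le> x' t" by (simp add: x'_def)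
  have xu0: "AE t in lebesgue_on I. 0 \<le> xu t" using uvE(3) by eventually_elim (simp add: xu_def x'_def)
  have fg: "AE t in lebesgue_on I. \<bar>f t\<bar> \<le> \<bar>g t\<bar>" using le pos(1) uvE(4)
    by eventually_elim (auto simp: f_def g_def xu_def x'_def)
  show thesis
  proof (rule that[of "4 * L"])
    fix \<kappa> a b :: real assume \<kappa>: "4 * L \<le> \<kappa>" and ab: "0 < a" "a \<le> b"
    have b: "b > 0" using ab by simp
    \<comment> \<open>All times \<open>4s\<close> and \<open>4Ls\<close> that occur are at most \<open>\<kappa>s\<close>.\<close>
    have s4: "4 * s \<le> \<kappa> * s" "L * (4 * s) \<le> \<kappa> * s" if "s > 0" for s
    proof -
      have "4 \<le> 4 * L" using L by simp
      then have "4 \<le> \<kappa>" using \<kappa> by linarith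
      then show "4 * s \<le> \<kappa> * s" using that by (intro mult_right_mono) auto
      have "4 * L * s \<le> \<kappa> * s" using that \<kappa> by (intro mult_right_mono) auto
      then show "L * (4 * s) \<le> \<kappa> * s" by (simp add: mult_ac)
    qed
    have lower_f: "mass y b + mass v b \<le> mass f (4 * b)"
      using mass_add_ge[OF E(2,5) b pos(1) uvE(4)] mass_mono[OF fL, of "2 * b" "4 * b"] b unfolding f_def by linarith
    have lower_g: "mass x a + mass u a + mass e a \<le> mass g (4 * a)"
    proof -
      have "mass x a + mass u a \<le> mass xu (2 * a)"
        using mass_add_ge[OF x' E(4) ab(1) x'0 uvE(3)] unfolding mx xu_def .
      moreover have "mass e a \<le> mass e (2 * a)" using ab by (intro mass_mono E) auto
      moreover have "mass xu (2 * a) + mass e (2 * a) \<le> mass g (2 * (2 * a))"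
        unfolding g_def using ab by (intro mass_add_ge xu E xu0 pos) auto
      ultimately show ?thesis by simp
    qed
    have upper_g: "mass g (4 * b) \<le> mass x (4 * b) + mass u (4 * b) + mass e (4 * b)"
    proof -
      have b4: "0 < 4 * b" using b by simp
      have "mass g (4 * b) \<le> mass xu (4 * b) + mass e (4 * b)" unfolding g_def by (rule mass_add_le[OF xu E(3) b4])
      also have "mass xu (4 * b) \<le> mass x (4 * b) + mass u (4 * b)" unfolding xu_def mx[symmetric] by (rule mass_add_le[OF x' E(4) b4])
      finally show ?thesis by simp
    qed
    have upper_f: "mass f (4 * a) \<le> mass y (4 * a) + mass v (4 * a)"
      unfolding f_def using ab by (intro mass_add_le E) auto
    have "mass f (4 * b) + mass g (4 * a) \<le> mass g (4 * b) + mass f (4 * a)"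
      using ab by (intro mass_increment_mono fL gL fg) auto
    moreover have "mass x (4 * b) \<le> mass x (\<kappa> * b)" "mass e (4 * b) \<le> mass e (\<kappa> * b)" "mass y (4 * a) \<le> mass y (\<kappa> * a)"
      using ab b s4 by (auto intro!: mass_mono E)
    moreover have "mass u (4 * b) \<le> mass v (\<kappa> * b)"
      using L(2)[of "4 * b"] mass_mono[OF E(5), of "L * (4 * b)" "\<kappa> * b"] s4[OF b] b L(1) by simp
    moreover have "mass v (4 * a) \<le> mass u (\<kappa> * a)"
      using L(3)[of "4 * a"] mass_mono[OF E(4), of "L * (4 * a)" "\<kappa> * a"] s4[OF ab(1)] ab L(1) by simp
    ultimately show "mass y b + mass v b + mass x a + mass u a + mass e a
      \<le> mass x (\<kappa> * b) + mass v (\<kappa> * b) + mass e (\<kappa> * b) + mass y (\<kappa> * a) + mass u (\<kappa> * a)"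
      using lower_f lower_g upper_f upper_g by linarith
  qed
qed

end

section \<open>Construction of the submajorized function\<close>

context fs_space
begin

text \<open>
  The construction of \<open>y\<close> from the windows, and the contradiction for one large index \<open>k\<close>. The
  order of choices matters: the windows, the nodes and \<open>y\<close> depend on \<open>x\<close> and \<open>c\<close> only; then
  \<open>u, v, e, L\<close> arise from \<open>y\<close>; the index \<open>k\<close> is chosen last.
\<close>
lemma spread_rearr_null:
  assumes fat: "fatou_norm I E N" and x: "x \<in> E"
    and cond: "I = {0<..<1} \<or> (I = {0<..} \<and> \<not> E \<subseteq> {f. integrable (lebesgue_on I) f})"
    and detect: "\<And>\<phi> y. symmetric_functional_on I E \<phi> \<Longrightarrow> positive_functional_on I E \<phi> \<Longrightarrow>
           y \<in> L1_plus_Linf I \<Longrightarrow> (AE t in lebesgue_on I. 0 \<le> y t) \<Longrightarrow> submajorized I y x \<Longrightarrow> \<phi> y \<le> \<phi> x"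
  shows "(\<lambda>m. N (spread m (pos_rearr I x))) \<longlonglongrightarrow> 0"
proof -
  define f where "f = pos_rearr I x"
  have xL: "x \<in> L1Linf" by (rule E_L1Linf[OF x])
  have f: "decreasing f" "f \<in> E" and Nf: "N f \<le> N x" and mf: "\<And>t. t > 0 \<Longrightarrow> mass f t = mass x t"
    unfolding f_def using decreasing_pos_rearr[OF xL] pos_rearr_E[OF x] mass_pos_rearr[OF xL] by auto
  have fb: "f \<in> borel_measurable borel" and fL: "f \<in> L1Linf" using f by (auto simp: decreasing_def)
  have anti: "N (spread m f) \<le> N (spread n f)" if "1 \<le> n" "n \<le> m" for m n by (rule spread_norm_antimono[OF f that])
  have nonneg: "0 \<le> N (spread m f)" if "1 \<le> m" for m by (intro N_nonneg spread_E f fb that)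
  from null_or_bounded_below[of "\<lambda>m. N (spread m f)", OF anti nonneg]
  consider "(\<lambda>m. N (spread m f)) \<longlonglongrightarrow> 0" | c where "c > 0" "\<And>m. 1 \<le> m \<Longrightarrow> c \<le> N (spread m f)" by metis
  then show ?thesis
  proof cases
    case 1 then show ?thesis by (simp add: f_def)
  next
    case 2
    define M where "M k = block_ratio (k + 2)" for k
    define \<kappa> where "\<kappa> k = node_ratio (k + 2)" for k
    have M2: "M k \<ge> 2" and \<kappa>2: "\<kappa> k \<ge> 2" for k using node_ratio_ge[of "k + 2"] by (auto simp: M_def \<kappa>_def)
    have M\<kappa>: "real (M k) = (\<kappa> k ^ 2) ^ (k + 2)" for k unfolding M_def \<kappa>_def by (rule real_block_ratio)
    obtain A B where windows: "\<forall>k. 0 < A k \<and> A k < B k \<and> B k * real (M k)^2 \<in> I \<and> c / 4 \<le> N (spread (M k ^ 3) (window f {A k<..<B k}))"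
      and disjoint: "\<forall>i k. i < k \<longrightarrow> B k * real (M k)^2 \<le> A i / real (M i)^2 \<or> B i * real (M i)^2 \<le> A k / real (M k)^2"
      by (rule separated_windows[OF f fat cond 2(1), of M]) (assumption | rule 2(2) M2 that)+
    have A: "0 < A k" and AB: "A k < B k" and BI: "B k * real (M k)^2 \<in> I"
      and big: "c / 4 \<le> N (spread (M k ^ 3) (window f {A k<..<B k}))" for k using windows by auto
    have apart: "i < k \<Longrightarrow> B k * real (M k)^2 \<le> A i / real (M i)^2 \<or> B i * real (M i)^2 \<le> A k / real (M k)^2" for i k
      using disjoint by simp
    \<comment> \<open>The grid starts two blocks below the window, so that \<open>p k 2 = A k\<close>.\<close>
    define s where "s k = A k / real (M k)^2" for k
    define p where "p k i = s k * real (M k) ^ i" for k i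
    have Mpos: "real (M k) > 0" "real (M k) > 1" "real (M k) \<ge> 2" for k using M2[of k] by auto
    have s0: "s k > 0" for k using A[of k] Mpos[of k] by (simp add: s_def)
    have p0: "p k i > 0" for k i using s0[of k] Mpos[of k] by (simp add: p_def)
    have pS: "p k (Suc i) = real (M k) * p k i" for k i by (simp add: p_def)
    have p2: "p k 2 = A k" for k using Mpos[of k] by (simp add: p_def s_def)
    have pmono: "i \<le> j \<Longrightarrow> p k i \<le> p k j" for i j k
      using s0[of k] Mpos[of k] by (auto simp: p_def intro!: mult_left_mono power_increasing)
    have "\<exists>n\<ge>2. B k \<le> p k n \<and> p k (Suc n) \<le> B k * real (M k)^2" for k
    proof -
      obtain n0 where "B k / s k < real (M k) ^ n0" using real_arch_pow[OF Mpos(2)] by blast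
      then have "B k < s k * real (M k) ^ n0" using s0[of k] by (simp add: field_simps)
      moreover have "s k * real (M k) ^ 2 \<le> B k" using p2[of k] AB[of k] by (simp add: p_def)
      ultimately obtain j where j: "2 \<le> j" "s k * real (M k) ^ j \<le> B k" "B k < s k * real (M k) ^ Suc j"
        using block_index[OF s0 Mpos(2)] by metis
      then have "B k \<le> p k (Suc j)" by (simp add: p_def)
      moreover have "p k (Suc (Suc j)) = p k j * real (M k)^2" by (simp add: p_def power2_eq_square)
      moreover have "p k j * real (M k)^2 \<le> B k * real (M k)^2" using j(2) by (intro mult_right_mono) (auto simp: p_def)
      ultimately show ?thesis using j(1) by (intro exI[of _ "Suc j"]) auto
    qed
    then obtain n where n: "\<And>k. 2 \<le> n k" "\<And>k. B k \<le> p k (n k)" "\<And>k. p k (Suc (n k)) \<le> B k * real (M k)^2" by metis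
    have "\<exists>\<tau>. p k i \<le> \<tau> / \<kappa> k \<and> \<kappa> k * \<tau> \<le> p k (Suc i) \<and>
       mass f (\<kappa> k * \<tau>) - mass f (\<tau> / \<kappa> k) \<le> (mass f (p k (Suc i)) - mass f (p k i)) / real (k + 2)" for k i
    proof -
      have "1 \<le> k + 2" "1 \<le> \<kappa> k" using \<kappa>2[of k] by auto
      from sparse_block[OF this p0, of k i "mass f"] show ?thesis
        unfolding pS M\<kappa> by metis
    qed
    then obtain \<tau> where \<tau>: "\<And>k i. p k i \<le> \<tau> k i / \<kappa> k" "\<And>k i. \<kappa> k * \<tau> k i \<le> p k (Suc i)"
       "\<And>k i. mass f (\<kappa> k * \<tau> k i) - mass f (\<tau> k i / \<kappa> k) \<le> (mass f (p k (Suc i)) - mass f (p k i)) / real (k + 2)"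
      by metis
    have \<tau>0: "\<tau> k i > 0" for k i
    proof -
      have "0 < \<tau> k i / \<kappa> k" using \<tau>(1)[of k i] p0[of k i] by linarith
      then show ?thesis using \<kappa>2[of k] by (simp add: zero_less_divide_iff)
    qed
    have in_block: "p k i \<le> \<tau> k i" "\<tau> k i < p k (Suc i)" for k i
    proof -
      have "1 * \<tau> k i < \<kappa> k * \<tau> k i" using \<kappa>2[of k] \<tau>0[of k i] by (intro mult_strict_right_mono) auto
      then show "\<tau> k i < p k (Suc i)" using \<tau>(2)[of k i] by simp
      have "\<tau> k i / \<kappa> k \<le> \<tau> k i / 1" using \<kappa>2[of k] \<tau>0[of k i] by (intro divide_left_mono) auto
      then show "p k i \<le> \<tau> k i" using \<tau>(1)[of k i] by simp
    qed
    have \<tau>_less: "\<tau> k i < \<tau> k (Suc i)" for k i using in_block(2)[of k i] in_block(1)[of k "Suc i"] by simp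
    have \<tau>_mono: "i \<le> j \<Longrightarrow> \<tau> k i \<le> \<tau> k j" for i j k
      using lift_Suc_mono_le[of "\<tau> k"] \<tau>_less[of k] by (simp add: less_imp_le)
    have \<tau>_range: "A k / real (M k)^2 \<le> \<tau> k i" "i \<le> n k \<Longrightarrow> \<tau> k i \<le> B k * real (M k)^2" for k i
    proof -
      have "p k 0 \<le> \<tau> k i" using pmono[of 0 i k] in_block(1)[of k i] by simp
      then show "A k / real (M k)^2 \<le> \<tau> k i" by (simp add: p_def s_def)
      assume "i \<le> n k"
      then have "p k (Suc i) \<le> p k (Suc (n k))" by (intro pmono) simp
      then show "\<tau> k i \<le> B k * real (M k)^2" using n(3)[of k] in_block(2)[of k i] by simp
    qed
    \<comment> \<open>Only the nodes up to index \<open>n k\<close> are used; the later ones leave the range reserved for the window.\<close>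
    define C where "C = (\<Union>k. (\<lambda>i. (\<tau> k i, \<tau> k (Suc i))) ` {..<n k})"
    have C: "cell_family C" unfolding cell_family_def
    proof (intro conjI)
      show "countable C" unfolding C_def by auto
      show "\<forall>(\<alpha>, \<beta>)\<in>C. 0 < \<alpha> \<and> \<alpha> < \<beta> \<and> \<beta> \<in> I"
      proof (safe)
        fix \<alpha> \<beta> assume "(\<alpha>, \<beta>) \<in> C"
        then obtain k i where i: "i < n k" "\<alpha> = \<tau> k i" "\<beta> = \<tau> k (Suc i)" by (auto simp: C_def)
        show "0 < \<alpha>" "\<alpha> < \<beta>" using i \<tau>0 \<tau>_less by auto
        show "\<beta> \<in> I" using I_down[OF BI[of k], of \<beta>] i \<tau>0 \<tau>_range(2)[of "Suc i" k] by simp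
      qed
      have sep: "\<beta> \<le> \<alpha>' \<or> \<beta>' \<le> \<alpha>"
        if "(\<alpha>, \<beta>) = (\<tau> k i, \<tau> k (Suc i))" "i < n k" "(\<alpha>', \<beta>') = (\<tau> l j, \<tau> l (Suc j))" "j < n l" "k < l" for \<alpha> \<beta> \<alpha>' \<beta>' k i l j
        using apart[OF that(5)] \<tau>_range(1)[of k i] \<tau>_range(1)[of l j] \<tau>_range(2)[of "Suc i" k] \<tau>_range(2)[of "Suc j" l] that by auto
      have "c = d \<or> snd c \<le> fst d \<or> snd d \<le> fst c" if cd: "c \<in> C" "d \<in> C" for c d
      proof -
        obtain k i l j where ij: "i < n k" "c = (\<tau> k i, \<tau> k (Suc i))" "j < n l" "d = (\<tau> l j, \<tau> l (Suc j))"
          using cd unfolding C_def by blast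
        consider "k < l" | "l < k" | "k = l" "i = j" | "k = l" "Suc i \<le> j" | "k = l" "Suc j \<le> i" by linarith
        then show ?thesis
        proof cases
          case 1 then show ?thesis using sep[OF _ ij(1) _ ij(3)] ij by auto
        next
          case 2 then show ?thesis using sep[OF _ ij(3) _ ij(1)] ij by auto
        qed (use \<tau>_mono[of "Suc i" j k] \<tau>_mono[of "Suc j" i k] ij in auto)
      qed
      then show "\<forall>(\<alpha>,\<beta>)\<in>C. \<forall>(\<alpha>',\<beta>')\<in>C. (\<alpha>,\<beta>) = (\<alpha>',\<beta>') \<or> \<beta> \<le> \<alpha>' \<or> \<beta>' \<le> \<alpha>"
        by fastforce
    qed
    define y where "y = average C f"
    have y: "decreasing y" unfolding y_def by (rule decreasing_average[OF C f(1)])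
    have yL: "y \<in> L1Linf" using y by (simp add: decreasing_def)
    have yle: "mass y t \<le> mass x t" if "t > 0" for t
      using mass_average_le[OF C f(1) that] mf[OF that] by (simp add: y_def)
    have yE: "y \<in> E" by (rule dominated(1)[OF x yL yle])
    have y0: "AE t in lebesgue_on I. 0 \<le> y t" using y I_pos by (intro AE_I2) (auto simp: decreasing_def)
    have "submajorized I y x" by (rule submajorizedI[OF yL xL yle])
    \<comment> \<open>The functionals do not exceed their value at \<open>x\<close>, so the detection lemma applies to \<open>y\<close>.\<close>
    note le_x = detect[OF _ _ yL y0 this]
    have c16: "c / 16 > 0" using 2(1) by simp
    obtain u v e where uv: "mass_equiv u v" and e: "e \<in> E" "AE t in lebesgue_on I. 0 \<le> e t" "N e < c / 16"
      and le: "AE t in lebesgue_on I. y t + v t \<le> x t + u t + e t"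
      by (rule symmetric_functionals_detect[OF x yE c16]) (assumption | rule le_x that)+
    have uvE: "u \<in> E" "v \<in> E" using uv by (auto simp: mass_equiv_def)
    obtain L where L: "\<And>\<kappa> a b. L \<le> \<kappa> \<Longrightarrow> 0 < a \<Longrightarrow> a \<le> b \<Longrightarrow>
       mass y b + mass v b + mass x a + mass u a + mass e a
      \<le> mass x (\<kappa> * b) + mass v (\<kappa> * b) + mass e (\<kappa> * b) + mass y (\<kappa> * a) + mass u (\<kappa> * a)"
      using core_inequality[OF uv x yE e(1) y0 e(2) le] by metis
    define T where "T = N x + N u + N v"
    have T0: "T \<ge> 0" using N_nonneg x uvE by (simp add: T_def)
    obtain k :: nat where k: "max L (16 * T / c) < real k" using reals_Archimedean2 by blast
    define K where "K = k + 2"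
    have K2: "K \<ge> 2" and KL: "L \<le> real K" using k by (auto simp: K_def)
    have KT: "T / real K < c / 16"
    proof -
      have "16 * T / c < real K" using k by (simp add: K_def)
      then show ?thesis using 2(1) K2 by (simp add: field_simps)
    qed
    define e' u' v' where "e' = pos_rearr I e" and "u' = pos_rearr I u" and "v' = pos_rearr I v"
    note primes = e'_def u'_def v'_def
    define h where "h t = 2 * (e' t + 1 / real K * ((f t + u' t) + v' t))" for t
    define H where "H t = mass e t + (mass f t + mass u t + mass v t) / real K" for t
    note EL = E_L1Linf[OF e(1)] E_L1Linf[OF uvE(1)] E_L1Linf[OF uvE(2)]
    note dec = decreasing_pos_rearr[OF EL(1), folded primes] decreasing_pos_rearr[OF EL(2), folded primes]
      decreasing_pos_rearr[OF EL(3), folded primes]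
    have hdec: "decreasing h" unfolding h_def using K2 by (intro decreasing_cmult decreasing_add dec f) auto
    have hmass: "mass h t = 2 * H t" if t: "t > 0" for t
    proof -
      have d1: "decreasing (\<lambda>t. f t + u' t)" by (intro decreasing_add dec f)
      have d2: "decreasing (\<lambda>t. (f t + u' t) + v' t)" by (intro decreasing_add d1 dec f)
      have d3: "decreasing (\<lambda>t. 1 / real K * ((f t + u' t) + v' t))" by (intro decreasing_cmult d2) auto
      have d4: "decreasing (\<lambda>t. e' t + 1 / real K * ((f t + u' t) + v' t))" by (intro decreasing_add dec d3)
      have LL: "g \<in> L1Linf" if "decreasing g" for g using that by (simp add: decreasing_def)
      have "mass h t = 2 * mass (\<lambda>t. e' t + 1 / real K * ((f t + u' t) + v' t)) t"
        unfolding h_def by (rule mass_cmult[OF LL[OF d4] t]) simp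
      also have "\<dots> = 2 * (mass e' t + mass (\<lambda>t. 1 / real K * ((f t + u' t) + v' t)) t)"
        by (simp only: mass_decreasing_add[OF dec(1) d3 t])
      also have "mass (\<lambda>t. 1 / real K * ((f t + u' t) + v' t)) t = 1 / real K * mass (\<lambda>t. (f t + u' t) + v' t) t"
        using K2 by (intro mass_cmult[OF LL[OF d2] t]) simp
      also have "mass (\<lambda>t. (f t + u' t) + v' t) t = mass f t + mass u' t + mass v' t"
        by (simp only: mass_decreasing_add[OF d1 dec(3) t] mass_decreasing_add[OF f(1) dec(2) t])
      finally show ?thesis unfolding H_def using mass_pos_rearr[OF _ t] EL by (simp add: primes)
    qed
    have hL: "h \<in> L1Linf" using hdec by (simp add: decreasing_def)
    note PE = pos_rearr_E[OF e(1), folded primes] pos_rearr_E[OF uvE(1), folded primes] pos_rearr_E[OF uvE(2), folded primes]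
    have hE: "h \<in> E" unfolding h_def by (intro E_cmult E_add PE f)
    have hN: "N h \<le> 2 * (N e + T / real K)"
    proof -
      have g1: "(\<lambda>t. (f t + u' t) + v' t) \<in> E" by (intro E_add PE f)
      have g2: "(\<lambda>t. 1 / real K * ((f t + u' t) + v' t)) \<in> E" by (intro E_cmult g1)
      have g3: "(\<lambda>t. e' t + 1 / real K * ((f t + u' t) + v' t)) \<in> E" by (intro E_add PE g2)
      have 1: "N h = 2 * N (\<lambda>t. e' t + 1 / real K * ((f t + u' t) + v' t))"
        unfolding h_def N_cmult[OF g3] by simp
      have 2: "N (\<lambda>t. e' t + 1 / real K * ((f t + u' t) + v' t))
         \<le> N e' + N (\<lambda>t. 1 / real K * ((f t + u' t) + v' t))"
        by (intro N_add PE g2)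
      have 3: "N (\<lambda>t. 1 / real K * ((f t + u' t) + v' t)) = 1 / real K * N (\<lambda>t. (f t + u' t) + v' t)"
        unfolding N_cmult[OF g1] by simp
      have 4: "N (\<lambda>t. (f t + u' t) + v' t) \<le> N (\<lambda>t. f t + u' t) + N v'"
        by (intro N_add E_add PE f)
      have 5: "N (\<lambda>t. f t + u' t) \<le> N f + N u'" by (intro N_add PE f)
      have "N (\<lambda>t. (f t + u' t) + v' t) \<le> T" using 4 5 Nf PE unfolding T_def by linarith
      then have "1 / real K * N (\<lambda>t. (f t + u' t) + v' t) \<le> 1 / real K * T" by (intro mult_left_mono) auto
      then have "N (\<lambda>t. 1 / real K * ((f t + u' t) + v' t)) \<le> T / real K" unfolding 3 by simp
      then have "N (\<lambda>t. e' t + 1 / real K * ((f t + u' t) + v' t)) \<le> N e + T / real K"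
        using 2 PE(2) by (meson add_mono order_trans)
      then show ?thesis unfolding 1 by simp
    qed
    have grid: "mass f (p k j) - mass f (p k 1) \<le> 2 * H (p k (Suc j))" if j: "j \<le> n k" for j
      unfolding H_def p_def M_def K_def[symmetric]
    proof (rule window_increments[where k = K and s = "s k" and X = "mass f" and Y = "mass y" and U = "mass u" and V = "mass v" and D = "mass e" and \<tau> = "\<tau> k" and n = "n k" and j = j])
      show "2 \<le> K" by (rule K2)
      show "0 < s k" by (rule s0)
      show "j \<le> n k" by (rule j)
      show "F a \<le> F b" if "F \<in> {mass f, mass y, mass u, mass v, mass e}" "0 < a" "a \<le> b" for F a b
        using that mass_mono fL yL EL by auto
      show "0 \<le> F a" if "F \<in> {mass f, mass y, mass u, mass v, mass e}" for F a using that by auto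
      show "mass y b + mass v b + mass f a + mass u a + mass e a
         \<le> mass f (real K * b) + mass v (real K * b) + mass e (real K * b) + mass y (real K * a) + mass u (real K * a)" if "0 < a" "a \<le> b" for a b
        using L[OF KL that] that K2 mf[of a] mf[of "real K * b"] by simp
      show "s k * real (block_ratio K) ^ i \<le> \<tau> k i / node_ratio K" for i
        using \<tau>(1)[where k = k and i = i] unfolding p_def M_def \<kappa>_def K_def .
      show "node_ratio K * \<tau> k i \<le> s k * real (block_ratio K) ^ Suc i" for i
        using \<tau>(2)[where k = k and i = i] unfolding p_def M_def \<kappa>_def K_def .
      show "mass f (node_ratio K * \<tau> k i) - mass f (\<tau> k i / node_ratio K) \<le> (mass f (s k * real (block_ratio K) ^ Suc i) - mass f (s k * real (block_ratio K) ^ i)) / real K" for i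
        using \<tau>(3)[where k = k and i = i] unfolding p_def M_def \<kappa>_def K_def .
      fix i r assume i: "i < n k" and r: "\<tau> k i \<le> r" "r \<le> \<tau> k (Suc i)"
      have cC: "(\<tau> k i, \<tau> k (Suc i)) \<in> C" unfolding C_def using i by blast
      show "mass y (\<tau> k (Suc i)) - mass y r = (\<tau> k (Suc i) - r) * ((mass f (\<tau> k (Suc i)) - mass f (\<tau> k i)) / (\<tau> k (Suc i) - \<tau> k i))"
        using mass_average_cell[OF C f(1) cC, of r] r unfolding y_def by (simp add: cell_mean_def)
    qed
    have spread_le: "mass (spread (M k ^ 3) (window f {A k<..<B k})) t \<le> mass h t" if t: "t > 0" for t
      unfolding hmass[OF t]
    proof (rule spread_window_mass_le[where p = "p k" and s = "s k" and n = "n k"])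
      have B0: "B k > 0" using A[of k] AB[of k] by linarith
      have "1 \<le> real (M k)^2" using Mpos[of k] by simp
      then have "B k * 1 \<le> B k * real (M k)^2" using B0 by (intro mult_left_mono) auto
      then show "B k \<in> I" using I_down[OF BI[of k] B0] by simp
      show "p k (Suc (n k)) \<in> I" using I_down[OF BI[of k] p0 n(3)] .
      show "H t \<le> H r" if "0 < t" "t \<le> r" for t r using mass_mono[OF hL that] hmass that by simp
      show "t / r * H r \<le> H t" if "0 < t" "t \<le> r" for t r
      proof -
        have "t / r * (2 * H r) \<le> 2 * H t" using mass_concave[OF hL that] hmass[of t] hmass[of r] that by simp
        moreover have "w * a \<le> b" if "w * (2 * a) \<le> 2 * b" for w a b :: real using that by (simp add: mult.left_commute)
        ultimately show ?thesis by blast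
      qed
    qed (use f A s0 M2 n p2 grid t in \<open>auto simp: p_def\<close>)
    have M3: "M k ^ 3 \<ge> 1" using M2[of k] by simp
    have "c / 4 \<le> N (spread (M k ^ 3) (window f {A k<..<B k}))" by (rule big)
    also have "\<dots> \<le> N h"
      by (rule dominated(2)[OF hE _ spread_le]) (intro spread_L1Linf window_L1Linf window_borel fb fL M3, auto)
    also have "\<dots> \<le> 2 * (N e + T / real K)" by (rule hN)
    also have "\<dots> < 2 * (c / 16 + c / 16)" by (intro mult_strict_left_mono add_strict_mono e(3) KT) simp
    finally show ?thesis by simp
  qed
qed

end

theorem theorem47:
  fixes I :: "real set" and E :: "(real \<Rightarrow> real) set"
    and N :: "(real \<Rightarrow> real) \<Rightarrow> real" and x :: "real \<Rightarrow> real"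
  assumes "I = {0<..<1} \<or> I = {0<..}"
    and "fully_symmetric_space I E N"
    and "fatou_norm I E N"
    and "x \<in> E"
    and "\<And>\<phi> y. symmetric_functional_on I E \<phi> \<Longrightarrow> positive_functional_on I E \<phi> \<Longrightarrow>
           y \<in> L1_plus_Linf I \<Longrightarrow> (AE t in lebesgue_on I. 0 \<le> y t) \<Longrightarrow> submajorized I y x \<Longrightarrow>
           \<phi> y \<le> \<phi> x"
    and "I = {0<..<1} \<or> (I = {0<..} \<and> \<not> E \<subseteq> {f. integrable (lebesgue_on I) f})"
  shows "(\<lambda>m. (1 / real m) * N (dilation m (rearr I x))) \<longlonglongrightarrow> 0"
proof -
  interpret fs_space I E N using assms(1,2) by unfold_locales
  define f where "f = pos_rearr I x"
  have xL: "x \<in> L1Linf" by (rule E_L1Linf[OF assms(4)])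
  have fE: "f \<in> E" and fb: "f \<in> borel_measurable borel"
    unfolding f_def using pos_rearr_E[OF assms(4)] pos_rearr_borel[OF xL] by auto
  have "(1 / real m) * N (dilation m (rearr I x)) = N (spread m f)" if m: "m \<ge> 1" for m
  proof -
    have sE: "spread m f \<in> E" by (rule spread_E(1)[OF fE fb m])
    have dil: "dilation m (rearr I x) t = real m * spread m f t" if "t \<in> I" for t
      using I_pos[OF that] m by (simp add: dilation_def spread_def f_def pos_rearr_def)
    have "meas (dilation m (rearr I x))"
      by (rule measurable_lebesgue_cong[of I "dilation m (rearr I x)" "\<lambda>t. real m * spread m f t", OF dil, THEN iffD2, OF _ E_meas[OF E_cmult[OF sE]]])
    moreover have "AE t in lebesgue_on I. dilation m (rearr I x) t = real m * spread m f t"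
      using dil by (intro AE_I2) simp
    ultimately have "N (dilation m (rearr I x)) = N (\<lambda>t. real m * spread m f t)"
      by (rule N_AE_cong(2)[OF E_cmult[OF sE]])
    also have "\<dots> = real m * N (spread m f)" using N_cmult[OF sE, of "real m"] by simp
    finally show ?thesis using m by simp
  qed
  then have "\<forall>\<^sub>F m in sequentially. N (spread m f) = (1 / real m) * N (dilation m (rearr I x))"
    by (intro eventually_sequentiallyI[of 1]) simp
  moreover have "(\<lambda>m. N (spread m f)) \<longlonglongrightarrow> 0"
    unfolding f_def by (rule spread_rearr_null[OF assms(3,4,6,5)])
  ultimately show ?thesis by (rule Lim_transform_eventually[rotated])
qed

end
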